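(* Let $N$ be a large positive number, $P=N^{1/3}$, and $f(\alpha)=\sum_{1\le x\le P}e(\alpha x^3)$. Let $\mathfrak{n}$ be the set of $\alpha\in[0,1)$ with the property that whenever $q\in\mathbb{N}$ and $q\alpha$ differs from an integer by at most $P^{-9/4}$, then $q>P^{3/4}$. Define $$M_h(N)=\sum_{N/2<n\le N}\Bigl|\int_{\mathfrak{n}}f(\alpha)^5e(-n\alpha)\,d\alpha\Bigr|^h.$$ Then for $h\ge2$ and each $\varepsilon>0$, $$M_h(N)\ll N^{\varepsilon}\bigl(N^{\frac{11}{12}h}+N^{\frac89h+\frac29}+N^{\frac34h+\frac23}\bigr).$$
   Context: Here $e(z)=\exp(2\pi i z)$. The implied constant may depend on $\varepsilon$ and $h$, and the bound holds for all sufficiently large $N$. *)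

theory Defs
  imports "HOL-Analysis.Analysis" "HOL-Library.Landau_Symbols"
begin

definition ee :: "real \<Rightarrow> complex" where
  "ee z = exp (2 * of_real pi * \<i> * of_real z)"

definition cubic_sum :: "real \<Rightarrow> real \<Rightarrow> complex" where
  "cubic_sum P \<alpha> = (\<Sum>x | 1 \<le> x \<and> real x \<le> P. ee (\<alpha> * real x ^ 3))"

definition minor_arcs :: "real \<Rightarrow> real set" where
  "minor_arcs P = {\<alpha> \<in> {0..<1}. \<forall>q::nat. q \<ge> 1 \<longrightarrow>
     (\<exists>a::int. \<bar>real q * \<alpha> - of_int a\<bar> \<le> P powr (-9/4)) \<longrightarrow> real q > P powr (3/4)}"

(* The parameter N is real, so P = N powr (1/3) is the usual cube root when N > 0.
   The exponent h is real as well, with 0 powr h = 0 where the integral vanishes. *)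
definition minor_arc_moment :: "real \<Rightarrow> real \<Rightarrow> real" where
  "minor_arc_moment h N = (\<Sum>n::nat | N / 2 < real n \<and> real n \<le> N.
     cmod (LINT \<alpha>:minor_arcs (N powr (1/3))|lborel.
             cubic_sum (N powr (1/3)) \<alpha> ^ 5 * ee (- (real n * \<alpha>))) powr h)"

end

(* Let c(n) be the n-th Fourier coefficient of f^5 restricted to the minor arcs. On the minor arcs
   |f| is at most P^(3/4+eps), up to exceptional neighbourhoods of rationals whose contribution is
   controlled by the mean square of f there. With Hua's lemma, Bessel's inequality gives
   sum |c(n)|^2 << P^(13/2+eps).

   For a set S of Z integers n with |c(n)| >= T, put K(alpha) = sum_{n in S} b(n) e(n alpha) with
   suitable unimodular b(n); then T Z is at most the integral of |f|^5 |K| over the minor arcs.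
   Squaring out, the integral of |f K|^2 counts pairs u, u' in S with u - u' = (z+h)^3 - z^3.
   For fixed h, Cauchy-Schwarz over u in S and the divisor bound for
   3 h (z-z') (z+z'+h) = u'' - u' give P Z + P^(1/2+eps) Z^(3/2). The same argument for the
   multiset S + {x^3}, which for Z <= P has few coincidences, bounds the integral of |f^2 K|^2
   by P^(2+eps) Z^(3/2). In both ranges T^4 Z << P^(11+eps), hence sum |c(n)|^4 << P^(11+eps).

   Interpolation between the two moments gives N^eps (N^(11h/12) + N^(3h/4+2/3)). *)

theory Submission
  imports Defs
begin

section \<open>The divisor function\<close>

text \<open>On the minor arcs Weyl's inequality reads |f|^4 << X^3 + X^4 / lam, where lam = q (1 +
  X^3 |\<alpha> - a/q|) >> X^(3/4). It yields |f| << X^(3/4) only for lam >= X; below that it loses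
  up to X^(1/16). There 1 / lam is kept as a weight: the integral of |f|^2 against the sum of all
  such weights is << X^(-1+eps), which needs no approximation of f by complete sums.

  The target for T^4 Z is the fourth moment, since the exponents 11h/12 and 3h/4 + 2/3 meet at h =
  4. It asks that the integral of |f|^5 |K| be << X^(11/4) Z^(3/4). For Z >= X this is the square
  root of Hua's X^5 times X^(1/2) Z^(3/2). For Z < X the diagonal term X Z would be too large in
  that count; X^(3/4) times the square root of X^2 times X^2 Z^(3/2) then gives the same bound.

  All losses N^eps are collected in one number \<open>D\<close>, which dominates divisor counts and
  harmonic sums, so that every intermediate estimate has an explicit constant.\<close>

lemma card_divisors_prime_power_mult:
  fixes p m a :: nat
  assumes "prime p" "m > 0"
  shows "card {d. d dvd p ^ a * m} \<le> (a + 1) * card {d. d dvd m}"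
proof -
  have fin: "finite {d. d dvd m}"
    using assms by (simp add: finite_divisors_nat)
  have "{d. d dvd p ^ a * m} \<subseteq> (\<lambda>(i, e). p ^ i * e) ` ({..a} \<times> {d. d dvd m})"
  proof
    fix d assume "d \<in> {d. d dvd p ^ a * m}"
    then obtain b c where bc: "d = b * c" "b dvd p ^ a" "c dvd m"
      using division_decomp by blast
    obtain i where "i \<le> a" "b = p ^ i"
      using bc(2) assms(1) by (auto simp: divides_primepow_nat)
    with bc show "d \<in> (\<lambda>(i, e). p ^ i * e) ` ({..a} \<times> {d. d dvd m})"
      by force
  qed
  then have "card {d. d dvd p ^ a * m} \<le> card ({..a} \<times> {d. d dvd m})"
    using fin by (meson card_image_le card_mono finite_SigmaI finite_atMost finite_imageI order_trans)
  then show ?thesis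
    by (simp add: card_cartesian_product)
qed

text \<open>One prime power is split off at a time: \<open>a + 1\<close> is at most p^(\<epsilon> a)
  as soon as p >= 2^(1/\<epsilon>), and the finitely many smaller primes cost one constant factor
  \<open>c\<close> each.\<close>

theorem card_divisors_le_powr:
  fixes \<epsilon> :: real
  assumes "\<epsilon> > 0"
  obtains C where "C \<ge> 1" "\<And>n::nat. n > 0 \<Longrightarrow> real (card {d. d dvd n}) \<le> C * real n powr \<epsilon>"
proof -
  define B where "B = nat \<lceil>2 powr (1 / \<epsilon>)\<rceil>"
  \<comment> \<open>Chosen so that c \<epsilon> ln 2 >= 1; then a + 1 <= c (1 + \<epsilon> a ln 2),
    which is below c 2^(\<epsilon> a).\<close>
  define c where "c = max 1 (1 / (\<epsilon> * ln 2))"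
  have c1: "c \<ge> 1" by (simp add: c_def)
  have small: "real a + 1 \<le> c * real p powr (\<epsilon> * real a)" if "prime p" for a p :: nat
  proof -
    have p2: "real p \<ge> 2" using prime_ge_2_nat[OF that] by linarith
    have l2: "\<epsilon> * ln 2 > 0" using assms by simp
    have "1 / (\<epsilon> * ln 2) * (\<epsilon> * ln 2) \<le> c * (\<epsilon> * ln 2)"
      using l2 by (intro mult_right_mono) (auto simp: c_def)
    then have "1 \<le> c * (\<epsilon> * ln 2)"
      using l2 assms by simp
    then have "real a * 1 \<le> real a * (c * (\<epsilon> * ln 2))"
      by (intro mult_left_mono) auto
    then have "real a + 1 \<le> c * (1 + \<epsilon> * real a * ln 2)"
      using c1 by (simp add: algebra_simps)
    also have "\<dots> \<le> c * exp (\<epsilon> * real a * ln 2)"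
      using c1 exp_ge_add_one_self[of "\<epsilon> * real a * ln 2"] by (intro mult_left_mono) auto
    also have "exp (\<epsilon> * real a * ln 2) = 2 powr (\<epsilon> * real a)"
      by (simp add: powr_def)
    also have "c * 2 powr (\<epsilon> * real a) \<le> c * real p powr (\<epsilon> * real a)"
      using c1 p2 assms by (intro mult_left_mono powr_mono2) auto
    finally show ?thesis .
  qed
  have large: "real a + 1 \<le> real p powr (\<epsilon> * real a)" if "prime p" "p \<ge> B" for a p :: nat
  proof -
    have "2 powr (1 / \<epsilon>) \<le> real p"
      using that(2) unfolding B_def by linarith
    then have "(2 powr (1 / \<epsilon>)) powr (\<epsilon> * real a) \<le> real p powr (\<epsilon> * real a)"
      using assms by (intro powr_mono2) auto
    moreover have "(2 powr (1 / \<epsilon>)) powr (\<epsilon> * real a) = 2 ^ a"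
      using assms by (simp add: powr_powr powr_realpow)
    moreover have "real a + 1 \<le> 2 ^ a"
      by (induction a) auto
    ultimately show ?thesis by linarith
  qed
  \<comment> \<open>The exponent counts the small prime factors of \<open>n\<close>, so the
    induction picks up a factor \<open>c\<close> exactly when the removed prime is below
    \<open>B\<close>.\<close>
  have main: "real (card {d. d dvd n}) \<le> c ^ card {p \<in> prime_factors n. p < B} * real n powr \<epsilon>"
    if "n > 0" for n :: nat
    using that
  proof (induction n rule: less_induct)
    case (less n)
    show ?case
    proof (cases "n = 1")
      case True
      then show ?thesis using c1 by simp
    next
      case False
      then obtain p where p: "prime p" "p dvd n"
        using prime_factor_nat by blast
      define a where "a = multiplicity p n"
      obtain m where nm: "n = p ^ a * m" and pm: "\<not> p dvd m"
        using multiplicity_decompose'[of n p] p less.prems prime_elem_def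
        unfolding a_def by (metis not_prime_unit not_gr_zero prime_imp_prime_elem)
      have a0: "a > 0"
        using p less.prems unfolding a_def by (simp add: prime_multiplicity_gt_zero_iff)
      have m0: "m > 0" using nm less.prems by (cases m) auto
      have "p ^ a \<ge> 2"
        using a0 prime_ge_2_nat[OF p(1)] by (metis self_le_power le_trans le_numeral_extra(4) one_le_numeral order_trans)
      then have "m < n" using nm m0 by (simp add: nm)
      have pf: "prime_factors n = insert p (prime_factors m)"
      proof (intro set_eqI)
        fix q
        have "q \<in> prime_factors n \<longleftrightarrow> prime q \<and> (q dvd p ^ a \<or> q dvd m)"
          using less.prems unfolding nm by (auto simp: in_prime_factors_iff prime_dvd_mult_iff)
        also have "\<dots> \<longleftrightarrow> q = p \<or> prime q \<and> q dvd m"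
          using p(1) a0 by (metis dvd_power prime_dvd_power primes_dvd_imp_eq)
        finally show "q \<in> prime_factors n \<longleftrightarrow> q \<in> insert p (prime_factors m)"
          using m0 by (auto simp: in_prime_factors_iff)
      qed
      have npow: "real n powr \<epsilon> = real p powr (\<epsilon> * real a) * real m powr \<epsilon>"
        using prime_gt_0_nat[OF p(1)] unfolding nm
        by (simp add: powr_mult powr_powr powr_realpow[symmetric] mult.commute)
      have pn: "p \<notin> prime_factors m" using pm by (simp add: in_prime_factors_iff)
      have "real (card {d. d dvd n}) \<le> real ((a + 1) * card {d. d dvd m})"
        unfolding nm by (intro of_nat_mono card_divisors_prime_power_mult p m0)
      also have "\<dots> = (real a + 1) * real (card {d. d dvd m})"
        by (simp only: of_nat_mult of_nat_add of_nat_1)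
      also have "\<dots> \<le> (real a + 1) * (c ^ card {p \<in> prime_factors m. p < B} * real m powr \<epsilon>)"
        using less.IH[OF \<open>m < n\<close> m0] by (intro mult_left_mono) auto
      also have "\<dots> \<le> c ^ card {p \<in> prime_factors n. p < B} * real n powr \<epsilon>"
      proof (cases "p < B")
        case True
        then have "{q \<in> prime_factors n. q < B} = insert p {q \<in> prime_factors m. q < B}"
          unfolding pf by auto
        then have card: "card {q \<in> prime_factors n. q < B} = Suc (card {q \<in> prime_factors m. q < B})"
          using pn by simp
        have "(real a + 1) * (c ^ card {p \<in> prime_factors m. p < B} * real m powr \<epsilon>)
            \<le> (c * real p powr (\<epsilon> * real a)) * (c ^ card {p \<in> prime_factors m. p < B} * real m powr \<epsilon>)"
          using small[OF p(1), of a] c1 by (intro mult_right_mono) auto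
        then show ?thesis
          unfolding card npow by (simp add: mult_ac)
      next
        case False
        then have card: "{q \<in> prime_factors n. q < B} = {q \<in> prime_factors m. q < B}"
          unfolding pf by auto
        have "(real a + 1) * (c ^ card {p \<in> prime_factors m. p < B} * real m powr \<epsilon>)
            \<le> (real p powr (\<epsilon> * real a)) * (c ^ card {p \<in> prime_factors m. p < B} * real m powr \<epsilon>)"
          using large[OF p(1), of a] c1 False by (intro mult_right_mono) auto
        then show ?thesis
          unfolding card npow by (simp add: mult_ac)
      qed
      finally show ?thesis .
    qed
  qed
  have "real (card {d. d dvd n}) \<le> c ^ B * real n powr \<epsilon>" if "n > 0" for n :: nat
  proof -
    have "card {p \<in> prime_factors n. p < B} \<le> card {..<B}"
      by (intro card_mono) auto
    then have "c ^ card {p \<in> prime_factors n. p < B} \<le> c ^ B"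
      using c1 by (intro power_increasing) auto
    then show ?thesis
      using main[OF that] by (meson mult_right_mono order_trans powr_ge_zero)
  qed
  moreover have "c ^ B \<ge> 1" using c1 by simp
  ultimately show ?thesis using that by blast
qed

text \<open>Off the diagonal, pairs are sorted by h = |x - y| and z = min x y. This serves both Weyl
  differencing and the counting of differences of cubes.\<close>

lemma sum_square_by_difference:
  fixes \<phi> :: "nat \<Rightarrow> nat \<Rightarrow> 'a :: comm_monoid_add"
  shows "(\<Sum>x\<in>{1..n}. \<Sum>y\<in>{1..n}. \<phi> x y) =
    (\<Sum>x\<in>{1..n}. \<phi> x x) + (\<Sum>h\<in>{1..<n}. \<Sum>z\<in>{1..n-h}. \<phi> (z + h) z + \<phi> z (z + h))"
proof (induction n)
  case 0
  then show ?case by simp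
next
  case (Suc n)
  have 1: "(\<Sum>x\<in>{1..Suc n}. \<Sum>y\<in>{1..Suc n}. \<phi> x y) =
      (\<Sum>x\<in>{1..n}. \<Sum>y\<in>{1..n}. \<phi> x y) + (\<phi> (Suc n) (Suc n) +
       (\<Sum>x\<in>{1..n}. \<phi> (Suc n) x + \<phi> x (Suc n)))"
    by (simp add: sum.distrib add_ac)
  have 2: "(\<Sum>z\<in>{1..Suc n-h}. \<phi> (z + h) z + \<phi> z (z + h)) =
      (\<Sum>z\<in>{1..n-h}. \<phi> (z + h) z + \<phi> z (z + h)) +
      (\<phi> (Suc n) (Suc n - h) + \<phi> (Suc n - h) (Suc n))" if "h \<in> {1..<Suc n}" for h
    using that by (simp add: Suc_diff_le)
  have "(\<Sum>h\<in>{1..<Suc n}. \<Sum>z\<in>{1..Suc n-h}. \<phi> (z + h) z + \<phi> z (z + h)) =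
     (\<Sum>h\<in>{1..<Suc n}. \<Sum>z\<in>{1..n-h}. \<phi> (z + h) z + \<phi> z (z + h)) +
     (\<Sum>h\<in>{1..<Suc n}. \<phi> (Suc n) (Suc n - h) + \<phi> (Suc n - h) (Suc n))"
    using 2 by (simp add: sum.distrib)
  \<comment> \<open>The additional index h = n has an empty inner range.\<close>
  also have "(\<Sum>h\<in>{1..<Suc n}. \<Sum>z\<in>{1..n-h}. \<phi> (z + h) z + \<phi> z (z + h)) =
     (\<Sum>h\<in>{1..<n}. \<Sum>z\<in>{1..n-h}. \<phi> (z + h) z + \<phi> z (z + h))"
    by (rule sum.mono_neutral_right) (auto simp: not_less less_Suc_eq)
  also have "(\<Sum>h\<in>{1..<Suc n}. \<phi> (Suc n) (Suc n - h) + \<phi> (Suc n - h) (Suc n)) =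
     (\<Sum>x\<in>{1..n}. \<phi> (Suc n) x + \<phi> x (Suc n))"
    by (rule sum.reindex_bij_witness[of _ "\<lambda>x. Suc n - x" "\<lambda>x. Suc n - x"]) auto
  finally show ?case
    using 1 Suc.IH by (simp add: add_ac)
qed

section \<open>Counting differences of cubes\<close>

definition cube_step :: "nat \<Rightarrow> nat \<Rightarrow> int" where
  "cube_step h z = (int z + int h) ^ 3 - int z ^ 3"

text \<open>The second difference of a cube splits into linear factors. The factor h forces a
  congruence modulo h, and the factor z - z' must be a divisor of the prescribed difference.\<close>

lemma cube_step_diff:
  "cube_step h z - cube_step h z' = 3 * int h * (int z - int z') * (int z + int z' + int h)"
  by (simp add: cube_step_def power3_eq_cube algebra_simps)

lemma cube_step_eq_iff: "h > 0 \<Longrightarrow> cube_step h z = cube_step h z' \<longleftrightarrow> z = z'"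
  using cube_step_diff[of h z z'] by auto

lemma cube_diff_factor:
  fixes a b :: int
  shows "a ^ 3 - b ^ 3 = (a - b) * (a\<^sup>2 + a * b + b\<^sup>2)"
  by (simp add: power2_eq_square power3_eq_cube algebra_simps)

lemma finite_nat_divisors_int:
  fixes m :: int
  assumes "m \<noteq> 0"
  shows "finite {d::nat. int d dvd m}"
  using assms by (metis (no_types) finite_divisors_int finite_imageI
       finite_subset[of _ "nat ` {d. d dvd m}"] image_eqI mem_Collect_eq nat_int subsetI)

text \<open>The difference x - y divides m, and together with m it determines the pair.\<close>

lemma card_cube_differences_le:
  fixes m :: int
  assumes "m \<noteq> 0"
  shows "card {(x, y). x \<in> {1..n} \<and> y \<in> {1..n} \<and> int x ^ 3 - int y ^ 3 = m}
    \<le> card {d::nat. int d dvd m}"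
proof -
  let ?A = "{(x, y). x \<in> {1..n} \<and> y \<in> {1..n} \<and> int x ^ 3 - int y ^ 3 = m}"
  have eq: "y = y'" if "int x ^ 3 - int y ^ 3 = int x' ^ 3 - int y' ^ 3"
    "int x - int y = int x' - int y'" "x \<noteq> y" "x > 0" "y > 0" "x' > 0" "y' > 0" for x y x' y' :: nat
  proof -
    define d where "d = int x - int y"
    have d: "int x = int y + d" "int x' = int y' + d" "d \<noteq> 0"
      using that unfolding d_def by auto
    \<comment> \<open>For fixed d, (y + d)^3 - y^3 is quadratic in y; the last factor equals x + y'
      and is positive.\<close>
    have "3 * d * ((int y - int y') * (int y + int y' + d)) = 0"
      using that(1) unfolding d by (simp add: power3_eq_cube algebra_simps)
    moreover have "int y + int y' + d > 0"
      using that d by linarith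
    ultimately show ?thesis using d(3) by simp
  qed
  have "inj_on (\<lambda>(x, y). nat \<bar>int x - int y\<bar>) ?A"
  proof (rule inj_onI, clarify)
    fix x y x' y' :: nat
    assume a: "x \<in> {1..n}" "y \<in> {1..n}" "x' \<in> {1..n}" "y' \<in> {1..n}"
      "int x' ^ 3 - int y' ^ 3 = int x ^ 3 - int y ^ 3" "nat \<bar>int x - int y\<bar> = nat \<bar>int x' - int y'\<bar>"
      "m = int x ^ 3 - int y ^ 3"
    have cube_less: "int y ^ 3 < int x ^ 3 \<longleftrightarrow> int y < int x" for x y :: nat
      by (auto intro!: power_strict_mono dest: power_less_imp_less_base)
    \<comment> \<open>The sign of x - y is that of m, so the absolute value is enough as a
      label.\<close>
    have sg: "int x > int y \<longleftrightarrow> int x' > int y'"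
      using a(5) unfolding cube_less[symmetric] by linarith
    have "int x - int y = int x' - int y'"
      using a(6) sg by linarith
    moreover have "x \<noteq> y" using a assms by auto
    ultimately have "y = y'" using eq[of x y x' y'] a by auto
    with \<open>int x - int y = int x' - int y'\<close> show "x = x' \<and> y = y'" by auto
  qed
  moreover have "(\<lambda>(x, y). nat \<bar>int x - int y\<bar>) ` ?A \<subseteq> {d. int d dvd m}"
    by (auto simp: cube_diff_factor)
  moreover have "finite {d::nat. int d dvd m}"
    using assms by (intro finite_nat_divisors_int)
  ultimately show ?thesis
    by (meson card_inj_on_le)
qed

text \<open>The difference z - z' divides m; once it is known, the cofactor gives z + z' + h and
  hence both variables.\<close>

lemma card_cube_step_differences_le:
  fixes m :: int
  assumes "m \<noteq> 0" "h > 0"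
  shows "card {(z, z'). z \<in> {1..n} \<and> z' \<in> {1..n} \<and> cube_step h z - cube_step h z' = m}
    \<le> card {d::nat. int d dvd m}"
proof -
  let ?A = "{(z, z'). z \<in> {1..n} \<and> z' \<in> {1..n} \<and> cube_step h z - cube_step h z' = m}"
  have "inj_on (\<lambda>(x, y). nat \<bar>int x - int y\<bar>) ?A"
  proof (rule inj_onI, clarify)
    fix x y x' y' :: nat
    assume a: "x \<in> {1..n}" "y \<in> {1..n}" "x' \<in> {1..n}" "y' \<in> {1..n}"
      "cube_step h x' - cube_step h y' = cube_step h x - cube_step h y" "nat \<bar>int x - int y\<bar> = nat \<bar>int x' - int y'\<bar>"
      "m = cube_step h x - cube_step h y"
    have e: "(int x - int y) * (int x + int y + int h) = (int x' - int y') * (int x' + int y' + int h)"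
      using a(5) assms(2) unfolding cube_step_diff by (simp add: mult.assoc)
    have p: "int x + int y + int h > 0" "int x' + int y' + int h > 0"
      using assms by auto
    have sg: "int x > int y \<longleftrightarrow> int x' > int y'"
      using e p by (metis diff_gt_0_iff_gt zero_less_mult_pos2 mult_pos_pos)
    have d: "int x - int y = int x' - int y'"
      using a(6) sg by linarith
    moreover have "x \<noteq> y" using a assms by auto
    ultimately have "int x + int y + int h = int x' + int y' + int h" using e by auto
    with d show "x = x' \<and> y = y'" by auto
  qed
  moreover have "(\<lambda>(x, y). nat \<bar>int x - int y\<bar>) ` ?A \<subseteq> {d. int d dvd m}"
    by (auto simp: cube_step_diff)
  moreover have "finite {d::nat. int d dvd m}"
    using assms by (intro finite_nat_divisors_int)
  ultimately show ?thesis
    by (meson card_inj_on_le)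
qed

text \<open>This is the mean square of the exponential sum with frequencies \<open>u i\<close>. A
  family is used instead of a set because numbers such as n + x^3 occur with multiplicity.\<close>

definition energy :: "('i \<Rightarrow> int) \<Rightarrow> 'i set \<Rightarrow> real" where
  "energy u I = (\<Sum>i\<in>I. \<Sum>j\<in>I. of_bool (u i = u j))"

text \<open>Pairs with equal values are left out because every h divides 0; for the others the
  number of possible h is a divisor count.\<close>

definition congruent_pairs :: "nat \<Rightarrow> ('i \<Rightarrow> int) \<Rightarrow> 'i set \<Rightarrow> real" where
  "congruent_pairs h u I = (\<Sum>i\<in>I. \<Sum>j\<in>I. of_bool (u i \<noteq> u j \<and> int h dvd u i - u j))"

lemma energy_nonneg: "energy u I \<ge> 0"
  by (auto simp: energy_def intro!: sum_nonneg)

lemma energy_inj: "finite I \<Longrightarrow> inj_on u I \<Longrightarrow> energy u I = real (card I)"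
  unfolding energy_def by (simp add: inj_on_eq_iff sum.delta cong: sum.cong)

lemma card_le_energy: "finite I \<Longrightarrow> real (card I) \<le> energy u I"
proof -
  assume f: "finite I"
  have "real (card I) = (\<Sum>i\<in>I. \<Sum>j\<in>I. of_bool (i = j))"
    using f by simp
  also have "\<dots> \<le> energy u I"
    unfolding energy_def by (intro sum_mono) auto
  finally show ?thesis .
qed

lemma congruent_pairs_nonneg: "congruent_pairs h u I \<ge> 0"
  by (auto simp: congruent_pairs_def intro!: sum_nonneg)

lemma sum_sum_of_bool:
  assumes "finite A" "finite B"
  shows "(\<Sum>x\<in>A. \<Sum>y\<in>B. of_bool (P x y) :: real) = real (card {(x, y). x \<in> A \<and> y \<in> B \<and> P x y})"
proof -
  have "(\<Sum>x\<in>A. \<Sum>y\<in>B. of_bool (P x y) :: real) = (\<Sum>p\<in>A\<times>B. of_bool (case p of (x, y) \<Rightarrow> P x y))"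
    by (simp add: sum.cartesian_product case_prod_beta)
  also have "\<dots> = real (card ((A \<times> B) \<inter> {p. case p of (x, y) \<Rightarrow> P x y}))"
    using assms by (simp add: sum_of_bool_eq)
  also have "(A \<times> B) \<inter> {p. case p of (x, y) \<Rightarrow> P x y} = {(x, y). x \<in> A \<and> y \<in> B \<and> P x y}"
    by auto
  finally show ?thesis .
qed

text \<open>The 9 is 8 + 1: the numbers n + x^3 occur with x <= X and n <= 8 X^3, the latter because
  N < (X + 1)^3 <= (2 X)^3.\<close>

locale divisor_bounded =
  fixes X :: nat and D :: real
  assumes X_pos: "X > 0" and D_ge_1: "D \<ge> 1"
    and divisors_le: "\<And>m::int. m \<noteq> 0 \<Longrightarrow> \<bar>m\<bar> \<le> 9 * int X ^ 3 \<Longrightarrow> real (card {d::nat. int d dvd m}) \<le> D"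
begin

text \<open>Indices with equal \<open>u\<close> force x = y and give the first term; for unequal
  ones the two cubes have a prescribed non-zero difference, which leaves at most \<open>D\<close>
  pairs.\<close>

lemma energy_add_cube_le:
  assumes "finite I" and range: "\<And>i j. i \<in> I \<Longrightarrow> j \<in> I \<Longrightarrow> \<bar>u i - u j\<bar> \<le> 9 * int X ^ 3"
  shows "energy (\<lambda>(i, x). u i + int x ^ 3) (I \<times> {1..X}) \<le> real X * energy u I + D * (real (card I))\<^sup>2"
proof -
  have inner: "(\<Sum>x\<in>{1..X}. \<Sum>y\<in>{1..X}. of_bool (u i + int x ^ 3 = u j + int y ^ 3)) \<le>
      real X * of_bool (u i = u j) + D" if "i \<in> I" "j \<in> I" for i j
  proof (cases "u i = u j")
    case True
    have "int x ^ 3 = int y ^ 3 \<longleftrightarrow> x = y" for x y :: nat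
      by (simp add: power_eq_iff_eq_base)
    then show ?thesis using True D_ge_1 by simp
  next
    case False
    have "(\<Sum>x\<in>{1..X}. \<Sum>y\<in>{1..X}. of_bool (u i + int x ^ 3 = u j + int y ^ 3)) =
        real (card {(x, y). x \<in> {1..X} \<and> y \<in> {1..X} \<and> int x ^ 3 - int y ^ 3 = u j - u i})"
      by (subst sum_sum_of_bool) (auto intro!: arg_cong[where f = card])
    also have "\<dots> \<le> real (card {d::nat. int d dvd u j - u i})"
      using card_cube_differences_le[of "u j - u i" X] False by simp
    also have "\<dots> \<le> D"
      using False range[OF that(2,1)] by (intro divisors_le) auto
    finally show ?thesis using False by simp
  qed
  have "energy (\<lambda>(i, x). u i + int x ^ 3) (I \<times> {1..X}) =
      (\<Sum>i\<in>I. \<Sum>x\<in>{1..X}. \<Sum>j\<in>I. \<Sum>y\<in>{1..X}. of_bool (u i + int x ^ 3 = u j + int y ^ 3))"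
    unfolding energy_def by (simp add: sum.cartesian_product' case_prod_beta)
  also have "\<dots> = (\<Sum>i\<in>I. \<Sum>j\<in>I. \<Sum>x\<in>{1..X}. \<Sum>y\<in>{1..X}. of_bool (u i + int x ^ 3 = u j + int y ^ 3))"
    by (intro sum.cong refl sum.swap)
  also have "\<dots> \<le> (\<Sum>i\<in>I. \<Sum>j\<in>I. real X * of_bool (u i = u j) + D)"
    by (intro sum_mono inner)
  also have "\<dots> = real X * energy u I + D * (real (card I))\<^sup>2"
    unfolding energy_def by (simp add: sum.distrib sum_distrib_left power2_eq_square)
  finally show ?thesis .
qed

text \<open>After interchanging the sums, a fixed pair with distinct values admits at most
  \<open>D\<close> moduli. Summing over h therefore costs no factor X.\<close>

lemma sum_congruent_pairs_le:
  assumes "finite I" and range: "\<And>i j. i \<in> I \<Longrightarrow> j \<in> I \<Longrightarrow> \<bar>u i - u j\<bar> \<le> 9 * int X ^ 3"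
    and "finite H"
  shows "(\<Sum>h\<in>H. congruent_pairs h u I) \<le> D * (real (card I))\<^sup>2"
proof -
  have inner: "(\<Sum>h\<in>H. of_bool (u i \<noteq> u j \<and> int h dvd u i - u j)) \<le> D" if "i \<in> I" "j \<in> I" for i j
  proof (cases "u i = u j")
    case False
    have fin: "finite {d::nat. int d dvd u i - u j}"
      using False by (intro finite_nat_divisors_int) simp
    have "(\<Sum>h\<in>H. of_bool (u i \<noteq> u j \<and> int h dvd u i - u j)) = real (card (H \<inter> {h. int h dvd u i - u j}))"
      using False assms(3) by (simp add: sum_of_bool_eq)
    also have "\<dots> \<le> real (card {d::nat. int d dvd u i - u j})"
      using fin by (intro of_nat_mono card_mono) auto
    also have "\<dots> \<le> D"
      using False range[OF that] by (intro divisors_le) auto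
    finally show ?thesis .
  qed (use D_ge_1 in auto)
  have "(\<Sum>h\<in>H. congruent_pairs h u I) = (\<Sum>i\<in>I. \<Sum>j\<in>I. \<Sum>h\<in>H. of_bool (u i \<noteq> u j \<and> int h dvd u i - u j))"
    unfolding congruent_pairs_def by (subst sum.swap, intro sum.cong refl, subst sum.swap, rule refl)
  also have "\<dots> \<le> (\<Sum>i\<in>I. \<Sum>j\<in>I. D)"
    by (intro sum_mono inner)
  finally show ?thesis by (simp add: power2_eq_square mult_ac)
qed

text \<open>By \<open>cube_step_diff\<close> a difference of two steps is a multiple of h, so there
  is no solution unless h divides u i - u j; otherwise the divisor bound applies.\<close>

lemma cube_step_pairs_le:
  assumes "i \<in> I" "j \<in> I" "u i \<noteq> u j" "h > 0"
    and range: "\<And>i j. i \<in> I \<Longrightarrow> j \<in> I \<Longrightarrow> \<bar>u i - u j\<bar> \<le> 9 * int X ^ 3"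
  shows "(\<Sum>z\<in>{1..X-h}. \<Sum>z'\<in>{1..X-h}. of_bool (u i + cube_step h z = u j + cube_step h z')) \<le>
      D * of_bool (int h dvd u i - u j)"
proof (cases "int h dvd u i - u j")
  case True
  have "(\<Sum>z\<in>{1..X-h}. \<Sum>z'\<in>{1..X-h}. of_bool (u i + cube_step h z = u j + cube_step h z')) =
     real (card {(z, z'). z \<in> {1..X-h} \<and> z' \<in> {1..X-h} \<and> cube_step h z - cube_step h z' = u j - u i})"
    by (subst sum_sum_of_bool) (auto intro!: arg_cong[where f = card])
  also have "\<dots> \<le> real (card {d::nat. int d dvd u j - u i})"
    using card_cube_step_differences_le[of "u j - u i" h] assms by simp
  also have "\<dots> \<le> D"
    using assms(3) range[OF assms(2,1)] by (intro divisors_le) auto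
  finally show ?thesis using True by simp
next
  case False
  have "u i + cube_step h z \<noteq> u j + cube_step h z'" for z z'
  proof
    assume "u i + cube_step h z = u j + cube_step h z'"
    then have "u i - u j = cube_step h z' - cube_step h z" by simp
    then show False using False unfolding cube_step_diff by simp
  qed
  then show ?thesis using False by simp
qed

text \<open>The count behind the eighth moment, after one Weyl differencing step. Equal values of
  \<open>u\<close> force z = z' and give the first term.\<close>

lemma energy_add_cube_step_le:
  assumes "finite I" "h > 0" and range: "\<And>i j. i \<in> I \<Longrightarrow> j \<in> I \<Longrightarrow> \<bar>u i - u j\<bar> \<le> 9 * int X ^ 3"
  shows "energy (\<lambda>(i, z). u i + cube_step h z) (I \<times> {1..X-h}) \<le>
    real X * energy u I + D * congruent_pairs h u I"
proof -
  have inner: "(\<Sum>z\<in>{1..X-h}. \<Sum>z'\<in>{1..X-h}. of_bool (u i + cube_step h z = u j + cube_step h z')) \<le>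
      real X * of_bool (u i = u j) + D * of_bool (u i \<noteq> u j \<and> int h dvd u i - u j)"
    if "i \<in> I" "j \<in> I" for i j
  proof (cases "u i = u j")
    case True
    then show ?thesis using assms(2) by (simp add: cube_step_eq_iff)
  next
    case False
    then show ?thesis using cube_step_pairs_le[OF that False assms(2) range] by simp
  qed
  have "energy (\<lambda>(i, z). u i + cube_step h z) (I \<times> {1..X-h}) =
      (\<Sum>i\<in>I. \<Sum>x\<in>{1..X-h}. \<Sum>j\<in>I. \<Sum>y\<in>{1..X-h}. of_bool (u i + cube_step h x = u j + cube_step h y))"
    unfolding energy_def by (simp add: sum.cartesian_product' case_prod_beta)
  also have "\<dots> = (\<Sum>i\<in>I. \<Sum>j\<in>I. \<Sum>x\<in>{1..X-h}. \<Sum>y\<in>{1..X-h}. of_bool (u i + cube_step h x = u j + cube_step h y))"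
    by (intro sum.cong refl sum.swap)
  also have "\<dots> \<le> (\<Sum>i\<in>I. \<Sum>j\<in>I. real X * of_bool (u i = u j) + D * of_bool (u i \<noteq> u j \<and> int h dvd u i - u j))"
    by (intro sum_mono inner)
  also have "\<dots> = real X * energy u I + D * congruent_pairs h u I"
    unfolding energy_def congruent_pairs_def by (simp add: sum.distrib sum_distrib_left)
  finally show ?thesis .
qed

definition step_count :: "nat \<Rightarrow> ('i \<Rightarrow> int) \<Rightarrow> 'i set \<Rightarrow> real" where
  "step_count h u I = (\<Sum>i\<in>I. \<Sum>j\<in>I. \<Sum>z\<in>{1..X-h}. of_bool (u i = u j + cube_step h z))"

text \<open>Positive and negative differences x - y contribute equally, by exchanging i and j; hence
  the factor 2.\<close>

lemma energy_add_cube_eq: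
  assumes "finite I"
  shows "energy (\<lambda>(i, x). u i + int x ^ 3) (I \<times> {1..X}) =
    real X * energy u I + 2 * (\<Sum>h\<in>{1..<X}. step_count h u I)"
proof -
  have inner: "(\<Sum>x\<in>{1..X}. \<Sum>y\<in>{1..X}. of_bool (u i + int x ^ 3 = u j + int y ^ 3)) =
     real X * of_bool (u i = u j) + (\<Sum>h\<in>{1..<X}. \<Sum>z\<in>{1..X-h}. of_bool (u j = u i + cube_step h z) +
       of_bool (u i = u j + cube_step h z))" for i j
    unfolding sum_square_by_difference
    by (intro arg_cong2[where f = "(+)"] sum.cong refl arg_cong[where f = of_bool]) (auto simp: cube_step_def)
  have "energy (\<lambda>(i, x). u i + int x ^ 3) (I \<times> {1..X}) =
      (\<Sum>i\<in>I. \<Sum>x\<in>{1..X}. \<Sum>j\<in>I. \<Sum>y\<in>{1..X}. of_bool (u i + int x ^ 3 = u j + int y ^ 3))"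
    unfolding energy_def by (simp add: sum.cartesian_product' case_prod_beta)
  also have "\<dots> = (\<Sum>i\<in>I. \<Sum>j\<in>I. \<Sum>x\<in>{1..X}. \<Sum>y\<in>{1..X}. of_bool (u i + int x ^ 3 = u j + int y ^ 3))"
    by (intro sum.cong refl sum.swap)
  also have "\<dots> = real X * energy u I +
      ((\<Sum>i\<in>I. \<Sum>j\<in>I. \<Sum>h\<in>{1..<X}. \<Sum>z\<in>{1..X-h}. of_bool (u j = u i + cube_step h z)) +
       (\<Sum>i\<in>I. \<Sum>j\<in>I. \<Sum>h\<in>{1..<X}. \<Sum>z\<in>{1..X-h}. of_bool (u i = u j + cube_step h z)))"
    unfolding inner energy_def by (simp add: sum.distrib sum_distrib_left)
  also have "(\<Sum>i\<in>I. \<Sum>j\<in>I. \<Sum>h\<in>{1..<X}. \<Sum>z\<in>{1..X-h}. of_bool (u j = u i + cube_step h z)) =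
      (\<Sum>i\<in>I. \<Sum>j\<in>I. \<Sum>h\<in>{1..<X}. \<Sum>z\<in>{1..X-h}. of_bool (u i = u j + cube_step h z) :: real)"
    by (rule sum.swap)
  also have "(\<Sum>i\<in>I. \<Sum>j\<in>I. \<Sum>h\<in>{1..<X}. \<Sum>z\<in>{1..X-h}. of_bool (u i = u j + cube_step h z) :: real) =
      (\<Sum>h\<in>{1..<X}. step_count h u I)"
    unfolding step_count_def by (subst (2) sum.swap, intro sum.cong refl, subst sum.swap, rule refl)
  finally show ?thesis by simp
qed

end

section \<open>Counting differences of cubes over the values attained by a family\<close>

lemma sum_by_values:
  fixes \<phi> :: "int \<Rightarrow> real"
  assumes "finite I"
  shows "(\<Sum>i\<in>I. \<phi> (u i)) = (\<Sum>v\<in>u ` I. (\<Sum>i\<in>I. of_bool (u i = v)) * \<phi> v)"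
proof -
  have "(\<Sum>v\<in>u ` I. (\<Sum>i\<in>I. of_bool (u i = v)) * \<phi> v) = (\<Sum>i\<in>I. \<Sum>v\<in>u ` I. of_bool (u i = v) * \<phi> v)"
    unfolding sum_distrib_right by (rule sum.swap)
  also have "\<dots> = (\<Sum>i\<in>I. \<phi> (u i))"
    using assms by (intro sum.cong refl) (simp add: of_bool_def if_distrib[of "\<lambda>x. x * _"] sum.delta cong: if_cong)
  finally show ?thesis ..
qed

text \<open>Needed because the Cauchy-Schwarz bound for \<open>step_count\<close> contains
  \<open>step_count\<close> itself on the right.\<close>

lemma le_add_sqrt_if_square_le:
  fixes x a b :: real
  assumes "x\<^sup>2 \<le> a * x + b" "a \<ge> 0" "b \<ge> 0"
  shows "x \<le> a + sqrt b"
proof (rule ccontr)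
  assume "\<not> x \<le> a + sqrt b"
  then have x: "x > a + sqrt b" by simp
  then have "x > 0" using assms real_sqrt_ge_zero[of b] by linarith
  have "x * x > x * (a + sqrt b)"
    using x \<open>x > 0\<close> by simp
  moreover have "x * sqrt b \<ge> sqrt b * sqrt b"
    using x assms by (intro mult_right_mono) auto
  ultimately show False
    using assms by (simp add: power2_eq_square algebra_simps)
qed

lemma sum_sqrt_le:
  fixes c :: "'a \<Rightarrow> real"
  assumes "finite H" "\<And>h. h \<in> H \<Longrightarrow> c h \<ge> 0"
  shows "(\<Sum>h\<in>H. sqrt (c h)) \<le> sqrt (real (card H) * (\<Sum>h\<in>H. c h))"
proof (rule real_le_rsqrt)
  have "(\<Sum>h\<in>H. 1 * sqrt (c h))\<^sup>2 \<le> (\<Sum>h\<in>H. 1\<^sup>2) * (\<Sum>h\<in>H. (sqrt (c h))\<^sup>2)"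
    by (rule Cauchy_Schwarz_ineq_sum)
  then show "(\<Sum>h\<in>H. sqrt (c h))\<^sup>2 \<le> real (card H) * (\<Sum>h\<in>H. c h)"
    using assms by simp
qed

context divisor_bounded
begin

text \<open>Cauchy-Schwarz over the values attained by u only, and not over all integers: the diagonal
  terms are then bounded by the count itself instead of X times the energy.\<close>

lemma step_count_square_le:
  assumes fin: "finite I" and h: "h > 0"
    and range: "\<And>i j. i \<in> I \<Longrightarrow> j \<in> I \<Longrightarrow> \<bar>u i - u j\<bar> \<le> 9 * int X ^ 3"
  shows "(step_count h u I)\<^sup>2 \<le>
    energy u I * (step_count h u I + real X * (energy u I - real (card I)) + D * congruent_pairs h u I)"
proof -
  define Z where "Z = {1..X-h}"
  define V where "V = u ` I"
  define w where "w v = (\<Sum>i\<in>I. of_bool (u i = v) :: real)" for v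
  define q where "q p = u (fst p) + cube_step h (snd p)" for p
  \<comment> \<open>\<open>w v\<close> is the multiplicity of v in the family, and
    \<open>d v\<close> the number of its representations as u j + cube_step h z.\<close>
  define d where "d v = (\<Sum>p\<in>I\<times>Z. of_bool (v = q p) :: real)" for v
  have finV: "finite V" and finZ: "finite Z" using fin by (auto simp: V_def Z_def)
  have e: "step_count h u I = (\<Sum>v\<in>V. w v * d v)"
  proof -
    have "step_count h u I = (\<Sum>i\<in>I. d (u i))"
      unfolding step_count_def d_def q_def Z_def by (simp add: sum.cartesian_product' case_prod_beta del: sum_of_bool_eq)
    then show ?thesis using sum_by_values[OF fin, of d u] by (simp add: V_def w_def)
  qed
  have E: "energy u I = (\<Sum>v\<in>V. (w v)\<^sup>2)"
  proof -
    have "energy u I = (\<Sum>i\<in>I. w (u i))"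
      unfolding energy_def w_def by (intro sum.cong refl arg_cong[where f = of_bool] eq_commute)
    then show ?thesis using sum_by_values[OF fin, of w u] by (simp add: V_def w_def power2_eq_square)
  qed
  have "(\<Sum>v\<in>V. (d v)\<^sup>2) = (\<Sum>v\<in>V. \<Sum>p\<in>I\<times>Z. \<Sum>p'\<in>I\<times>Z. of_bool (v = q p) * of_bool (v = q p'))"
    unfolding d_def power2_eq_square sum_product ..
  also have "\<dots> = (\<Sum>p\<in>I\<times>Z. \<Sum>p'\<in>I\<times>Z. \<Sum>v\<in>V. of_bool (v = q p) * of_bool (v = q p'))"
    by (subst sum.swap, intro sum.cong refl sum.swap)
  also have "\<dots> = (\<Sum>p\<in>I\<times>Z. \<Sum>p'\<in>I\<times>Z. of_bool (q p \<in> V \<and> q p = q p'))"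
  proof (intro sum.cong refl)
    fix p p'
    have "(\<Sum>v\<in>V. of_bool (v = q p) * of_bool (v = q p')) = (\<Sum>v\<in>V. if v = q p then of_bool (q p = q p') else 0 :: real)"
      by (intro sum.cong refl) auto
    then show "(\<Sum>v\<in>V. of_bool (v = q p) * of_bool (v = q p')) = (of_bool (q p \<in> V \<and> q p = q p') :: real)"
      using finV by simp
  qed
  \<comment> \<open>Three kinds of coincidence: identical pairs; different indices with the same
    value of \<open>u\<close>, which forces z = z'; and different values of \<open>u\<close>, which
    are subject to the congruence modulo h.\<close>
  also have "\<dots> \<le> (\<Sum>p\<in>I\<times>Z. \<Sum>p'\<in>I\<times>Z. of_bool (p' = p) * of_bool (q p \<in> V) +
      of_bool (fst p \<noteq> fst p' \<and> u (fst p) = u (fst p')) * of_bool (snd p' = snd p) +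
      of_bool (u (fst p) \<noteq> u (fst p')) * of_bool (q p = q p'))"
  proof (intro sum_mono)
    fix p p' :: "'a \<times> nat"
    have "snd p' = snd p" if "q p = q p'" "u (fst p) = u (fst p')"
      using that h by (auto simp: q_def cube_step_eq_iff)
    then show "of_bool (q p \<in> V \<and> q p = q p') \<le> of_bool (p' = p) * of_bool (q p \<in> V) +
      of_bool (fst p \<noteq> fst p' \<and> u (fst p) = u (fst p')) * of_bool (snd p' = snd p) +
      (of_bool (u (fst p) \<noteq> u (fst p')) * of_bool (q p = q p') :: real)"
      by (cases "q p = q p'"; cases "u (fst p) = u (fst p')"; cases "fst p = fst p'") (simp_all add: prod_eq_iff)
  qed
  also have "\<dots> = (\<Sum>p\<in>I\<times>Z. \<Sum>p'\<in>I\<times>Z. of_bool (p' = p) * of_bool (q p \<in> V)) +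
      (\<Sum>p\<in>I\<times>Z. \<Sum>p'\<in>I\<times>Z. of_bool (fst p \<noteq> fst p' \<and> u (fst p) = u (fst p')) * of_bool (snd p' = snd p)) +
      (\<Sum>p\<in>I\<times>Z. \<Sum>p'\<in>I\<times>Z. of_bool (u (fst p) \<noteq> u (fst p')) * of_bool (q p = q p'))"
    by (simp only: sum.distrib)
  also have "\<dots> \<le> step_count h u I + real X * (energy u I - real (card I)) + D * congruent_pairs h u I"
  proof (intro add_mono)
    have "(\<Sum>p\<in>I\<times>Z. \<Sum>p'\<in>I\<times>Z. of_bool (p' = p) * of_bool (q p \<in> V) :: real) = (\<Sum>p\<in>I\<times>Z. of_bool (q p \<in> V))"
      using fin finZ by (intro sum.cong refl) (simp add: of_bool_def if_distrib[of "\<lambda>x. x * _"] sum.delta cong: if_cong)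
    \<comment> \<open>As \<open>q p\<close> is attained by \<open>u\<close>, at least one i matches
      it; this is how the identical pairs are bounded by \<open>step_count\<close> itself.\<close>
    also have "\<dots> \<le> (\<Sum>p\<in>I\<times>Z. \<Sum>i\<in>I. of_bool (u i = q p))"
    proof (intro sum_mono)
      fix p
      show "of_bool (q p \<in> V) \<le> (\<Sum>i\<in>I. of_bool (u i = q p) :: real)"
      proof (cases "q p \<in> V")
        case True
        then obtain i where "i \<in> I" "u i = q p" by (auto simp: V_def)
        then have "(\<Sum>i\<in>{i}. of_bool (u i = q p) :: real) \<le> (\<Sum>i\<in>I. of_bool (u i = q p))"
          using fin by (intro sum_mono2) auto
        then show ?thesis using True \<open>u i = q p\<close> by simp
      qed (auto intro: sum_nonneg)
    qed
    also have "\<dots> = (\<Sum>i\<in>I. \<Sum>p\<in>I\<times>Z. of_bool (u i = q p))"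
      by (rule sum.swap)
    also have "\<dots> = step_count h u I"
      unfolding step_count_def q_def Z_def by (simp add: sum.cartesian_product' case_prod_beta del: sum_of_bool_eq)
    finally show "(\<Sum>p\<in>I\<times>Z. \<Sum>p'\<in>I\<times>Z. of_bool (p' = p) * of_bool (q p \<in> V)) \<le> step_count h u I" .
  next
    have "(\<Sum>p\<in>I\<times>Z. \<Sum>p'\<in>I\<times>Z. of_bool (fst p \<noteq> fst p' \<and> u (fst p) = u (fst p')) * of_bool (snd p' = snd p)) =
       (\<Sum>i\<in>I. \<Sum>z\<in>Z. \<Sum>j\<in>I. \<Sum>z'\<in>Z. of_bool (i \<noteq> j \<and> u i = u j) * of_bool (z' = z) :: real)"
      by (simp add: sum.cartesian_product' case_prod_beta)
    also have "\<dots> = (\<Sum>i\<in>I. \<Sum>z\<in>Z. \<Sum>j\<in>I. of_bool (i \<noteq> j \<and> u i = u j))"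
      using finZ by (intro sum.cong refl) (simp add: of_bool_def if_distrib[of "\<lambda>x. _ * x"] sum.delta cong: if_cong)
    also have "\<dots> = real (card Z) * (\<Sum>i\<in>I. \<Sum>j\<in>I. of_bool (i \<noteq> j \<and> u i = u j))"
      by (simp add: sum_distrib_left)
    also have "(\<Sum>i\<in>I. \<Sum>j\<in>I. of_bool (i \<noteq> j \<and> u i = u j) :: real) =
       (\<Sum>i\<in>I. \<Sum>j\<in>I. of_bool (u i = u j) - of_bool (j = i))"
      by (intro sum.cong refl) auto
    also have "\<dots> = energy u I - real (card I)"
      using fin unfolding energy_def by (simp add: sum_subtractf)
    also have "real (card Z) * (energy u I - real (card I)) \<le> real X * (energy u I - real (card I))"
      using card_le_energy[OF fin, of u] unfolding Z_def by (intro mult_right_mono) auto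
    finally show "(\<Sum>p\<in>I\<times>Z. \<Sum>p'\<in>I\<times>Z. of_bool (fst p \<noteq> fst p' \<and> u (fst p) = u (fst p')) * of_bool (snd p' = snd p))
       \<le> real X * (energy u I - real (card I))" .
  next
    have "(\<Sum>p\<in>I\<times>Z. \<Sum>p'\<in>I\<times>Z. of_bool (u (fst p) \<noteq> u (fst p')) * of_bool (q p = q p')) =
       (\<Sum>i\<in>I. \<Sum>z\<in>Z. \<Sum>j\<in>I. \<Sum>z'\<in>Z. of_bool (u i \<noteq> u j) * of_bool (u i + cube_step h z = u j + cube_step h z') :: real)"
      by (simp add: sum.cartesian_product' case_prod_beta q_def)
    also have "\<dots> = (\<Sum>i\<in>I. \<Sum>j\<in>I. of_bool (u i \<noteq> u j) *
        (\<Sum>z\<in>Z. \<Sum>z'\<in>Z. of_bool (u i + cube_step h z = u j + cube_step h z')))"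
      unfolding sum_distrib_left by (intro sum.cong refl sum.swap)
    also have "\<dots> \<le> (\<Sum>i\<in>I. \<Sum>j\<in>I. D * of_bool (u i \<noteq> u j \<and> int h dvd u i - u j))"
    proof (intro sum_mono)
      fix i j assume ij: "i \<in> I" "j \<in> I"
      show "of_bool (u i \<noteq> u j) * (\<Sum>z\<in>Z. \<Sum>z'\<in>Z. of_bool (u i + cube_step h z = u j + cube_step h z')) \<le>
          D * of_bool (u i \<noteq> u j \<and> int h dvd u i - u j)"
      proof (cases "u i = u j")
        case False
        then show ?thesis
          using cube_step_pairs_le[where u = u, OF ij False h range] unfolding Z_def
          by (simp del: sum_of_bool_eq)
      qed simp
    qed
    also have "\<dots> = D * congruent_pairs h u I"
      unfolding congruent_pairs_def sum_distrib_left ..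
    finally show "(\<Sum>p\<in>I\<times>Z. \<Sum>p'\<in>I\<times>Z. of_bool (u (fst p) \<noteq> u (fst p')) * of_bool (q p = q p')) \<le> D * congruent_pairs h u I" .
  qed
  finally have d2: "(\<Sum>v\<in>V. (d v)\<^sup>2) \<le> step_count h u I + real X * (energy u I - real (card I)) + D * congruent_pairs h u I" .
  have "(step_count h u I)\<^sup>2 \<le> energy u I * (\<Sum>v\<in>V. (d v)\<^sup>2)"
    unfolding e E by (rule Cauchy_Schwarz_ineq_sum)
  also have "\<dots> \<le> energy u I * (step_count h u I + real X * (energy u I - real (card I)) + D * congruent_pairs h u I)"
    using d2 by (intro mult_left_mono energy_nonneg)
  finally show ?thesis .
qed

text \<open>The quadratic inequality for each h is solved, the square roots are summed by
  Cauchy-Schwarz over h, and \<open>sum_congruent_pairs_le\<close> handles the congruences. The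
  excess \<open>energy u I - card I\<close> measures the repeated values and vanishes for injective
  \<open>u\<close>. The 3 is 1 from x = y and 2 from the terms E in the step counts.\<close>

theorem energy_add_cube_le_sqrt:
  assumes fin: "finite I"
    and range: "\<And>i j. i \<in> I \<Longrightarrow> j \<in> I \<Longrightarrow> \<bar>u i - u j\<bar> \<le> 9 * int X ^ 3"
  shows "energy (\<lambda>(i, x). u i + int x ^ 3) (I \<times> {1..X}) \<le> 3 * real X * energy u I +
    2 * sqrt (real X * energy u I * ((real X)\<^sup>2 * (energy u I - real (card I)) + D\<^sup>2 * (real (card I))\<^sup>2))"
proof -
  define E where "E = energy u I"
  define F where "F = energy u I - real (card I)"
  define b where "b h = E * (real X * F + D * congruent_pairs h u I)" for h
  have E0: "E \<ge> 0" and F0: "F \<ge> 0"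
    using energy_nonneg[of u I] card_le_energy[OF fin, of u] by (auto simp: E_def F_def)
  have b0: "b h \<ge> 0" for h
    using E0 F0 D_ge_1 congruent_pairs_nonneg[of h u I] by (simp add: b_def)
  have "step_count h u I \<le> E + sqrt (b h)" if "h \<in> {1..<X}" for h
  proof (rule le_add_sqrt_if_square_le[OF _ E0 b0])
    show "(step_count h u I)\<^sup>2 \<le> E * step_count h u I + b h"
      using step_count_square_le[OF fin _ range, of h] that
      unfolding b_def E_def F_def by (simp add: algebra_simps)
  qed
  then have "(\<Sum>h\<in>{1..<X}. step_count h u I) \<le> (\<Sum>h\<in>{1..<X}. E + sqrt (b h))"
    by (intro sum_mono)
  also have "\<dots> = real (X - 1) * E + (\<Sum>h\<in>{1..<X}. sqrt (b h))"
    by (simp add: sum.distrib)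
  also have "\<dots> \<le> real X * E + sqrt (real X * E * ((real X)\<^sup>2 * F + D\<^sup>2 * (real (card I))\<^sup>2))"
  proof (intro add_mono mult_right_mono E0)
    have "(\<Sum>h\<in>{1..<X}. sqrt (b h)) \<le> sqrt (real (card {1..<X}) * (\<Sum>h\<in>{1..<X}. b h))"
      by (intro sum_sqrt_le b0) auto
    also have "(\<Sum>h\<in>{1..<X}. b h) = E * (real (X - 1) * (real X * F) + D * (\<Sum>h\<in>{1..<X}. congruent_pairs h u I))"
      unfolding b_def by (simp add: sum_distrib_left[symmetric] sum.distrib)
    also have "sqrt (real (card {1..<X}) * \<dots>) \<le> sqrt (real X * (E * ((real X)\<^sup>2 * F + D\<^sup>2 * (real (card I))\<^sup>2)))"
    proof (intro real_sqrt_le_mono)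
      have 1: "real (X - 1) * (real X * F) \<le> (real X)\<^sup>2 * F"
        using F0 X_pos by (simp add: power2_eq_square mult.assoc mult_right_mono)
      have 2: "D * (\<Sum>h\<in>{1..<X}. congruent_pairs h u I) \<le> D\<^sup>2 * (real (card I))\<^sup>2"
        using sum_congruent_pairs_le[OF fin range, where H = "{1..<X}"] D_ge_1
        by (simp add: power2_eq_square mult.assoc)
      have "real (card {1..<X}) * (E * (real (X - 1) * (real X * F) + D * (\<Sum>h\<in>{1..<X}. congruent_pairs h u I)))
          \<le> real (card {1..<X}) * (E * ((real X)\<^sup>2 * F + D\<^sup>2 * (real (card I))\<^sup>2))"
        using 1 2 E0 by (intro mult_left_mono) auto
      also have "\<dots> \<le> real X * (E * ((real X)\<^sup>2 * F + D\<^sup>2 * (real (card I))\<^sup>2))"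
        using E0 F0 by (intro mult_right_mono) auto
      finally show "real (card {1..<X}) * (E * (real (X - 1) * (real X * F) + D * (\<Sum>h\<in>{1..<X}. congruent_pairs h u I)))
          \<le> real X * (E * ((real X)\<^sup>2 * F + D\<^sup>2 * (real (card I))\<^sup>2))" .
    qed
    finally show "(\<Sum>h\<in>{1..<X}. sqrt (b h)) \<le> sqrt (real X * E * ((real X)\<^sup>2 * F + D\<^sup>2 * (real (card I))\<^sup>2))"
      by (simp add: mult.assoc)
  qed auto
  finally show ?thesis
    unfolding energy_add_cube_eq[OF fin] E_def F_def by simp
qed

text \<open>Here \<open>u\<close> is injective, so there is no excess. The first bound makes the
  excess of the family n + x^3 over its size at most D Z^2, as the next lemma requires; the second
  is the efficient one for large Z.\<close>

lemma energy_shifted_cubes_le: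
  assumes "finite S" and S: "\<And>n. n \<in> S \<Longrightarrow> n \<le> 8 * X ^ 3"
  shows "energy (\<lambda>(n, x). int n + int x ^ 3) (S \<times> {1..X}) \<le> real X * real (card S) + D * (real (card S))\<^sup>2"
    and "energy (\<lambda>(n, x). int n + int x ^ 3) (S \<times> {1..X}) \<le> 3 * real X * real (card S) +
      2 * sqrt (real X * real (card S) * (D\<^sup>2 * (real (card S))\<^sup>2))"
proof -
  have r: "\<bar>int i - int j\<bar> \<le> 9 * int X ^ 3" if "i \<in> S" "j \<in> S" for i j
  proof -
    have "int i \<le> 8 * int X ^ 3" "int j \<le> 8 * int X ^ 3"
      using S[OF that(1)] S[OF that(2)] by (metis of_nat_mono of_nat_mult of_nat_numeral of_nat_power)+
    then show ?thesis by simp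
  qed
  have e: "energy int S = real (card S)"
    using assms(1) by (intro energy_inj) auto
  show "energy (\<lambda>(n, x). int n + int x ^ 3) (S \<times> {1..X}) \<le> real X * real (card S) + D * (real (card S))\<^sup>2"
    using energy_add_cube_le[OF assms(1), of int] r e by simp
  show "energy (\<lambda>(n, x). int n + int x ^ 3) (S \<times> {1..X}) \<le> 3 * real X * real (card S) +
      2 * sqrt (real X * real (card S) * (D\<^sup>2 * (real (card S))\<^sup>2))"
    using energy_add_cube_le_sqrt[OF assms(1), of int] r e by simp
qed

text \<open>\<open>energy_add_cube_le_sqrt\<close> is applied to the family n + x^3 itself. Its
  energy is << X Z because Z <= X, so the square root is about that of X * X Z * X^2 Z^2, which is
  X^2 Z^(3/2).\<close>

lemma energy_two_shifted_cubes_le: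
  assumes "finite S" and S: "\<And>n. n \<in> S \<Longrightarrow> n \<le> 8 * X ^ 3" and small: "card S \<le> X"
  shows "energy (\<lambda>(p, y). (int (fst p) + int (snd p) ^ 3) + int y ^ 3) ((S \<times> {1..X}) \<times> {1..X})
    \<le> 10 * D\<^sup>2 * (real X)\<^sup>2 * real (card S) * sqrt (real (card S))"
proof -
  define Z where "Z = real (card S)"
  define x where "x = real X"
  define u where "u p = int (fst p) + int (snd p) ^ 3" for p :: "nat \<times> nat"
  define E where "E = energy u (S \<times> {1..X})"
  have x1: "x \<ge> 1" using X_pos by (simp add: x_def)
  have Z0: "Z \<ge> 0" and Zx: "Z \<le> x" using small by (auto simp: Z_def x_def)
  have E: "E \<le> x * Z + D * Z\<^sup>2"
    using energy_shifted_cubes_le(1)[OF assms(1) S] unfolding E_def u_def x_def Z_def case_prod_beta .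
  have r: "\<bar>u i - u j\<bar> \<le> 9 * int X ^ 3" if "i \<in> S \<times> {1..X}" "j \<in> S \<times> {1..X}" for i j
  proof -
    have "0 \<le> u p \<and> u p \<le> 9 * int X ^ 3" if "p \<in> S \<times> {1..X}" for p
    proof -
      have "fst p \<in> S" "snd p \<in> {1..X}" using that by (simp_all only: mem_Times_iff)
      then have "fst p \<le> 8 * X ^ 3" "snd p \<le> X" using S by simp_all
      then have "int (fst p) \<le> 8 * int X ^ 3"
        by (metis of_nat_mono of_nat_mult of_nat_numeral of_nat_power)
      moreover have "int (snd p) ^ 3 \<le> int X ^ 3"
        using \<open>snd p \<le> X\<close> by (intro power_mono) auto
      moreover have "int (snd p) ^ 3 \<ge> 0" by simp
      ultimately show ?thesis unfolding u_def by linarith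
    qed
    from this[OF that(1)] this[OF that(2)] show ?thesis by auto
  qed
  have c: "real (card (S \<times> {1..X})) = x * Z"
    by (simp add: card_cartesian_product x_def Z_def)
  have main: "energy (\<lambda>(p, y). u p + int y ^ 3) ((S \<times> {1..X}) \<times> {1..X}) \<le>
     3 * x * E + 2 * sqrt (x * E * (x\<^sup>2 * (E - x * Z) + D\<^sup>2 * (x * Z)\<^sup>2))"
    using energy_add_cube_le_sqrt[of "S \<times> {1..X}" u] r assms(1) unfolding c E_def x_def by simp
  have E2: "E \<le> 2 * D * x * Z"
  proof -
    have "D * Z\<^sup>2 \<le> D * (x * Z)"
      using Zx Z0 D_ge_1 by (intro mult_left_mono) (auto simp: power2_eq_square mult_right_mono)
    moreover have "1 * (x * Z) \<le> D * (x * Z)"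
      using D_ge_1 x1 Z0 by (intro mult_right_mono) auto
    ultimately show ?thesis using E by (simp add: mult_ac)
  qed
  have E0: "E \<ge> 0" unfolding E_def by (rule energy_nonneg)
  \<comment> \<open>The excess E - x Z is at most D Z^2, so repeated values cost no more than the
    congruent pairs do.\<close>
  have in0: "x\<^sup>2 * (E - x * Z) + D\<^sup>2 * (x * Z)\<^sup>2 \<le> 2 * D\<^sup>2 * x\<^sup>2 * Z\<^sup>2"
  proof -
    have "x\<^sup>2 * (E - x * Z) \<le> x\<^sup>2 * (D * Z\<^sup>2)"
      using E by (intro mult_left_mono) auto
    also have "\<dots> \<le> x\<^sup>2 * (D\<^sup>2 * Z\<^sup>2)"
      using D_ge_1 by (intro mult_left_mono mult_right_mono) (auto simp: power2_eq_square)
    finally show ?thesis by (simp add: power_mult_distrib algebra_simps)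
  qed
  have "sqrt (x * E * (x\<^sup>2 * (E - x * Z) + D\<^sup>2 * (x * Z)\<^sup>2)) \<le> sqrt (x * (2 * D * x * Z) * (2 * D\<^sup>2 * x\<^sup>2 * Z\<^sup>2))"
  proof (intro real_sqrt_le_mono)
    have "x * E * (x\<^sup>2 * (E - x * Z) + D\<^sup>2 * (x * Z)\<^sup>2) \<le> x * E * (2 * D\<^sup>2 * x\<^sup>2 * Z\<^sup>2)"
      using in0 x1 E0 by (intro mult_left_mono) auto
    also have "\<dots> \<le> x * (2 * D * x * Z) * (2 * D\<^sup>2 * x\<^sup>2 * Z\<^sup>2)"
      using E2 x1 D_ge_1 by (intro mult_right_mono mult_left_mono) auto
    finally show "x * E * (x\<^sup>2 * (E - x * Z) + D\<^sup>2 * (x * Z)\<^sup>2) \<le> x * (2 * D * x * Z) * (2 * D\<^sup>2 * x\<^sup>2 * Z\<^sup>2)" .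
  qed
  also have "x * (2 * D * x * Z) * (2 * D\<^sup>2 * x\<^sup>2 * Z\<^sup>2) = (2 * D * x\<^sup>2 * Z)\<^sup>2 * (D * Z)"
    by (simp add: power2_eq_square algebra_simps)
  also have "sqrt \<dots> = 2 * D * x\<^sup>2 * Z * (sqrt D * sqrt Z)"
    using D_ge_1 Z0 by (simp add: real_sqrt_mult)
  also have "\<dots> \<le> 2 * D * x\<^sup>2 * Z * (D * sqrt Z)"
  proof -
    have "sqrt D \<le> D" using D_ge_1 by (metis abs_of_nonneg mult_left_mono mult_1_right order_trans real_le_lsqrt power2_eq_square zero_le_one)
    then show ?thesis using D_ge_1 Z0 by (intro mult_left_mono mult_right_mono) auto
  qed
  finally have s: "sqrt (x * E * (x\<^sup>2 * (E - x * Z) + D\<^sup>2 * (x * Z)\<^sup>2)) \<le> 2 * D\<^sup>2 * x\<^sup>2 * Z * sqrt Z"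
    by (simp add: power2_eq_square mult_ac)
  \<comment> \<open>Z is a cardinality, hence 0 or at least 1; this absorbs the term 3 x E.\<close>
  have zz: "Z \<le> Z * sqrt Z"
  proof (cases "card S = 0")
    case False
    then have "Z \<ge> 1" by (simp add: Z_def)
    then have "Z * 1 \<le> Z * sqrt Z" by (intro mult_left_mono) auto
    then show ?thesis by simp
  qed (simp add: Z_def)
  have "3 * x * E \<le> 3 * x * (2 * D * x * Z)"
    using E2 x1 by (intro mult_left_mono) auto
  also have "\<dots> = 6 * x\<^sup>2 * (D * Z)" by (simp add: power2_eq_square)
  also have "\<dots> \<le> 6 * x\<^sup>2 * (D\<^sup>2 * (Z * sqrt Z))"
    using zz D_ge_1 Z0 by (intro mult_left_mono mult_mono) (auto simp: power2_eq_square)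
  finally have "energy (\<lambda>(p, y). u p + int y ^ 3) ((S \<times> {1..X}) \<times> {1..X}) \<le> 10 * D\<^sup>2 * x\<^sup>2 * Z * sqrt Z"
    using main s by (simp add: mult_ac)
  then show ?thesis unfolding u_def x_def Z_def .
qed

text \<open>For Z >= X the diagonal term X Z is dominated by X^(1/2) Z^(3/2).\<close>

lemma energy_shifted_cubes_large:
  assumes "finite S" and S: "\<And>n. n \<in> S \<Longrightarrow> n \<le> 8 * X ^ 3" and large: "X \<le> card S"
  shows "energy (\<lambda>(n, x). int n + int x ^ 3) (S \<times> {1..X})
    \<le> 5 * D * sqrt (real X) * (real (card S) * sqrt (real (card S)))"
proof -
  define Z where "Z = real (card S)"
  define x where "x = real X"
  have x1: "x \<ge> 1" using X_pos by (simp add: x_def)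
  have Zx: "x \<le> Z" using large by (auto simp: Z_def x_def)
  have "sqrt (x * Z * (D\<^sup>2 * Z\<^sup>2)) = sqrt x * sqrt Z * (D * Z)"
    using D_ge_1 Zx x1 by (simp add: real_sqrt_mult)
  moreover have "x * Z \<le> D * sqrt x * (Z * sqrt Z)"
  proof -
    have "sqrt x * sqrt x \<le> (D * sqrt x) * sqrt Z"
      using D_ge_1 x1 Zx by (intro mult_mono) (auto simp: mult_le_cancel_right1)
    then have "x * Z \<le> (D * sqrt x) * sqrt Z * Z"
      using x1 Zx by (intro mult_right_mono) auto
    then show ?thesis by (simp add: mult_ac)
  qed
  ultimately show ?thesis
    using energy_shifted_cubes_le(2)[OF assms(1) S]
    unfolding x_def[symmetric] Z_def[symmetric] by (simp add: mult_ac)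
qed

end

section \<open>Mean values of trigonometric sums\<close>

lemma ee_add: "ee (x + y) = ee x * ee y"
  by (simp add: ee_def ring_distribs exp_add)

lemma norm_ee [simp]: "cmod (ee x) = 1"
  by (simp add: ee_def norm_exp_eq_Re)

lemma cnj_ee: "cnj (ee x) = ee (- x)"
  by (simp add: ee_def exp_cnj)

lemma ee_0 [simp]: "ee 0 = 1"
  by (simp add: ee_def)

lemma ee_of_int [simp]: "ee (of_int k) = 1"
proof -
  have "ee (of_int k) = exp (of_int (2 * k) * (of_real pi * \<i>))"
    by (simp add: ee_def mult_ac)
  then show ?thesis by (simp add: exp_integer_2pi mult_ac ee_def)
qed

lemma continuous_on_ee [continuous_intros]: "continuous_on A g \<Longrightarrow> continuous_on A (\<lambda>x. ee (g x))"
  unfolding ee_def by (intro continuous_intros)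

abbreviation unit_circle :: "real measure" where
  "unit_circle \<equiv> restrict_space lborel {0..<1}"

lemma integrable_unit_circle:
  fixes g :: "real \<Rightarrow> 'a :: {banach, second_countable_topology}"
  assumes "continuous_on UNIV g"
  shows "integrable unit_circle g"
proof -
  have "set_integrable lborel {0..1} g"
    by (intro borel_integrable_atLeastAtMost' continuous_on_subset[OF assms]) auto
  then have "set_integrable lborel {0..<1} g"
    by (rule set_integrable_subset) auto
  then show ?thesis
    by (simp add: integrable_restrict_space set_integrable_def)
qed

lemma integral_ee: "(\<integral>\<alpha>. ee (of_int k * \<alpha>) \<partial>unit_circle) = of_bool (k = 0)"
proof (cases "k = 0")
  case True
  then show ?thesis by (simp add: measure_restrict_space)
next
  case False
  define c where "c = 2 * of_real pi * \<i> * of_int k"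
  have c0: "c \<noteq> 0" using False by (simp add: c_def)
  have e: "ee (of_int k * \<alpha>) = exp (c * of_real \<alpha>)" for \<alpha>
    by (simp add: ee_def c_def mult_ac)
  have "(\<integral>\<alpha>. ee (of_int k * \<alpha>) \<partial>unit_circle) = (\<integral>\<alpha>. indicator {0..<1} \<alpha> *\<^sub>R ee (of_int k * \<alpha>) \<partial>lborel)"
    by (simp add: integral_restrict_space)
  also have "\<dots> = (\<integral>\<alpha>. indicator {0..1} \<alpha> *\<^sub>R ee (of_int k * \<alpha>) \<partial>lborel)"
  proof (intro integral_cong_AE)
    have m: "(\<lambda>\<alpha>. ee (of_int k * \<alpha>)) \<in> borel_measurable borel"
      by (intro borel_measurable_continuous_onI continuous_intros)
    show "(\<lambda>\<alpha>. indicator {0..<1::real} \<alpha> *\<^sub>R ee (of_int k * \<alpha>)) \<in> borel_measurable lborel"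
      "(\<lambda>\<alpha>. indicator {0..1::real} \<alpha> *\<^sub>R ee (of_int k * \<alpha>)) \<in> borel_measurable lborel"
      using m by (auto intro!: borel_measurable_scaleR)
    show "AE \<alpha> in lborel. indicator {0..<1} \<alpha> *\<^sub>R ee (of_int k * \<alpha>) = indicator {0..1::real} \<alpha> *\<^sub>R ee (of_int k * \<alpha>)"
      using AE_lborel_singleton[of "1::real"] by eventually_elim (auto simp: indicator_def)
  qed
  also have "\<dots> = exp (c * of_real 1) / c - exp (c * of_real 0) / c"
  proof (rule integral_FTC_atLeastAtMost)
    fix x :: real
    have "((\<lambda>\<alpha>. exp (c * of_real \<alpha>) / c) has_vector_derivative (exp (c * of_real x) * c / c)) (at x within {0..1})"
      by (rule has_vector_derivative_real_field) (auto intro!: derivative_eq_intros)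
    then show "((\<lambda>\<alpha>. exp (c * of_real \<alpha>) / c) has_vector_derivative ee (of_int k * x)) (at x within {0..1})"
      using c0 by (simp add: e)
  qed (auto intro!: continuous_intros)
  also have "exp (c * of_real 1) = 1"
    using e[of 1] by simp
  finally show ?thesis using False by simp
qed

text \<open>Opening the square, the pairs (z + h, z) and (z, z + h) contribute conjugate terms, so
  the off-diagonal part is twice a real part.\<close>

lemma sum_weyl_difference_le:
  "(cmod (\<Sum>x\<in>{1..n}. ee (\<phi> x)))\<^sup>2 \<le>
    real n + 2 * cmod (\<Sum>h\<in>{1..<n}. \<Sum>z\<in>{1..n-h}. ee (\<phi> (z + h) - \<phi> z))"
proof -
  define T where "T = (\<Sum>h\<in>{1..<n}. \<Sum>z\<in>{1..n-h}. ee (\<phi> (z + h) - \<phi> z))"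
  have "complex_of_real ((cmod (\<Sum>x\<in>{1..n}. ee (\<phi> x)))\<^sup>2) = (\<Sum>x\<in>{1..n}. ee (\<phi> x)) * cnj (\<Sum>x\<in>{1..n}. ee (\<phi> x))"
    by (simp only: complex_norm_square)
  also have "\<dots> = (\<Sum>x\<in>{1..n}. \<Sum>y\<in>{1..n}. ee (\<phi> x - \<phi> y))"
    by (simp add: cnj_ee sum_product flip: ee_add)
  also have "\<dots> = of_nat n + (T + cnj T)"
    unfolding sum_square_by_difference T_def
    by (simp add: cnj_ee sum.distrib minus_diff_eq)
  finally have "(cmod (\<Sum>x\<in>{1..n}. ee (\<phi> x)))\<^sup>2 = Re (of_nat n + (T + cnj T))"
    by (metis Re_complex_of_real)
  also have "\<dots> = real n + 2 * Re T" by simp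
  also have "\<dots> \<le> real n + 2 * cmod T"
    using complex_Re_le_cmod[of T] by simp
  finally show ?thesis unfolding T_def .
qed

text \<open>Frequencies are an indexed family, so that a product of two such sums is again one, over
  the product of the index sets.\<close>

definition trig_sum :: "('i \<Rightarrow> complex) \<Rightarrow> ('i \<Rightarrow> int) \<Rightarrow> 'i set \<Rightarrow> real \<Rightarrow> complex" where
  "trig_sum c u I \<alpha> = (\<Sum>i\<in>I. c i * ee (of_int (u i) * \<alpha>))"

lemma continuous_on_trig_sum [continuous_intros]: "continuous_on A (trig_sum c u I)"
  unfolding trig_sum_def by (intro continuous_intros)

lemma trig_sum_mult:
  "trig_sum c u I \<alpha> * trig_sum d v J \<alpha> = trig_sum (\<lambda>(i, j). c i * d j) (\<lambda>(i, j). u i + v j) (I \<times> J) \<alpha>"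
  unfolding trig_sum_def sum_product
  by (simp add: sum.cartesian_product' ee_add ring_distribs mult_ac)

lemma integral_norm_trig_sum_square:
  "complex_of_real (\<integral>\<alpha>. (cmod (trig_sum c u I \<alpha>))\<^sup>2 \<partial>unit_circle) =
    (\<Sum>i\<in>I. \<Sum>j\<in>I. c i * cnj (c j) * of_bool (u i = u j))"
proof -
  have "complex_of_real (\<integral>\<alpha>. (cmod (trig_sum c u I \<alpha>))\<^sup>2 \<partial>unit_circle) =
      (\<integral>\<alpha>. complex_of_real ((cmod (trig_sum c u I \<alpha>))\<^sup>2) \<partial>unit_circle)"
    by (rule integral_complex_of_real[symmetric])
  also have "\<dots> = (\<integral>\<alpha>. (\<Sum>i\<in>I. \<Sum>j\<in>I. c i * cnj (c j) * ee (of_int (u i - u j) * \<alpha>)) \<partial>unit_circle)"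
    unfolding complex_norm_square trig_sum_def
    by (simp add: cnj_ee sum_product mult_ac flip: ee_add) (simp add: algebra_simps)
  also have "\<dots> = (\<Sum>i\<in>I. \<Sum>j\<in>I. (\<integral>\<alpha>. c i * cnj (c j) * ee (of_int (u i - u j) * \<alpha>) \<partial>unit_circle))"
    by (subst Bochner_Integration.integral_sum; (intro integrable_unit_circle continuous_intros)?)
       (intro sum.cong refl Bochner_Integration.integral_sum integrable_unit_circle continuous_intros)
  also have "\<dots> = (\<Sum>i\<in>I. \<Sum>j\<in>I. c i * cnj (c j) * of_bool (u i = u j))"
    by (simp only: integral_mult_right_zero integral_ee) simp
  finally show ?thesis .
qed

text \<open>The passage from integrals to counting: by orthogonality only coincidences survive, and
  coefficients of modulus at most 1 do no harm.\<close>

lemma integral_norm_trig_sum_square_le: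
  assumes "\<And>i. i \<in> I \<Longrightarrow> cmod (c i) \<le> 1"
  shows "(\<integral>\<alpha>. (cmod (trig_sum c u I \<alpha>))\<^sup>2 \<partial>unit_circle) \<le> energy u I"
proof -
  have "(\<integral>\<alpha>. (cmod (trig_sum c u I \<alpha>))\<^sup>2 \<partial>unit_circle) \<le>
      cmod (complex_of_real (\<integral>\<alpha>. (cmod (trig_sum c u I \<alpha>))\<^sup>2 \<partial>unit_circle))"
    by simp
  also have "\<dots> \<le> (\<Sum>i\<in>I. \<Sum>j\<in>I. cmod (c i * cnj (c j) * of_bool (u i = u j)))"
    unfolding integral_norm_trig_sum_square by (intro order.trans[OF norm_sum] sum_mono norm_sum)
  also have "\<dots> \<le> energy u I"
    unfolding energy_def
    by (intro sum_mono) (auto simp: norm_mult intro!: mult_le_one assms)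
  finally show ?thesis .
qed

lemma integral_norm_trig_sum_square_inj:
  assumes "finite I" "inj_on u I"
  shows "(\<integral>\<alpha>. (cmod (trig_sum c u I \<alpha>))\<^sup>2 \<partial>unit_circle) = (\<Sum>i\<in>I. (cmod (c i))\<^sup>2)"
proof -
  have "complex_of_real (\<integral>\<alpha>. (cmod (trig_sum c u I \<alpha>))\<^sup>2 \<partial>unit_circle) = (\<Sum>i\<in>I. c i * cnj (c i))"
    unfolding integral_norm_trig_sum_square
  proof (intro sum.cong refl)
    fix i assume "i \<in> I"
    then have "(\<Sum>j\<in>I. c i * cnj (c j) * of_bool (u i = u j)) = (\<Sum>j\<in>I. if j = i then c i * cnj (c i) else 0)"
      using assms(2) by (intro sum.cong refl) (auto simp: inj_on_eq_iff)
    then show "(\<Sum>j\<in>I. c i * cnj (c j) * of_bool (u i = u j)) = c i * cnj (c i)"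
      using assms(1) \<open>i \<in> I\<close> by simp
  qed
  also have "\<dots> = complex_of_real (\<Sum>i\<in>I. (cmod (c i))\<^sup>2)"
    by (simp only: of_real_sum complex_norm_square)
  finally show ?thesis by (simp only: of_real_eq_iff)
qed

lemma integral_Cauchy_Schwarz:
  fixes a b :: "'a \<Rightarrow> real"
  assumes "integrable M (\<lambda>x. (a x)\<^sup>2)" "integrable M (\<lambda>x. (b x)\<^sup>2)" "integrable M (\<lambda>x. a x * b x)"
  shows "(\<integral>x. a x * b x \<partial>M)\<^sup>2 \<le> (\<integral>x. (a x)\<^sup>2 \<partial>M) * (\<integral>x. (b x)\<^sup>2 \<partial>M)"
proof -
  define A where "A = (\<integral>x. (a x)\<^sup>2 \<partial>M)"
  define B where "B = (\<integral>x. (b x)\<^sup>2 \<partial>M)"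
  define C where "C = (\<integral>x. a x * b x \<partial>M)"
  have q: "s\<^sup>2 * A - 2 * s * t * C + t\<^sup>2 * B \<ge> 0" for s t
  proof -
    have "0 \<le> (\<integral>x. (s * a x - t * b x)\<^sup>2 \<partial>M)" by simp
    also have "\<dots> = (\<integral>x. s\<^sup>2 * (a x)\<^sup>2 - 2 * s * t * (a x * b x) + t\<^sup>2 * (b x)\<^sup>2 \<partial>M)"
      by (intro Bochner_Integration.integral_cong) (auto simp: power2_eq_square algebra_simps)
    also have "\<dots> = s\<^sup>2 * A - 2 * s * t * C + t\<^sup>2 * B"
      using assms unfolding A_def B_def C_def by simp
    finally show ?thesis .
  qed
  have B0: "B \<ge> 0" unfolding B_def by simp
  have "C\<^sup>2 \<le> A * B"
  proof (cases "B = 0")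
    case True
    have "C = 0"
    proof (rule ccontr)
      assume "C \<noteq> 0"
      \<comment> \<open>With B = 0 the form at s = 1 is A - 2 t C, which equals -1 for this
        t.\<close>
      then show False using q[of 1 "(A + 1) / (2 * C)"] True by simp
    qed
    then show ?thesis using True by simp
  next
    case False
    \<comment> \<open>The choice s = B, t = C minimises the form up to scaling.\<close>
    then have "B * (A * B - C\<^sup>2) \<ge> 0"
      using q[of B C] by (simp add: power2_eq_square algebra_simps)
    then show ?thesis using False B0 by (simp add: zero_le_mult_iff)
  qed
  then show ?thesis unfolding A_def B_def C_def .
qed

definition cube_sum :: "nat \<Rightarrow> real \<Rightarrow> complex" where
  "cube_sum X = trig_sum (\<lambda>_. 1) (\<lambda>x. int x ^ 3) {1..X}"

definition step_sum :: "nat \<Rightarrow> nat \<Rightarrow> real \<Rightarrow> complex" where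
  "step_sum X h = trig_sum (\<lambda>_. 1) (cube_step h) {1..X-h}"

lemma continuous_on_cube_sum [continuous_intros]: "continuous_on A (cube_sum X)"
  unfolding cube_sum_def by (rule continuous_on_trig_sum)

lemma continuous_on_step_sum [continuous_intros]: "continuous_on A (step_sum X h)"
  unfolding step_sum_def by (rule continuous_on_trig_sum)

text \<open>One differencing step, squared, with Cauchy-Schwarz over h. It is used pointwise for
  Weyl's inequality and, multiplied by |f|^4 and integrated, for the eighth moment.\<close>

lemma norm_cube_sum_pow4_le:
  "cmod (cube_sum X \<alpha>) ^ 4 \<le> 2 * (real X)\<^sup>2 + 8 * real X * (\<Sum>h\<in>{1..<X}. (cmod (step_sum X h \<alpha>))\<^sup>2)"
proof -
  define T where "T = (\<Sum>h\<in>{1..<X}. step_sum X h \<alpha>)"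
  have "(cmod (cube_sum X \<alpha>))\<^sup>2 \<le> real X + 2 * cmod T"
    using sum_weyl_difference_le[where n = X and \<phi> = "\<lambda>x. real x ^ 3 * \<alpha>"]
    unfolding cube_sum_def T_def step_sum_def trig_sum_def cube_step_def
    by (simp add: algebra_simps)
  then have "((cmod (cube_sum X \<alpha>))\<^sup>2)\<^sup>2 \<le> (real X + 2 * cmod T)\<^sup>2"
    by (intro power_mono) auto
  also have "\<dots> \<le> 2 * (real X)\<^sup>2 + 8 * (cmod T)\<^sup>2"
    using zero_le_power2[of "real X - 2 * cmod T"] by (simp add: power2_eq_square algebra_simps)
  also have "(cmod T)\<^sup>2 \<le> (\<Sum>h\<in>{1..<X}. 1 * cmod (step_sum X h \<alpha>))\<^sup>2"
    unfolding T_def by (intro power_mono) (simp_all add: norm_sum)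
  also have "\<dots> \<le> (\<Sum>h\<in>{1..<X}. 1\<^sup>2) * (\<Sum>h\<in>{1..<X}. (cmod (step_sum X h \<alpha>))\<^sup>2)"
    by (rule Cauchy_Schwarz_ineq_sum)
  also have "\<dots> \<le> real X * (\<Sum>h\<in>{1..<X}. (cmod (step_sum X h \<alpha>))\<^sup>2)"
    by (intro mult_right_mono sum_nonneg) auto
  finally show ?thesis by (simp add: mult.assoc)
qed

text \<open>Multiplying by f adds a cube to every frequency.\<close>

lemma integral_cube_sum_mult_le:
  assumes "\<And>i. i \<in> I \<Longrightarrow> cmod (c i) \<le> 1"
  shows "(\<integral>\<alpha>. (cmod (cube_sum X \<alpha>) * cmod (trig_sum c u I \<alpha>))\<^sup>2 \<partial>unit_circle) \<le>
    energy (\<lambda>(i, x). u i + int x ^ 3) (I \<times> {1..X})"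
proof -
  have "cmod (cube_sum X \<alpha>) * cmod (trig_sum c u I \<alpha>) =
      cmod (trig_sum (\<lambda>(i, x). c i * 1) (\<lambda>(i, x). u i + int x ^ 3) (I \<times> {1..X}) \<alpha>)" for \<alpha>
    unfolding trig_sum_mult[symmetric] cube_sum_def by (simp add: norm_mult mult.commute)
  then show ?thesis
    using assms by (simp only:) (intro integral_norm_trig_sum_square_le, auto)
qed

section \<open>Fourth and eighth moments of the cubic sum\<close>

context divisor_bounded
begin

lemma abs_cube_diff_le:
  assumes "i \<in> {1..X}" "j \<in> {1..X}"
  shows "\<bar>int i ^ 3 - int j ^ 3\<bar> \<le> 9 * int X ^ 3"
proof -
  have "int i ^ 3 \<le> int X ^ 3" "int j ^ 3 \<le> int X ^ 3"
    using assms by (auto intro!: power_mono)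
  moreover have "int i ^ 3 \<ge> 0" "int j ^ 3 \<ge> 0" by auto
  ultimately show ?thesis by linarith
qed

lemma energy_two_cubes_le:
  "energy (\<lambda>(x, y). int x ^ 3 + int y ^ 3) ({1..X} \<times> {1..X}) \<le> 2 * D * (real X)\<^sup>2"
proof -
  have "energy (\<lambda>x. int x ^ 3) {1..X} = real X"
    by (subst energy_inj) (auto intro!: inj_onI simp: power_eq_iff_eq_base)
  then have "energy (\<lambda>(x, y). int x ^ 3 + int y ^ 3) ({1..X} \<times> {1..X}) \<le> (real X)\<^sup>2 + D * (real X)\<^sup>2"
    using energy_add_cube_le[of "{1..X}" "\<lambda>x. int x ^ 3"] abs_cube_diff_le by (simp add: power2_eq_square)
  also have "\<dots> \<le> 2 * D * (real X)\<^sup>2"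
    using D_ge_1 by (simp add: mult_le_cancel_right1 algebra_simps)
  finally show ?thesis .
qed

lemma integral_cube_sum_pow4_le:
  "(\<integral>\<alpha>. cmod (cube_sum X \<alpha>) ^ 4 \<partial>unit_circle) \<le> 2 * D * (real X)\<^sup>2"
proof -
  have "(\<integral>\<alpha>. cmod (cube_sum X \<alpha>) ^ 4 \<partial>unit_circle) =
      (\<integral>\<alpha>. (cmod (cube_sum X \<alpha>) * cmod (trig_sum (\<lambda>_. 1) (\<lambda>x. int x ^ 3) {1..X} \<alpha>))\<^sup>2 \<partial>unit_circle)"
    unfolding cube_sum_def[symmetric] by (simp add: power2_eq_square power4_eq_xxxx mult_ac)
  also have "\<dots> \<le> energy (\<lambda>(x, y). int x ^ 3 + int y ^ 3) ({1..X} \<times> {1..X})"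
    by (rule integral_cube_sum_mult_le) auto
  finally show ?thesis using energy_two_cubes_le by linarith
qed

text \<open>Hua's lemma: one factor |f|^4 is differenced, the other is the squared modulus of the
  sum over u = x^3 + y^3. The integrals that arise are the counts of
  \<open>energy_add_cube_step_le\<close>.\<close>

lemma integral_cube_sum_pow8_le:
  "(\<integral>\<alpha>. cmod (cube_sum X \<alpha>) ^ 8 \<partial>unit_circle) \<le> 28 * D\<^sup>2 * real X ^ 5"
proof -
  define u where "u p = int (fst p) ^ 3 + int (snd p) ^ 3" for p :: "nat \<times> nat"
  define I where "I = {1..X} \<times> {1..X}"
  define F where "F \<alpha> = cmod (cube_sum X \<alpha>)" for \<alpha>
  have E: "energy u I \<le> 2 * D * (real X)\<^sup>2"
    using energy_two_cubes_le unfolding u_def I_def case_prod_beta .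
  have cF: "continuous_on UNIV F"
    unfolding F_def by (intro continuous_intros)
  have r: "\<bar>u i - u j\<bar> \<le> 9 * int X ^ 3" if "i \<in> I" "j \<in> I" for i j
  proof -
    have "0 \<le> u p \<and> u p \<le> 2 * int X ^ 3" if "p \<in> I" for p
    proof -
      have "fst p \<le> X" "snd p \<le> X" using that by (auto simp: I_def)
      then have "int (fst p) ^ 3 \<le> int X ^ 3" "int (snd p) ^ 3 \<le> int X ^ 3"
        by (auto intro!: power_mono)
      moreover have "int (fst p) ^ 3 \<ge> 0" "int (snd p) ^ 3 \<ge> 0" by auto
      ultimately show ?thesis unfolding u_def by linarith
    qed
    from this[OF that(1)] this[OF that(2)] show ?thesis by auto
  qed
  have sq: "(F \<alpha>)\<^sup>2 = cmod (trig_sum (\<lambda>_. 1) u I \<alpha>)" for \<alpha>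
  proof -
    have "cube_sum X \<alpha> * cube_sum X \<alpha> = trig_sum (\<lambda>_. 1) u I \<alpha>"
      unfolding cube_sum_def trig_sum_mult by (simp add: u_def[abs_def] I_def case_prod_beta')
    then show ?thesis unfolding F_def by (metis norm_mult power2_eq_square)
  qed
  have step: "(\<integral>\<alpha>. (cmod (step_sum X h \<alpha>))\<^sup>2 * F \<alpha> ^ 4 \<partial>unit_circle) \<le>
      real X * energy u I + D * congruent_pairs h u I" if "h \<in> {1..<X}" for h
  proof -
    have "(cmod (step_sum X h \<alpha>))\<^sup>2 * F \<alpha> ^ 4 =
       (cmod (trig_sum (\<lambda>(i, z). 1 * 1) (\<lambda>(i, z). u i + cube_step h z) (I \<times> {1..X-h}) \<alpha>))\<^sup>2" for \<alpha>
    proof -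
      have "F \<alpha> ^ 4 = ((F \<alpha>)\<^sup>2)\<^sup>2" by simp
      then show ?thesis
        unfolding sq trig_sum_mult[symmetric] step_sum_def by (simp add: norm_mult power_mult_distrib mult.commute)
    qed
    then have "(\<integral>\<alpha>. (cmod (step_sum X h \<alpha>))\<^sup>2 * F \<alpha> ^ 4 \<partial>unit_circle) \<le>
        energy (\<lambda>(i, z). u i + cube_step h z) (I \<times> {1..X-h})"
      by (simp only:) (intro integral_norm_trig_sum_square_le, auto)
    also have "\<dots> \<le> real X * energy u I + D * congruent_pairs h u I"
      using that r by (intro energy_add_cube_step_le) (auto simp: I_def)
    finally show ?thesis .
  qed
  have "(\<integral>\<alpha>. F \<alpha> ^ 8 \<partial>unit_circle) \<le>
      (\<integral>\<alpha>. 2 * (real X)\<^sup>2 * F \<alpha> ^ 4 + 8 * real X * (\<Sum>h\<in>{1..<X}. (cmod (step_sum X h \<alpha>))\<^sup>2 * F \<alpha> ^ 4) \<partial>unit_circle)"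
  proof (intro integral_mono integrable_unit_circle)
    fix \<alpha>
    have "F \<alpha> ^ 4 * F \<alpha> ^ 4 \<le> (2 * (real X)\<^sup>2 + 8 * real X * (\<Sum>h\<in>{1..<X}. (cmod (step_sum X h \<alpha>))\<^sup>2)) * F \<alpha> ^ 4"
      unfolding F_def by (intro mult_right_mono norm_cube_sum_pow4_le) auto
    then show "F \<alpha> ^ 8 \<le> 2 * (real X)\<^sup>2 * F \<alpha> ^ 4 + 8 * real X * (\<Sum>h\<in>{1..<X}. (cmod (step_sum X h \<alpha>))\<^sup>2 * F \<alpha> ^ 4)"
      unfolding sum_distrib_right[symmetric] by (simp add: distrib_right mult.assoc flip: power_add)
  qed (intro continuous_intros cF)+
  also have "\<dots> = 2 * (real X)\<^sup>2 * (\<integral>\<alpha>. F \<alpha> ^ 4 \<partial>unit_circle) +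
      8 * real X * (\<Sum>h\<in>{1..<X}. (\<integral>\<alpha>. (cmod (step_sum X h \<alpha>))\<^sup>2 * F \<alpha> ^ 4 \<partial>unit_circle))"
    by (subst Bochner_Integration.integral_add Bochner_Integration.integral_sum integral_mult_right_zero;
      (intro integrable_unit_circle continuous_intros cF)?)+ simp
  also have "\<dots> \<le> 2 * (real X)\<^sup>2 * (2 * D * (real X)\<^sup>2) +
      8 * real X * (\<Sum>h\<in>{1..<X}. real X * energy u I + D * congruent_pairs h u I)"
    using integral_cube_sum_pow4_le unfolding F_def[symmetric]
    by (intro add_mono mult_left_mono sum_mono step) auto
  \<comment> \<open>Only the diagonal term is multiplied by the number of h; the congruent pairs are
    summed over h through divisors, so both parts have size X^4.\<close>
  also have "(\<Sum>h\<in>{1..<X}. real X * energy u I + D * congruent_pairs h u I) \<le>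
      real X * (real X * (2 * D * (real X)\<^sup>2)) + D * (D * real X ^ 4)"
  proof -
    have "real (X - 1) * (real X * energy u I) \<le> real X * (real X * (2 * D * (real X)\<^sup>2))"
      using E energy_nonneg[of u I] by (intro mult_mono mult_left_mono) auto
    moreover have "D * (\<Sum>h\<in>{1..<X}. congruent_pairs h u I) \<le> D * (D * real X ^ 4)"
      using sum_congruent_pairs_le[of I u "{1..<X}"] r D_ge_1
      by (intro mult_left_mono) (auto simp: I_def power2_eq_square power4_eq_xxxx)
    ultimately show ?thesis
      by (simp add: sum.distrib sum_distrib_left)
  qed
  also have "2 * (real X)\<^sup>2 * (2 * D * (real X)\<^sup>2) + 8 * real X * (real X * (real X * (2 * D * (real X)\<^sup>2)) + D * (D * real X ^ 4))
     = 4 * (D * real X ^ 4) + 16 * (D * real X ^ 5) + 8 * (D\<^sup>2 * real X ^ 5)"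
    by (simp add: power2_eq_square eval_nat_numeral algebra_simps)
  also have "\<dots> \<le> 28 * D\<^sup>2 * real X ^ 5"
  proof -
    have "D * real X ^ 4 \<le> D\<^sup>2 * real X ^ 5"
      using D_ge_1 X_pos by (intro mult_mono power_increasing) (auto simp: power2_eq_square)
    moreover have "D * real X ^ 5 \<le> D\<^sup>2 * real X ^ 5"
      using D_ge_1 by (intro mult_right_mono) (auto simp: power2_eq_square)
    ultimately show ?thesis by linarith
  qed
  finally show ?thesis unfolding F_def by (simp add: mult_left_mono)
qed

end

section \<open>Weyl differencing and rational approximation\<close>

definition nint_dist :: "real \<Rightarrow> real" where
  "nint_dist \<theta> = \<bar>\<theta> - of_int (round \<theta>)\<bar>"

lemma nint_dist_nonneg: "nint_dist \<theta> \<ge> 0"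
  by (simp add: nint_dist_def)

lemma sin_ge_chord:
  assumes "0 \<le> x" "x \<le> pi / 2"
  shows "sin x \<ge> 2 * x / pi"
proof -
  have "convex_on {0..pi} (\<lambda>x. - sin x)"
  proof (rule f''_ge0_imp_convex)
    show "((\<lambda>x. - sin x) has_real_derivative - cos x) (at x)" for x
      by (auto intro!: derivative_eq_intros)
    show "((\<lambda>x. - cos x) has_real_derivative sin x) (at x)" for x
      by (auto intro!: derivative_eq_intros)
  qed (auto intro: sin_ge_zero)
  then have "- sin ((1 - 2 * x / pi) *\<^sub>R 0 + (2 * x / pi) *\<^sub>R (pi / 2)) \<le>
      (1 - 2 * x / pi) * (- sin 0) + (2 * x / pi) * (- sin (pi / 2))"
    using assms by (intro convex_onD) (auto simp: field_simps)
  then show ?thesis by simp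
qed

text \<open>|e(t) - 1| = 2 |sin(pi t)|, and for |t| <= 1/2 concavity of the sine gives at least 4
  |t|.\<close>

lemma norm_ee_minus_1_ge: "cmod (ee \<theta> - 1) \<ge> 4 * nint_dist \<theta>"
proof -
  define t where "t = \<theta> - of_int (round \<theta>)"
  have t: "\<bar>t\<bar> \<le> 1 / 2"
    using of_int_round_abs_le[of \<theta>] by (simp add: t_def abs_minus_commute)
  have "ee \<theta> = ee t"
    using ee_add[of t "of_int (round \<theta>)"] by (simp add: t_def)
  also have "ee t = cis (2 * (pi * t))"
    by (simp add: ee_def cis_conv_exp mult_ac)
  finally have e: "ee \<theta> = cis (2 * (pi * t))" .
  have "(cmod (ee \<theta> - 1))\<^sup>2 = (cos (2 * (pi * t)) - 1)\<^sup>2 + (sin (2 * (pi * t)))\<^sup>2"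
    unfolding e by (simp add: cmod_power2)
  also have "\<dots> = 2 - 2 * cos (2 * (pi * t))"
    using sin_cos_squared_add[of "2 * (pi * t)"] by (simp add: power2_eq_square algebra_simps)
  also have "\<dots> = (2 * sin (pi * t))\<^sup>2"
    by (simp add: cos_double_sin power_mult_distrib)
  finally have "cmod (ee \<theta> - 1) = 2 * \<bar>sin (pi * t)\<bar>"
    by (metis abs_mult abs_norm_cancel abs_numeral power2_eq_iff_nonneg abs_ge_zero power2_abs)
  moreover have "\<bar>sin (pi * t)\<bar> = sin (pi * \<bar>t\<bar>)"
  proof -
    have "sin (pi * \<bar>t\<bar>) \<ge> 0"
      using t by (intro sin_ge_zero) (auto simp: mult_le_cancel_left1 intro: order_trans)
    then show ?thesis by (cases "t \<ge> 0") auto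
  qed
  moreover have "sin (pi * \<bar>t\<bar>) \<ge> 2 * (pi * \<bar>t\<bar>) / pi"
    using t by (intro sin_ge_chord) auto
  ultimately show ?thesis
    by (simp add: nint_dist_def t_def[symmetric])
qed

text \<open>The trivial bound s <= X and the telescoped bound 2 s \<open>nint_dist \<theta>\<close>
  <= 1, multiplied by X, are added up.\<close>

lemma norm_geometric_sum_le:
  assumes "n \<le> X"
  shows "cmod (\<Sum>z\<in>{1..n}. ee (\<theta> * real z + c)) \<le> 2 * real X / (1 + 2 * real X * nint_dist \<theta>)"
proof -
  define s where "s = cmod (\<Sum>z\<in>{1..n}. ee (\<theta> * real z + c))"
  define G where "G = (\<Sum>z\<in>{1..n}. ee (\<theta> * real z))"
  have s: "s = cmod G"
    unfolding s_def G_def ee_add sum_distrib_right[symmetric] by (simp add: norm_mult)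
  have tel: "(ee \<theta> - 1) * (\<Sum>z\<in>{1..n}. ee (\<theta> * real z)) = ee (\<theta> * real (Suc n)) - ee \<theta>" for n
  proof (induction n)
    case (Suc n)
    have "ee (\<theta> * real (Suc (Suc n))) = ee \<theta> * ee (\<theta> * real (Suc n))"
      by (simp add: ee_add[symmetric] algebra_simps)
    then show ?case using Suc by (simp add: algebra_simps)
  qed simp
  have "s \<le> (\<Sum>z\<in>{1..n}. 1)"
    unfolding s_def by (rule sum_norm_le) simp
  then have s1: "s \<le> real X" using assms by simp
  have "s * (4 * nint_dist \<theta>) \<le> s * cmod (ee \<theta> - 1)"
    by (intro mult_left_mono norm_ee_minus_1_ge) (simp add: s_def)
  also have "\<dots> = cmod (ee (\<theta> * real (Suc n)) - ee \<theta>)"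
    unfolding s tel[symmetric, of n] G_def by (simp add: norm_mult mult.commute)
  also have "\<dots> \<le> 2"
    using norm_triangle_ineq4[of "ee (\<theta> * real (Suc n))" "ee \<theta>"] by simp
  finally have s2: "s * (2 * nint_dist \<theta>) \<le> 1" by simp
  have "real X * (s * (2 * nint_dist \<theta>)) \<le> real X * 1"
    using s2 by (intro mult_left_mono) auto
  then have "s * (1 + 2 * real X * nint_dist \<theta>) \<le> 2 * real X"
    using s1 by (simp add: algebra_simps)
  moreover have "1 + 2 * real X * nint_dist \<theta> > 0"
    using nint_dist_nonneg[of \<theta>] by (simp add: add_pos_nonneg)
  ultimately show ?thesis
    unfolding s_def[symmetric] by (simp add: pos_le_divide_eq)
qed

text \<open>This is min X (1 / (2 * nint_dist \<theta>)) up to a factor 2, in a form without a division by 0.\<close>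

definition geometric_bound :: "nat \<Rightarrow> real \<Rightarrow> real" where
  "geometric_bound X \<theta> = 2 * real X / (1 + 2 * real X * nint_dist \<theta>)"

lemma geometric_bound_nonneg: "geometric_bound X \<theta> \<ge> 0"
  using nint_dist_nonneg[of \<theta>] by (simp add: geometric_bound_def)

lemma geometric_bound_le: "geometric_bound X \<theta> \<le> 2 * real X"
proof -
  have "2 * real X / (1 + 2 * real X * nint_dist \<theta>) \<le> 2 * real X / 1"
    using nint_dist_nonneg[of \<theta>] by (intro divide_left_mono) (auto intro!: add_pos_nonneg)
  then show ?thesis by (simp add: geometric_bound_def)
qed

lemma geometric_bound_le_inverse:
  assumes "d > 0" "d \<le> nint_dist \<theta>"
  shows "geometric_bound X \<theta> \<le> 1 / d"
proof -
  have "2 * real X * d \<le> 2 * real X * nint_dist \<theta>"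
    using assms by (intro mult_left_mono) auto
  moreover have "1 + 2 * real X * nint_dist \<theta> > 0"
    using nint_dist_nonneg[of \<theta>] by (simp add: add_pos_nonneg)
  ultimately show ?thesis
    using assms unfolding geometric_bound_def by (simp add: divide_simps mult_ac)
qed

text \<open>A second differencing step makes the phase linear in z, with slope 6 h k \<alpha>, so
  the inner sums are geometric.\<close>

lemma norm_step_sum_square_le:
  "(cmod (step_sum X h \<alpha>))\<^sup>2 \<le>
    real X + 2 * (\<Sum>k\<in>{1..<X}. geometric_bound X (real (6 * h * k) * \<alpha>))"
proof -
  define \<phi> where "\<phi> z = real_of_int (cube_step h z) * \<alpha>" for z
  have d: "\<phi> (z + k) - \<phi> z = (real (6 * h * k) * \<alpha>) * real z + 3 * real h * real k * (real h + real k) * \<alpha>" for z k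
  proof -
    have "\<phi> (z + k) - \<phi> z = real_of_int (cube_step h (z + k) - cube_step h z) * \<alpha>"
      by (simp add: \<phi>_def left_diff_distrib)
    then show ?thesis unfolding cube_step_diff by (simp add: algebra_simps)
  qed
  have "(cmod (step_sum X h \<alpha>))\<^sup>2 \<le>
      real (X - h) + 2 * cmod (\<Sum>k\<in>{1..<X-h}. \<Sum>z\<in>{1..X-h-k}. ee (\<phi> (z + k) - \<phi> z))"
    using sum_weyl_difference_le[where n = "X - h" and \<phi> = \<phi>]
    by (simp add: step_sum_def trig_sum_def \<phi>_def)
  also have "\<dots> \<le> real X + 2 * (\<Sum>k\<in>{1..<X-h}. geometric_bound X (real (6 * h * k) * \<alpha>))"
    unfolding d geometric_bound_def
    by (intro add_mono mult_left_mono sum_norm_le norm_geometric_sum_le) auto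
  also have "\<dots> \<le> real X + 2 * (\<Sum>k\<in>{1..<X}. geometric_bound X (real (6 * h * k) * \<alpha>))"
    by (intro add_mono mult_left_mono sum_mono2 geometric_bound_nonneg) auto
  finally show ?thesis .
qed

text \<open>Each block of q consecutive integers contains at most one such m, and
  \<open>(m - 1) div q\<close> numbers the blocks.\<close>

lemma card_residue_le:
  fixes a r :: int and q N :: nat
  assumes "q > 0" "coprime a (int q)"
  shows "real (card {m \<in> {1..N}. (int m * a) mod int q = r}) \<le> real N / real q + 1"
proof -
  let ?A = "{m \<in> {1..N}. (int m * a) mod int q = r}"
  have inj: "inj_on (\<lambda>m. (m - 1) div q) ?A"
  proof (rule inj_onI, clarify)
    fix m m' :: nat
    assume a: "m \<in> {1..N}" "m' \<in> {1..N}" "(m - 1) div q = (m' - 1) div q"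
      "int m' * a mod int q = int m * a mod int q"
    have "int q dvd (int m' - int m) * a"
      using a(4) by (simp add: mod_eq_dvd_iff left_diff_distrib)
    then have "int q dvd int m' - int m"
      using assms(2) by (simp add: coprime_dvd_mult_left_iff coprime_commute)
    then have "int (m' - 1) mod int q = int (m - 1) mod int q"
      using a(1,2) by (simp add: mod_eq_dvd_iff of_nat_diff)
    then have "(m' - 1) mod q = (m - 1) mod q"
      by (simp flip: of_nat_mod)
    then have "m' - 1 = m - 1" using a(3) by (metis div_mult_mod_eq)
    then show "m = m'" using a by auto
  qed
  have "(\<lambda>m. (m - 1) div q) ` ?A \<subseteq> {..(N - 1) div q}"
    by (auto intro!: div_le_mono)
  then have "card ?A \<le> card {..(N - 1) div q}"
    using inj by (intro card_inj_on_le) auto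
  also have "\<dots> = (N - 1) div q + 1" by simp
  finally have "real (card ?A) \<le> real ((N - 1) div q) + 1" by linarith
  also have "real ((N - 1) div q) \<le> real (N - 1) / real q"
    by (rule of_nat_div_le_of_nat)
  also have "\<dots> \<le> real N / real q"
    by (intro divide_right_mono) auto
  finally show ?thesis by simp
qed

lemma sum_inverse_both_le: "(\<Sum>r\<in>{1..<q}. 1 / real r + 1 / real (q - r)) \<le> 2 * harm q"
proof -
  have "(\<Sum>r\<in>{1..<q}. 1 / real (q - r)) = (\<Sum>r\<in>{1..<q}. 1 / real r)"
    by (rule sum.reindex_bij_witness[of _ "\<lambda>x. q - x" "\<lambda>x. q - x"]) auto
  moreover have "(\<Sum>r\<in>{1..<q}. 1 / real r) \<le> harm q"
    unfolding harm_def inverse_eq_divide by (intro sum_mono2) auto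
  ultimately show ?thesis by (simp add: sum.distrib)
qed

text \<open>The fraction m a / q is at distance min(r, q - r) / q from the integers, and replacing
  a/q by \<alpha> costs at most half of that. The sum 1/r + 1/(q - r) bounds the reciprocal of the
  minimum and sums to harmonic numbers.\<close>

lemma nint_dist_approx_ge:
  fixes a :: int and m q :: nat
  assumes "q > 0" "real m * \<bar>\<alpha> - of_int a / real q\<bar> \<le> 1 / (2 * real q)"
    and r: "r = nat ((int m * a) mod int q)" "r > 0"
  shows "nint_dist (real m * \<alpha>) > 0"
    and "1 / nint_dist (real m * \<alpha>) \<le> 2 * real q * (1 / real r + 1 / real (q - r))"
proof -
  define k where "k = round (real m * \<alpha>)"
  define x where "x = int m * a - k * int q"
  have rq: "r < q" using r assms(1) by (simp add: nat_less_iff)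
  have ri: "int r = (int m * a) mod int q" using r assms(1) by simp
  define t where "t = (int m * a) div int q - k"
  have x: "x = int r + t * int q"
    unfolding x_def t_def ri by (simp add: algebra_simps)
  define \<mu> where "\<mu> = real (min r (q - r))"
  have \<mu>1: "\<mu> \<ge> 1" using r(2) rq by (auto simp: \<mu>_def min_def)
  \<comment> \<open>Whatever integer k is nearest, x is congruent to r modulo q.\<close>
  have "\<bar>x\<bar> \<ge> int (min r (q - r))"
  proof (cases "t \<ge> 0")
    case True
    then have "x \<ge> int r" unfolding x by simp
    then show ?thesis by auto
  next
    case False
    then have "t * int q \<le> (-1) * int q" by (intro mult_right_mono) auto
    then have "x \<le> int r - int q" unfolding x by simp
    then show ?thesis using rq by (auto simp: of_nat_diff min_def)
  qed
  then have xm: "\<bar>real_of_int x\<bar> \<ge> \<mu>"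
    unfolding \<mu>_def by linarith
  have "real m * \<alpha> - of_int k = real_of_int x / real q + real m * (\<alpha> - of_int a / real q)"
    using assms(1) by (simp add: x_def field_simps)
  moreover have "\<bar>A\<bar> - \<bar>B\<bar> \<le> \<bar>A + B\<bar>" for A B :: real
    by linarith
  ultimately have "nint_dist (real m * \<alpha>) \<ge> \<bar>real_of_int x / real q\<bar> - \<bar>real m * (\<alpha> - of_int a / real q)\<bar>"
    unfolding nint_dist_def k_def[symmetric] by metis
  moreover have "\<bar>real_of_int x / real q\<bar> \<ge> \<mu> / real q"
    using xm assms(1) by (simp add: divide_right_mono)
  moreover have "\<bar>real m * (\<alpha> - of_int a / real q)\<bar> \<le> \<mu> / (2 * real q)"
  proof -
    have "\<bar>real m * (\<alpha> - of_int a / real q)\<bar> \<le> 1 / (2 * real q)"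
      using assms(2) by (simp add: abs_mult)
    also have "\<dots> \<le> \<mu> / (2 * real q)" using \<mu>1 by (intro divide_right_mono) auto
    finally show ?thesis .
  qed
  ultimately have ge: "nint_dist (real m * \<alpha>) \<ge> \<mu> / (2 * real q)"
    using assms(1) by (simp add: field_simps)
  have pos: "\<mu> / (2 * real q) > 0" using \<mu>1 assms(1) by simp
  show "nint_dist (real m * \<alpha>) > 0" using ge pos by linarith
  have "1 / nint_dist (real m * \<alpha>) \<le> 1 / (\<mu> / (2 * real q))"
    using ge pos by (intro frac_le) auto
  also have "\<dots> = 2 * real q * (1 / \<mu>)" by simp
  also have "\<dots> \<le> 2 * real q * (1 / real r + 1 / real (q - r))"
    using rq r(2) unfolding \<mu>_def by (intro mult_left_mono) (auto simp: min_def)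
  finally show "1 / nint_dist (real m * \<alpha>) \<le> 2 * real q * (1 / real r + 1 / real (q - r))" .
qed

text \<open>12 X^2 is the bound for denominators in Dirichlet's theorem; the harmonic sums and
  logarithms that arise later are thereby also absorbed into \<open>D\<close>.\<close>

locale weyl_bounded = divisor_bounded +
  assumes harm_le: "harm (12 * X\<^sup>2) \<le> D"
begin

lemma harm_le_D: "n \<le> 12 * X\<^sup>2 \<Longrightarrow> harm n \<le> D"
  using harm_le harm_mono[of n "12 * X\<^sup>2"] by (meson order_trans)

text \<open>Multiples of q are separated from the rest. For m = q j the distance of m \<alpha> to
  the integers is governed by m |\<alpha> - a/q|; keeping this dependence yields the factor 1 + X^3
  |\<alpha> - a/q| in the denominator, needed later for integration over arcs.\<close>

lemma sum_geometric_bound_le: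
  fixes a :: int and q :: nat
  assumes q: "q > 0" "q \<le> 12 * X\<^sup>2" "coprime a (int q)"
    and \<beta>: "\<bar>\<alpha> - of_int a / real q\<bar> \<le> 1 / (12 * (real X)\<^sup>2 * real q)"
  shows "(\<Sum>m\<in>{1..6 * X\<^sup>2}. geometric_bound X (real m * \<alpha>)) \<le>
    D * (72 * (real X)\<^sup>2 + 24 * real X ^ 3 / (real q * (1 + real X ^ 3 * \<bar>\<alpha> - of_int a / real q\<bar>)))"
proof -
  define N where "N = 6 * X\<^sup>2"
  define b where "b = \<bar>\<alpha> - of_int a / real q\<bar>"
  define lam where "lam = real q * (1 + real X ^ 3 * b)"
  define g where "g m = geometric_bound X (real m * \<alpha>)" for m :: nat
  have x1: "real X \<ge> 1" using X_pos by simp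
  have N: "real N = 6 * (real X)\<^sup>2" by (simp add: N_def)
  have b0: "b \<ge> 0" by (simp add: b_def)
  have lam0: "lam > 0" using q b0 by (auto simp: lam_def intro!: mult_pos_pos add_pos_nonneg)
  \<comment> \<open>The constant 12 makes the perturbation at most 1/(2q) for every m up to 6
    X^2.\<close>
  have bN: "real N * b \<le> 1 / (2 * real q)"
  proof -
    have "real N * b \<le> real N * (1 / (12 * (real X)\<^sup>2 * real q))"
      using \<beta> unfolding b_def by (intro mult_left_mono) auto
    also have "\<dots> = 1 / (2 * real q)" using x1 q by (simp add: N)
    finally show ?thesis .
  qed
  have mb: "real m * b \<le> 1 / (2 * real q)" if "m \<le> N" for m
    using bN mult_right_mono[of "real m" "real N" b] that b0 by simp
  define r where "r m = nat ((int m * a) mod int q)" for m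
  define w where "w s = 2 * real q * (1 / real s + 1 / real (q - s))" for s
  have r0: "r m > 0" if "\<not> q dvd m" for m
  proof (rule ccontr)
    assume "\<not> r m > 0"
    moreover have "(int m * a) mod int q \<ge> 0" using q(1) by simp
    ultimately have "int q dvd int m * a"
      by (simp add: r_def dvd_eq_mod_eq_0)
    then have "int q dvd int m"
      using q(3) by (simp add: coprime_dvd_mult_left_iff coprime_commute)
    then show False using that by simp
  qed
  have rq: "r m < q" for m using q by (simp add: r_def nat_less_iff)
  have w0: "w s \<ge> 0" for s by (simp add: w_def)
  \<comment> \<open>Each non-zero residue modulo q is taken at most N/q + 1 times, and the weights
    sum to 2 q times a harmonic sum; 72 = 4 (6 + 12).\<close>
  have nondiv: "(\<Sum>m\<in>{m \<in> {1..N}. \<not> q dvd m}. g m) \<le> 72 * (real X)\<^sup>2 * D"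
  proof -
    have "(\<Sum>m\<in>{m \<in> {1..N}. \<not> q dvd m}. g m) \<le> (\<Sum>m\<in>{m \<in> {1..N}. \<not> q dvd m}. w (r m))"
    proof (intro sum_mono)
      fix m assume m: "m \<in> {m \<in> {1..N}. \<not> q dvd m}"
      have "real m * \<bar>\<alpha> - of_int a / real q\<bar> \<le> 1 / (2 * real q)"
        using mb[of m] m by (simp add: b_def)
      note ap = nint_dist_approx_ge[OF q(1) this r_def r0]
      have "g m \<le> 1 / nint_dist (real m * \<alpha>)"
        unfolding g_def using ap(1) m by (intro geometric_bound_le_inverse) auto
      also have "\<dots> \<le> w (r m)" unfolding w_def using ap(2) m by simp
      finally show "g m \<le> w (r m)" .
    qed
    also have "\<dots> = (\<Sum>s\<in>{1..<q}. \<Sum>m\<in>{m \<in> {m \<in> {1..N}. \<not> q dvd m}. r m = s}. w (r m))"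
      using r0 rq by (intro sum.group[symmetric]) (auto simp: Suc_le_eq)
    also have "\<dots> \<le> (\<Sum>s\<in>{1..<q}. (real N / real q + 1) * w s)"
    proof (intro sum_mono)
      fix s assume "s \<in> {1..<q}"
      have "(\<Sum>m\<in>{m \<in> {m \<in> {1..N}. \<not> q dvd m}. r m = s}. w (r m)) =
          real (card {m \<in> {m \<in> {1..N}. \<not> q dvd m}. r m = s}) * w s"
        by simp
      also have "\<dots> \<le> (real N / real q + 1) * w s"
      proof (intro mult_right_mono w0)
        have "card {m \<in> {m \<in> {1..N}. \<not> q dvd m}. r m = s} \<le> card {m \<in> {1..N}. (int m * a) mod int q = int s}"
          using q(1) by (intro card_mono) (auto simp: r_def)
        then show "real (card {m \<in> {m \<in> {1..N}. \<not> q dvd m}. r m = s}) \<le> real N / real q + 1"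
          using card_residue_le[OF q(1,3), of N "int s"] by linarith
      qed
      finally show "(\<Sum>m\<in>{m \<in> {m \<in> {1..N}. \<not> q dvd m}. r m = s}. w (r m)) \<le> (real N / real q + 1) * w s" .
    qed
    also have "\<dots> = (real N / real q + 1) * (2 * real q) * (\<Sum>s\<in>{1..<q}. 1 / real s + 1 / real (q - s))"
      unfolding w_def sum_distrib_left by (simp only: mult.assoc)
    also have "\<dots> \<le> (real N / real q + 1) * (2 * real q) * (2 * D)"
      using sum_inverse_both_le[of q] harm_le_D[OF q(2)] by (intro mult_left_mono) auto
    also have "\<dots> = 4 * (real N + real q) * D"
      using q(1) by (simp add: field_simps)
    also have "\<dots> \<le> 4 * (6 * (real X)\<^sup>2 + 12 * (real X)\<^sup>2) * D"
    proof -
      have "real q \<le> 12 * (real X)\<^sup>2"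
        using q(2) by (metis of_nat_le_iff of_nat_mult of_nat_numeral of_nat_power)
      then show ?thesis using D_ge_1 unfolding N by (intro mult_right_mono mult_left_mono) auto
    qed
    finally show ?thesis by simp
  qed
  have div: "(\<Sum>m\<in>{m \<in> {1..N}. q dvd m}. g m) \<le> 24 * real X ^ 3 / lam * D"
  proof -
    define J where "J = N div q"
    have J: "real J \<le> real N / real q" unfolding J_def by (rule of_nat_div_le_of_nat)
    have "{m \<in> {1..N}. q dvd m} = (\<lambda>j. q * j) ` {1..J}"
    proof (intro equalityI subsetI)
      fix m assume "m \<in> {m \<in> {1..N}. q dvd m}"
      then obtain j where "m = q * j" "q * j \<le> N" "q * j \<ge> 1" by auto
      then show "m \<in> (\<lambda>j. q * j) ` {1..J}"
        using q(1) by (auto simp: J_def less_eq_div_iff_mult_less_eq mult.commute intro!: image_eqI[of _ _ j] Suc_leI)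
    next
      fix m assume "m \<in> (\<lambda>j. q * j) ` {1..J}"
      then obtain j where "m = q * j" "j \<in> {1..J}" by (rule imageE)
      then show "m \<in> {m \<in> {1..N}. q dvd m}"
        using q(1) by (auto simp: J_def less_eq_div_iff_mult_less_eq mult.commute)
    qed
    then have e: "(\<Sum>m\<in>{m \<in> {1..N}. q dvd m}. g m) = (\<Sum>j\<in>{1..J}. g (q * j))"
      using q(1) by (simp add: sum.reindex inj_on_def)
    show ?thesis
    proof (cases "real X ^ 3 * b \<le> 1")
      \<comment> \<open>Very close to a/q only the trivial bound 2 X is available for each of the at
        most 6 X^2 / q multiples, and lam <= 2 q.\<close>
      case True
      have "lam \<le> 2 * real q" using True q(1) by (simp add: lam_def)
      have "(\<Sum>j\<in>{1..J}. g (q * j)) \<le> (\<Sum>j\<in>{1..J}. 2 * real X)"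
        unfolding g_def by (intro sum_mono geometric_bound_le)
      also have "\<dots> = real J * (2 * real X)" by simp
      also have "\<dots> \<le> real N / real q * (2 * real X)" using J by (intro mult_right_mono) auto
      also have "\<dots> = 24 * real X ^ 3 / (2 * real q)"
        by (simp add: N power2_eq_square power3_eq_cube)
      also have "\<dots> \<le> 24 * real X ^ 3 / lam"
        using \<open>lam \<le> 2 * real q\<close> lam0 by (intro divide_left_mono) auto
      also have "\<dots> \<le> 24 * real X ^ 3 / lam * D"
        using D_ge_1 lam0 mult_left_mono[of 1 D "24 * real X ^ 3 / lam"] by simp
      finally show ?thesis unfolding e .
    next
      case False
      then have bp: "b > 0" using b0 by (cases "b = 0") auto
      have lamle: "lam \<le> 2 * (real q * real X ^ 3 * b)" using False q(1) by (simp add: lam_def algebra_simps)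
      have "(\<Sum>j\<in>{1..J}. g (q * j)) \<le> (\<Sum>j\<in>{1..J}. 1 / (real q * b) * inverse (real j))"
      proof (intro sum_mono)
        fix j assume j: "j \<in> {1..J}"
        then have "q * j \<le> N"
          using q(1) by (simp add: J_def less_eq_div_iff_mult_less_eq mult.commute)
        from mb[OF this] have "real (q * j) * b \<le> 1 / (2 * real q)" .
        also have "\<dots> \<le> 1 / 2" using q(1) by (simp add: field_simps)
        finally have half: "real (q * j) * b \<le> 1 / 2" .
        define k where "k = round (real (q * j) * \<alpha>)"
        have eq: "real (q * j) * \<alpha> - of_int k = real (q * j) * (\<alpha> - of_int a / real q) + of_int (int j * a - k)"
          using q(1) by (simp add: field_simps)
        have ab: "\<bar>real (q * j) * (\<alpha> - of_int a / real q)\<bar> = real (q * j) * b"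
          by (simp add: b_def abs_mult)
        \<comment> \<open>Either j a is the nearest integer, and equality holds, or the distance is
          at least 1 - q j b, which is no less because q j b <= 1/2.\<close>
        have "nint_dist (real (q * j) * \<alpha>) \<ge> real (q * j) * b"
        proof (cases "int j * a - k = 0")
          case True
          then show ?thesis unfolding nint_dist_def k_def[symmetric] eq using ab by simp
        next
          case False
          then have "\<bar>real_of_int (int j * a - k)\<bar> \<ge> 1" by linarith
          then have "\<bar>real (q * j) * (\<alpha> - of_int a / real q) + of_int (int j * a - k)\<bar> \<ge> 1 - real (q * j) * b"
            using ab abs_triangle_ineq2[of "real_of_int (int j * a - k)" "- (real (q * j) * (\<alpha> - of_int a / real q))"]
            by (simp only: abs_minus_cancel diff_minus_eq_add add.commute)
          then show ?thesis unfolding nint_dist_def k_def[symmetric] eq using half by linarith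
        qed
        then have "g (q * j) \<le> 1 / (real (q * j) * b)"
          unfolding g_def using q(1) j bp by (intro geometric_bound_le_inverse) auto
        then show "g (q * j) \<le> 1 / (real q * b) * inverse (real j)"
          by (simp add: field_simps)
      qed
      also have "\<dots> = 1 / (real q * b) * harm J"
        by (simp add: harm_def sum_distrib_left)
      also have "\<dots> \<le> 1 / (real q * b) * D"
      proof -
        have "J \<le> N" unfolding J_def by simp
        then have "harm J \<le> D" by (intro harm_le_D) (simp add: N_def)
        then show ?thesis using bp q(1) by (intro mult_left_mono) auto
      qed
      also have "\<dots> \<le> 24 * real X ^ 3 / lam * D"
      proof (intro mult_right_mono)
        have "1 / (real q * b) = 2 * real X ^ 3 / (2 * (real q * real X ^ 3 * b))"
          using x1 bp q(1) by (simp add: field_simps)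
        also have "\<dots> \<le> 2 * real X ^ 3 / lam"
          using lamle lam0 by (intro divide_left_mono) auto
        also have "\<dots> \<le> 24 * real X ^ 3 / lam"
          using lam0 by (intro divide_right_mono) auto
        finally show "1 / (real q * b) \<le> 24 * real X ^ 3 / lam" .
      qed (use D_ge_1 in auto)
      finally show ?thesis unfolding e .
    qed
  qed
  have "(\<Sum>m\<in>{1..N}. g m) = (\<Sum>m\<in>{m \<in> {1..N}. \<not> q dvd m}. g m) + (\<Sum>m\<in>{m \<in> {1..N}. q dvd m}. g m)"
    by (subst sum.union_disjoint[symmetric]) (auto intro!: sum.cong)
  also have "\<dots> \<le> 72 * (real X)\<^sup>2 * D + 24 * real X ^ 3 / lam * D"
    by (intro add_mono nondiv div)
  finally show ?thesis
    unfolding N_def g_def lam_def b_def by (simp add: algebra_simps)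
qed

text \<open>The slopes m = 6 h k are collected; h divides m and determines k, so each m arises at
  most \<open>D\<close> times.\<close>

lemma sum_step_sum_square_le:
  "(\<Sum>h\<in>{1..<X}. (cmod (step_sum X h \<alpha>))\<^sup>2) \<le>
    (real X)\<^sup>2 + 2 * D * (\<Sum>m\<in>{1..6 * X\<^sup>2}. geometric_bound X (real m * \<alpha>))"
proof -
  define g where "g m = geometric_bound X (real m * \<alpha>)" for m :: nat
  have g0: "g m \<ge> 0" for m by (simp add: g_def geometric_bound_nonneg)
  define S where "S = {1..<X} \<times> {1..<X}"
  have "(\<Sum>h\<in>{1..<X}. (cmod (step_sum X h \<alpha>))\<^sup>2) \<le> (\<Sum>h\<in>{1..<X}. real X + 2 * (\<Sum>k\<in>{1..<X}. g (6 * h * k)))"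
    unfolding g_def by (intro sum_mono norm_step_sum_square_le)
  also have "\<dots> = real (X - 1) * real X + 2 * (\<Sum>p\<in>S. g (6 * fst p * snd p))"
    unfolding S_def by (simp add: sum.distrib sum_distrib_left sum.cartesian_product' case_prod_beta)
  also have "\<dots> \<le> (real X)\<^sup>2 + 2 * (D * (\<Sum>m\<in>{1..6 * X\<^sup>2}. g m))"
  proof (intro add_mono mult_left_mono)
    show "real (X - 1) * real X \<le> (real X)\<^sup>2"
      unfolding power2_eq_square by (intro mult_right_mono) auto
    have im: "(\<lambda>p. 6 * fst p * snd p) ` S \<subseteq> {1..6 * X\<^sup>2}"
    proof
      fix m assume "m \<in> (\<lambda>p. 6 * fst p * snd p) ` S"
      then obtain h k where hk: "m = 6 * h * k" "1 \<le> h" "h < X" "1 \<le> k" "k < X"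
        by (auto simp: S_def)
      then have "h * k \<le> X * X" by (intro mult_mono) auto
      moreover have "h * k \<ge> 1" using hk by simp
      ultimately show "m \<in> {1..6 * X\<^sup>2}" using hk(1) by (simp add: power2_eq_square)
    qed
    have "(\<Sum>p\<in>S. g (6 * fst p * snd p)) = (\<Sum>m\<in>{1..6 * X\<^sup>2}. \<Sum>p\<in>{p \<in> S. 6 * fst p * snd p = m}. g (6 * fst p * snd p))"
      using im by (intro sum.group[symmetric]) (auto simp: S_def)
    also have "\<dots> \<le> (\<Sum>m\<in>{1..6 * X\<^sup>2}. D * g m)"
    proof (intro sum_mono)
      fix m assume m: "m \<in> {1..6 * X\<^sup>2}"
      have "inj_on fst {p \<in> S. 6 * fst p * snd p = m}"
        using m by (intro inj_onI) (auto simp: prod_eq_iff)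
      moreover have "fst ` {p \<in> S. 6 * fst p * snd p = m} \<subseteq> {d. int d dvd int m}"
        by auto
      moreover have "finite {d. int d dvd int m}" using m by simp
      ultimately have "card {p \<in> S. 6 * fst p * snd p = m} \<le> card {d. int d dvd int m}"
        by (meson card_inj_on_le)
      also have "real (card {d. int d dvd int m}) \<le> D"
      proof (rule divisors_le)
        have "X\<^sup>2 \<le> X ^ 3" using X_pos by (intro power_increasing) auto
        then have "m \<le> 9 * X ^ 3" using m by simp
        then show "\<bar>int m\<bar> \<le> 9 * int X ^ 3"
          by (metis abs_of_nat of_nat_mono of_nat_mult of_nat_numeral of_nat_power)
      qed (use m in auto)
      finally have "real (card {p \<in> S. 6 * fst p * snd p = m}) * g m \<le> D * g m"
        by (intro mult_right_mono g0) auto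
      then show "(\<Sum>p\<in>{p \<in> S. 6 * fst p * snd p = m}. g (6 * fst p * snd p)) \<le> D * g m"
        by simp
    qed
    finally show "(\<Sum>p\<in>S. g (6 * fst p * snd p)) \<le> D * (\<Sum>m\<in>{1..6 * X\<^sup>2}. g m)"
      by (simp add: sum_distrib_left)
  qed auto
  finally show ?thesis unfolding g_def by simp
qed

text \<open>Weyl's inequality at a Dirichlet approximation a/q, with decay in the distance |\<alpha>
  - a/q| as well as in q.\<close>

theorem cube_sum_weyl_bound:
  obtains a :: int and q :: nat where "q > 0"
    "\<bar>\<alpha> - of_int a / real q\<bar> \<le> 1 / (12 * (real X)\<^sup>2 * real q)"
    "cmod (cube_sum X \<alpha>) ^ 4 \<le> 1600 * D\<^sup>2 *
      (real X ^ 3 + real X ^ 4 / (real q * (1 + real X ^ 3 * \<bar>\<alpha> - of_int a / real q\<bar>)))"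
proof -
  define x where "x = real X"
  have x1: "x \<ge> 1" using X_pos by (simp add: x_def)
  have "12 * X\<^sup>2 > 0" using X_pos by simp
  then obtain a k where ak: "coprime a k" "0 < k" "k \<le> int (12 * X\<^sup>2)"
    "\<bar>of_int k * \<alpha> - of_int a\<bar> < 1 / real (12 * X\<^sup>2)"
    by (rule Dirichlet_approx_coprime[of _ \<alpha>])
  define q where "q = nat k"
  have k: "k = int q" using ak(2) by (simp add: q_def)
  have q: "q > 0" "q \<le> 12 * X\<^sup>2" "coprime a (int q)"
    using ak(1-3) unfolding k by (simp_all only: of_nat_le_iff of_nat_0_less_iff)
  have \<beta>: "\<bar>\<alpha> - of_int a / real q\<bar> \<le> 1 / (12 * (real X)\<^sup>2 * real q)"
  proof -
    have "\<bar>\<alpha> - of_int a / real q\<bar> = \<bar>of_int k * \<alpha> - of_int a\<bar> / real q"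
      using q(1) unfolding k by (simp add: abs_divide[symmetric] field_simps)
    also have "\<dots> \<le> 1 / real (12 * X\<^sup>2) / real q"
      using ak(4) by (intro divide_right_mono) auto
    finally show ?thesis by simp
  qed
  define lam where "lam = real q * (1 + x ^ 3 * \<bar>\<alpha> - of_int a / real q\<bar>)"
  have lam0: "lam > 0" using q x1 by (auto simp: lam_def intro!: mult_pos_pos add_pos_nonneg)
  define A where "A = D\<^sup>2 * x ^ 3"
  define B where "B = D\<^sup>2 * (x ^ 4 / lam)"
  have "cmod (cube_sum X \<alpha>) ^ 4 \<le> 2 * x\<^sup>2 + 8 * x * (\<Sum>h\<in>{1..<X}. (cmod (step_sum X h \<alpha>))\<^sup>2)"
    unfolding x_def by (rule norm_cube_sum_pow4_le)
  also have "\<dots> \<le> 2 * x\<^sup>2 + 8 * x * (x\<^sup>2 + 2 * D * (D * (72 * x\<^sup>2 + 24 * x ^ 3 / lam)))"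
  proof (intro add_mono mult_left_mono order_refl)
    have "(\<Sum>h\<in>{1..<X}. (cmod (step_sum X h \<alpha>))\<^sup>2) \<le>
        x\<^sup>2 + 2 * D * (\<Sum>m\<in>{1..6 * X\<^sup>2}. geometric_bound X (real m * \<alpha>))"
      unfolding x_def by (rule sum_step_sum_square_le)
    also have "\<dots> \<le> x\<^sup>2 + 2 * D * (D * (72 * x\<^sup>2 + 24 * x ^ 3 / lam))"
      using sum_geometric_bound_le[OF q \<beta>] D_ge_1 unfolding x_def lam_def
      by (intro add_mono mult_left_mono) auto
    finally show "(\<Sum>h\<in>{1..<X}. (cmod (step_sum X h \<alpha>))\<^sup>2) \<le> x\<^sup>2 + 2 * D * (D * (72 * x\<^sup>2 + 24 * x ^ 3 / lam))" .
  qed (use x1 in auto)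
  \<comment> \<open>1600 is a round bound for 2 + 8 + 1152 and for 384.\<close>
  also have "\<dots> = 2 * x\<^sup>2 + 8 * x ^ 3 + 1152 * A + 384 * B"
    by (simp add: A_def B_def power2_eq_square power3_eq_cube power4_eq_xxxx algebra_simps)
  also have "\<dots> \<le> 1600 * A + 1600 * B"
  proof -
    have d2: "D\<^sup>2 \<ge> 1" using D_ge_1 by simp
    have "1 * x ^ 2 \<le> A" "1 * x ^ 3 \<le> A"
      unfolding A_def using d2 x1 by (intro mult_mono power_increasing; simp)+
    moreover have "A \<ge> 0" unfolding A_def using x1 by simp
    moreover have "B \<ge> 0" unfolding B_def using lam0 x1 by (intro mult_nonneg_nonneg divide_nonneg_pos) auto
    ultimately show ?thesis by linarith
  qed
  also have "\<dots> = 1600 * D\<^sup>2 * (x ^ 3 + x ^ 4 / lam)"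
    by (simp add: A_def B_def distrib_left)
  finally show ?thesis
    using that[OF q(1) \<beta>] unfolding lam_def x_def by blast
qed

end

section \<open>Mean square near rationals\<close>

lemma sum_ee_residues:
  fixes m :: int and q :: nat
  assumes "q > 0"
  shows "(\<Sum>a\<in>{..<q}. ee (real a / real q * of_int m)) = of_nat q * of_bool (int q dvd m)"
proof (cases "int q dvd m")
  case True
  then obtain t where t: "m = int q * t" by blast
  have "ee (real a / real q * of_int m) = 1" for a
  proof -
    have "real a / real q * of_int m = of_int (int a * t)" using assms by (simp add: t)
    then show ?thesis by (simp only: ee_of_int)
  qed
  then show ?thesis using True by simp
next
  case False
  define w where "w = ee (of_int m / real q)"
  have pw: "w ^ n = ee (real n * (of_int m / real q))" for n
    by (induction n) (simp_all add: w_def ee_add[symmetric] algebra_simps add_divide_distrib)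
  have "of_int m / real q \<noteq> real_of_int (round (of_int m / real q))"
  proof
    assume "of_int m / real q = real_of_int (round (of_int m / real q))"
    then have "real_of_int m = real_of_int (int q * round (of_int m / real q))"
      using assms by (simp add: field_simps)
    then have "m = int q * round (of_int m / real q)" by (simp only: of_int_eq_iff)
    then show False using False by (metis dvd_triv_left)
  qed
  then have "nint_dist (of_int m / real q) > 0" by (simp add: nint_dist_def)
  then have w1: "w \<noteq> 1"
    using norm_ee_minus_1_ge[of "of_int m / real q"] by (auto simp: w_def)
  have "(\<Sum>a\<in>{..<q}. ee (real a / real q * of_int m)) = (\<Sum>a\<in>{..<q}. w ^ a)"
    unfolding pw by simp
  also have "\<dots> = (w ^ q - 1) / (w - 1)"
    using w1 by (simp add: geometric_sum)
  also have "w ^ q = 1"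
    unfolding pw using assms ee_of_int[of m] by simp
  finally show ?thesis using False by simp
qed

definition cube_congruences :: "nat \<Rightarrow> nat \<Rightarrow> real" where
  "cube_congruences X q = (\<Sum>x\<in>{1..X}. \<Sum>y\<in>{1..X}. of_bool (int q dvd int x ^ 3 - int y ^ 3))"

text \<open>Summing over all residues a detects x^3 = y^3 modulo q. The bound is uniform in \<beta>,
  so it can be integrated against any kernel in \<beta>.\<close>

lemma sum_cube_sum_translates_le:
  assumes "q > 0"
  shows "(\<Sum>a\<in>{..<q}. (cmod (cube_sum X (real a / real q + \<beta>)))\<^sup>2) \<le> real q * cube_congruences X q"
proof -
  have e: "complex_of_real ((cmod (cube_sum X \<alpha>))\<^sup>2) =
      (\<Sum>x\<in>{1..X}. \<Sum>y\<in>{1..X}. ee (of_int (int x ^ 3 - int y ^ 3) * \<alpha>))" for \<alpha>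
    unfolding complex_norm_square cube_sum_def trig_sum_def
    by (simp add: cnj_ee sum_product flip: ee_add) (simp add: algebra_simps)
  have "complex_of_real (\<Sum>a\<in>{..<q}. (cmod (cube_sum X (real a / real q + \<beta>)))\<^sup>2) =
      (\<Sum>a\<in>{..<q}. \<Sum>x\<in>{1..X}. \<Sum>y\<in>{1..X}. ee (of_int (int x ^ 3 - int y ^ 3) * \<beta>) *
         ee (real a / real q * of_int (int x ^ 3 - int y ^ 3)))"
    unfolding of_real_sum e by (simp add: algebra_simps flip: ee_add)
  also have "\<dots> = (\<Sum>x\<in>{1..X}. \<Sum>y\<in>{1..X}. \<Sum>a\<in>{..<q}. ee (of_int (int x ^ 3 - int y ^ 3) * \<beta>) *
         ee (real a / real q * of_int (int x ^ 3 - int y ^ 3)))"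
    by (subst sum.swap) (intro sum.cong refl sum.swap)
  also have "\<dots> = (\<Sum>x\<in>{1..X}. \<Sum>y\<in>{1..X}. ee (of_int (int x ^ 3 - int y ^ 3) * \<beta>) *
         (of_nat q * of_bool (int q dvd int x ^ 3 - int y ^ 3)))"
    unfolding sum_distrib_left[symmetric] sum_ee_residues[OF assms] ..
  finally have eq: "complex_of_real (\<Sum>a\<in>{..<q}. (cmod (cube_sum X (real a / real q + \<beta>)))\<^sup>2) =
    (\<Sum>x\<in>{1..X}. \<Sum>y\<in>{1..X}. ee (of_int (int x ^ 3 - int y ^ 3) * \<beta>) *
         (of_nat q * of_bool (int q dvd int x ^ 3 - int y ^ 3)))" .
  have "(\<Sum>a\<in>{..<q}. (cmod (cube_sum X (real a / real q + \<beta>)))\<^sup>2) \<le>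
      cmod (complex_of_real (\<Sum>a\<in>{..<q}. (cmod (cube_sum X (real a / real q + \<beta>)))\<^sup>2))"
    by (simp only: norm_of_real abs_ge_self)
  also have "\<dots> \<le> (\<Sum>x\<in>{1..X}. \<Sum>y\<in>{1..X}. cmod (ee (of_int (int x ^ 3 - int y ^ 3) * \<beta>) *
         (of_nat q * of_bool (int q dvd int x ^ 3 - int y ^ 3))))"
    unfolding eq by (intro order.trans[OF norm_sum] sum_mono norm_sum)
  also have "\<dots> = real q * cube_congruences X q"
    unfolding cube_congruences_def sum_distrib_left by (intro sum.cong refl) (auto simp: norm_mult)
  finally show ?thesis .
qed

lemma cube_sum_1_plus: "cube_sum X (1 + \<beta>) = cube_sum X \<beta>"
proof -
  have "ee (of_int k * (1 + \<beta>)) = ee (of_int k * \<beta>)" for k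
    using ee_add[of "of_int k" "of_int k * \<beta>"] by (simp add: distrib_left)
  then show ?thesis unfolding cube_sum_def trig_sum_def by (simp only:)
qed

lemma set_integrable_inverse_abs:
  assumes "c \<ge> (0::real)"
  shows "set_integrable lborel {-1..1} (\<lambda>\<beta>. 1 / (1 + c * \<bar>\<beta>\<bar>))"
  using assms
  by (intro borel_integrable_atLeastAtMost' continuous_intros) (auto simp: add_nonneg_eq_0_iff)

lemma set_integral_inverse_abs_le:
  assumes "c > (0::real)"
  shows "(LINT \<beta>:{-1..1}|lborel. 1 / (1 + c * \<bar>\<beta>\<bar>)) \<le> 2 * ln (1 + c) / c"
proof -
  have cont: "continuous_on A (\<lambda>\<beta>. 1 / (1 + c * \<bar>\<beta>\<bar>))" for A
    using assms by (intro continuous_intros) (auto simp: add_nonneg_eq_0_iff)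
  have R: "set_integrable lborel {0..1} (\<lambda>\<beta>. 1 / (1 + c * \<bar>\<beta>\<bar>))"
    and L: "set_integrable lborel {-1..0} (\<lambda>\<beta>. 1 / (1 + c * \<bar>\<beta>\<bar>))"
    using assms by (auto intro!: set_integrable_subset[OF set_integrable_inverse_abs])
  have "(LINT \<beta>:{-1..1}|lborel. 1 / (1 + c * \<bar>\<beta>\<bar>)) \<le>
     (\<integral>\<beta>. indicator {-1..0} \<beta> *\<^sub>R (1 / (1 + c * \<bar>\<beta>\<bar>)) + indicator {0..1} \<beta> *\<^sub>R (1 / (1 + c * \<bar>\<beta>\<bar>)) \<partial>lborel)"
    unfolding set_lebesgue_integral_def
  proof (intro integral_mono)
    show "integrable lborel (\<lambda>\<beta>. indicator {-1..1} \<beta> *\<^sub>R (1 / (1 + c * \<bar>\<beta>\<bar>)))"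
      using set_integrable_inverse_abs[of c] assms unfolding set_integrable_def by simp
    show "integrable lborel (\<lambda>\<beta>. indicator {-1..0} \<beta> *\<^sub>R (1 / (1 + c * \<bar>\<beta>\<bar>)) + indicator {0..1} \<beta> *\<^sub>R (1 / (1 + c * \<bar>\<beta>\<bar>)))"
      using L R unfolding set_integrable_def by (intro Bochner_Integration.integrable_add)
    fix \<beta> :: real
    have "1 / (1 + c * \<bar>\<beta>\<bar>) \<ge> 0" using assms by simp
    then show "indicator {-1..1} \<beta> *\<^sub>R (1 / (1 + c * \<bar>\<beta>\<bar>)) \<le>
        indicator {-1..0} \<beta> *\<^sub>R (1 / (1 + c * \<bar>\<beta>\<bar>)) + indicator {0..1} \<beta> *\<^sub>R (1 / (1 + c * \<bar>\<beta>\<bar>))"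
      by (auto simp: indicator_def)
  qed
  also have "\<dots> = (\<integral>\<beta>. indicator {-1..0} \<beta> *\<^sub>R (1 / (1 + c * \<bar>\<beta>\<bar>)) \<partial>lborel) +
      (\<integral>\<beta>. indicator {0..1} \<beta> *\<^sub>R (1 / (1 + c * \<bar>\<beta>\<bar>)) \<partial>lborel)"
    using L R unfolding set_integrable_def by (intro Bochner_Integration.integral_add)
  also have "(\<integral>\<beta>. indicator {-1..0} \<beta> *\<^sub>R (1 / (1 + c * \<bar>\<beta>\<bar>)) \<partial>lborel) =
      (- ln (1 - c * 0) / c) - (- ln (1 - c * (-1)) / c)"
  proof (rule integral_FTC_atLeastAtMost)
    fix x :: real assume x: "-1 \<le> x" "x \<le> 0"
    then have p: "1 - c * x > 0" using assms mult_nonneg_nonpos[of c x] by linarith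
    then show "((\<lambda>x. - ln (1 - c * x) / c) has_vector_derivative 1 / (1 + c * \<bar>x\<bar>)) (at x within {-1..0})"
      using x assms unfolding has_real_derivative_iff_has_vector_derivative[symmetric]
      by (auto intro!: derivative_eq_intros simp: field_simps)
  qed (auto intro: cont)
  also have "(\<integral>\<beta>. indicator {0..1} \<beta> *\<^sub>R (1 / (1 + c * \<bar>\<beta>\<bar>)) \<partial>lborel) =
      (ln (1 + c * 1) / c) - (ln (1 + c * 0) / c)"
  proof (rule integral_FTC_atLeastAtMost)
    fix x :: real assume x: "0 \<le> x" "x \<le> 1"
    then have p: "1 + c * x > 0" using assms mult_nonneg_nonneg[of c x] by linarith
    then have "((\<lambda>x. ln (1 + c * x) / c) has_real_derivative c / (1 + c * x) / c) (at x within {0..1})"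
      by (auto intro!: derivative_eq_intros)
    then show "((\<lambda>x. ln (1 + c * x) / c) has_vector_derivative 1 / (1 + c * \<bar>x\<bar>)) (at x within {0..1})"
      using x assms unfolding has_real_derivative_iff_has_vector_derivative[symmetric] by simp
  qed (auto intro: cont)
  finally show ?thesis by simp
qed

text \<open>A continuous majorant, on the arcs with denominator at most X, for the reciprocal of the
  quantity q (1 + X^3 |\<alpha> - a/q|) that controls Weyl's inequality.\<close>

definition arc_weight :: "nat \<Rightarrow> real \<Rightarrow> real" where
  "arc_weight X \<alpha> = (\<Sum>q\<in>{1..X}. \<Sum>a\<in>{..q}. 1 / (real q * (1 + real X ^ 3 * \<bar>\<alpha> - real a / real q\<bar>)))"

lemma arc_weight_nonneg: "arc_weight X \<alpha> \<ge> 0"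
  unfolding arc_weight_def by (intro sum_nonneg) auto

lemma continuous_on_arc_weight [continuous_intros]: "continuous_on A (arc_weight X)"
  unfolding arc_weight_def
  by (intro continuous_intros) (auto simp: add_nonneg_eq_0_iff)

text \<open>Each arc is translated to be centred at 0; then the sum over a is carried out pointwise
  in \<beta> by the bound for translates, and only the kernel 1 / (1 + X^3 |\<beta>|) is left to
  integrate.\<close>

lemma integral_cube_sum_arcs_le:
  assumes "q > 0" "X > 0"
  shows "(\<integral>\<alpha>. (\<Sum>a\<in>{..q}. (cmod (cube_sum X \<alpha>))\<^sup>2 / (1 + real X ^ 3 * \<bar>\<alpha> - real a / real q\<bar>)) \<partial>unit_circle)
    \<le> 4 * ln (1 + real X ^ 3) / real X ^ 3 * (real q * cube_congruences X q)"
proof -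
  define c where "c = real X ^ 3"
  define k where "k \<beta> = 1 / (1 + c * \<bar>\<beta>\<bar>)" for \<beta> :: real
  define F where "F \<alpha> = (cmod (cube_sum X \<alpha>))\<^sup>2" for \<alpha>
  have c0: "c > 0" using assms(2) by (simp add: c_def)
  have k0: "k \<beta> \<ge> 0" for \<beta> using c0 by (simp add: k_def)
  have F0: "F \<alpha> \<ge> 0" for \<alpha> by (simp add: F_def)
  have cF: "continuous_on A (\<lambda>\<beta>. F (g \<beta>))" if "continuous_on A g" for A g
    unfolding F_def by (intro continuous_intros continuous_on_compose2[OF continuous_on_cube_sum[of UNIV] that]) auto
  have ck: "continuous_on A k" for A
    unfolding k_def using c0 by (intro continuous_intros) (auto simp: add_nonneg_eq_0_iff)
  have ck': "continuous_on A (\<lambda>\<beta>. k (g \<beta>))" if "continuous_on A g" for A g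
    by (rule continuous_on_compose2[OF ck[of UNIV] that]) auto
  have int: "integrable lborel (\<lambda>\<beta>. indicator {-1..1} \<beta> *\<^sub>R (F (t + \<beta>) * k \<beta>))" for t
    using borel_integrable_atLeastAtMost'[of "-1" 1 "\<lambda>\<beta>. F (t + \<beta>) * k \<beta>"]
    unfolding set_integrable_def by (simp add: cF ck continuous_intros)
  \<comment> \<open>For a centre in [0, 1] the shifted interval lies in [-1, 1], a range that is the
    same for all centres; the integrand is non-negative.\<close>
  have one: "(\<integral>\<alpha>. F \<alpha> * k (\<alpha> - t) \<partial>unit_circle) \<le> (\<integral>\<beta>. indicator {-1..1} \<beta> *\<^sub>R (F (t + \<beta>) * k \<beta>) \<partial>lborel)"
    if t: "0 \<le> t" "t \<le> 1" for t
  proof -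
    have "(\<integral>\<alpha>. F \<alpha> * k (\<alpha> - t) \<partial>unit_circle) = (\<integral>\<alpha>. indicator {0..<1} \<alpha> *\<^sub>R (F \<alpha> * k (\<alpha> - t)) \<partial>lborel)"
      by (simp add: integral_restrict_space)
    also have "\<dots> = (\<integral>\<beta>. indicator {0..<1} (t + \<beta>) *\<^sub>R (F (t + \<beta>) * k \<beta>) \<partial>lborel)"
      by (subst lborel_integral_real_affine[of 1 _ t]) auto
    also have "\<dots> \<le> (\<integral>\<beta>. indicator {-1..1} \<beta> *\<^sub>R (F (t + \<beta>) * k \<beta>) \<partial>lborel)"
    proof (intro integral_mono int)
      have "set_integrable lborel {-t..<1-t} (\<lambda>\<beta>. F (t + \<beta>) * k \<beta>)"
        by (rule set_integrable_subset[OF int[of t, folded set_integrable_def]]) (use t in auto)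
      then show "integrable lborel (\<lambda>\<beta>. indicator {0..<1} (t + \<beta>) *\<^sub>R (F (t + \<beta>) * k \<beta>))"
        unfolding set_integrable_def by (rule Bochner_Integration.integrable_cong[THEN iffD1, rotated 2]) (auto simp: indicator_def)
      show "indicator {0..<1} (t + \<beta>) *\<^sub>R (F (t + \<beta>) * k \<beta>) \<le> indicator {-1..1} \<beta> *\<^sub>R (F (t + \<beta>) * k \<beta>)" for \<beta>
        using t F0 k0 by (auto simp: indicator_def)
    qed
    finally show ?thesis .
  qed
  \<comment> \<open>The fraction a = q repeats a = 0 by periodicity; hence the factor 2.\<close>
  have tr: "(\<Sum>a\<in>{..q}. F (real a / real q + \<beta>)) \<le> 2 * (real q * cube_congruences X q)" for \<beta>
  proof -
    have le: "(\<Sum>a\<in>{..<q}. F (real a / real q + \<beta>)) \<le> real q * cube_congruences X q"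
      unfolding F_def by (rule sum_cube_sum_translates_le[OF assms(1)])
    have "F (real q / real q + \<beta>) = F (real 0 / real q + \<beta>)"
      using assms(1) by (simp add: F_def cube_sum_1_plus)
    also have "\<dots> = (\<Sum>a\<in>{0}. F (real a / real q + \<beta>))" by simp
    also have "\<dots> \<le> (\<Sum>a\<in>{..<q}. F (real a / real q + \<beta>))"
      using assms(1) F0 by (intro sum_mono2) auto
    finally show ?thesis using le by (simp add: lessThan_Suc_atMost[symmetric])
  qed
  have "(\<integral>\<alpha>. (\<Sum>a\<in>{..q}. F \<alpha> * k (\<alpha> - real a / real q)) \<partial>unit_circle) =
      (\<Sum>a\<in>{..q}. (\<integral>\<alpha>. F \<alpha> * k (\<alpha> - real a / real q) \<partial>unit_circle))"
    by (intro Bochner_Integration.integral_sum integrable_unit_circle continuous_on_mult cF ck' continuous_intros)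
  also have "\<dots> \<le> (\<Sum>a\<in>{..q}. (\<integral>\<beta>. indicator {-1..1} \<beta> *\<^sub>R (F (real a / real q + \<beta>) * k \<beta>) \<partial>lborel))"
    using assms(1) by (intro sum_mono one) (auto simp: field_simps)
  also have "\<dots> = (\<integral>\<beta>. (\<Sum>a\<in>{..q}. indicator {-1..1} \<beta> *\<^sub>R (F (real a / real q + \<beta>) * k \<beta>)) \<partial>lborel)"
    by (intro Bochner_Integration.integral_sum[symmetric] int)
  also have "\<dots> \<le> (\<integral>\<beta>. 2 * (real q * cube_congruences X q) * (indicator {-1..1} \<beta> *\<^sub>R k \<beta>) \<partial>lborel)"
  proof (intro integral_mono Bochner_Integration.integrable_sum int integrable_mult_right)
    show "integrable lborel (\<lambda>\<beta>. indicator {-1..1} \<beta> *\<^sub>R k \<beta>)"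
      using set_integrable_inverse_abs[of c] c0 unfolding k_def set_integrable_def by simp
    fix \<beta>
    have "(\<Sum>a\<in>{..q}. indicator {-1..1} \<beta> *\<^sub>R (F (real a / real q + \<beta>) * k \<beta>)) =
       (\<Sum>a\<in>{..q}. F (real a / real q + \<beta>)) * (indicator {-1..1} \<beta> *\<^sub>R k \<beta>)"
      unfolding sum_distrib_right by (intro sum.cong refl) (simp add: mult_ac)
    also have "\<dots> \<le> 2 * (real q * cube_congruences X q) * (indicator {-1..1} \<beta> *\<^sub>R k \<beta>)"
      using tr k0 by (intro mult_right_mono) auto
    finally show "(\<Sum>a\<in>{..q}. indicator {-1..1} \<beta> *\<^sub>R (F (real a / real q + \<beta>) * k \<beta>)) \<le>
        2 * (real q * cube_congruences X q) * (indicator {-1..1} \<beta> *\<^sub>R k \<beta>)" .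
  qed
  also have "\<dots> = 2 * (real q * cube_congruences X q) * (\<integral>\<beta>. indicator {-1..1} \<beta> *\<^sub>R k \<beta> \<partial>lborel)"
    by simp
  also have "\<dots> \<le> 2 * (real q * cube_congruences X q) * (2 * ln (1 + c) / c)"
    using set_integral_inverse_abs_le[OF c0] unfolding k_def set_lebesgue_integral_def
    by (intro mult_left_mono) (auto simp: cube_congruences_def intro!: sum_nonneg mult_nonneg_nonneg)
  finally show ?thesis
    unfolding F_def k_def c_def by (simp add: mult_ac)
qed

section \<open>Averaging over denominators up to X\<close>

context weyl_bounded
begin

text \<open>The diagonal gives X for each q, and a non-zero difference x^3 - y^3 has at most
  \<open>D\<close> divisors q. On average there is little beyond the diagonal.\<close>

lemma sum_cube_congruences_le: "(\<Sum>q\<in>{1..X}. cube_congruences X q) \<le> 2 * D * (real X)\<^sup>2"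
proof -
  have inj: "int x ^ 3 = int y ^ 3 \<longleftrightarrow> x = y" for x y :: nat
    by (simp add: power_eq_iff_eq_base)
  have "cube_congruences X q \<le> real X + congruent_pairs q (\<lambda>x. int x ^ 3) {1..X}" for q
  proof -
    have "cube_congruences X q \<le> (\<Sum>x\<in>{1..X}. \<Sum>y\<in>{1..X}. of_bool (y = x) +
        of_bool (int x ^ 3 \<noteq> int y ^ 3 \<and> int q dvd int x ^ 3 - int y ^ 3))"
      unfolding cube_congruences_def by (intro sum_mono) (auto simp: inj)
    also have "\<dots> = real X + congruent_pairs q (\<lambda>x. int x ^ 3) {1..X}"
      unfolding congruent_pairs_def by (simp add: sum.distrib del: sum_of_bool_eq) simp
    finally show ?thesis .
  qed
  then have "(\<Sum>q\<in>{1..X}. cube_congruences X q) \<le> (\<Sum>q\<in>{1..X}. real X + congruent_pairs q (\<lambda>x. int x ^ 3) {1..X})"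
    by (intro sum_mono)
  also have "\<dots> \<le> (real X)\<^sup>2 + D * (real X)\<^sup>2"
    using sum_congruent_pairs_le[where I = "{1..X}" and u = "\<lambda>x. int x ^ 3" and H = "{1..X}"] abs_cube_diff_le
    by (simp add: sum.distrib power2_eq_square)
  also have "\<dots> \<le> 2 * D * (real X)\<^sup>2"
    using D_ge_1 by (simp add: mult_le_cancel_right1 algebra_simps)
  finally show ?thesis .
qed

text \<open>The factor q from the sum over translates cancels the 1/q in the weight, so the average
  of \<open>cube_congruences\<close> applies: X^2 over X^3, with a logarithm below 3 D.\<close>

lemma integral_cube_sum_arc_weight_le:
  "(\<integral>\<alpha>. (cmod (cube_sum X \<alpha>))\<^sup>2 * arc_weight X \<alpha> \<partial>unit_circle) \<le> 24 * D\<^sup>2 / real X"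
proof -
  define G where "G q \<alpha> = (\<Sum>a\<in>{..q}. (cmod (cube_sum X \<alpha>))\<^sup>2 / (1 + real X ^ 3 * \<bar>\<alpha> - real a / real q\<bar>))" for q \<alpha>
  have cG: "continuous_on UNIV (G q)" for q
    unfolding G_def by (intro continuous_intros) (auto simp: add_nonneg_eq_0_iff)
  have ln0: "ln (1 + real X ^ 3) \<ge> 0" by simp
  have ln: "ln (1 + real X ^ 3) \<le> 3 * D"
  proof -
    have "1 + real X ^ 3 \<le> (real X + 1) ^ 3"
      by (simp add: power3_eq_cube algebra_simps)
    then have "ln (1 + real X ^ 3) \<le> ln ((real X + 1) ^ 3)"
      by (subst ln_le_cancel_iff) (auto intro: add_pos_nonneg)
    also have "\<dots> = 3 * ln (real X + 1)" by (simp add: ln_realpow)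
    also have "ln (real X + 1) \<le> harm X" by (rule ln_le_harm)
    also have "harm X \<le> D"
      using X_pos by (intro harm_le_D) (simp add: power2_eq_square)
    finally show ?thesis by simp
  qed
  have "(\<integral>\<alpha>. (cmod (cube_sum X \<alpha>))\<^sup>2 * arc_weight X \<alpha> \<partial>unit_circle) =
      (\<integral>\<alpha>. (\<Sum>q\<in>{1..X}. 1 / real q * G q \<alpha>) \<partial>unit_circle)"
    unfolding arc_weight_def G_def sum_distrib_left by (simp add: mult_ac)
  also have "\<dots> = (\<Sum>q\<in>{1..X}. 1 / real q * (\<integral>\<alpha>. G q \<alpha> \<partial>unit_circle))"
    by (subst Bochner_Integration.integral_sum) (auto intro!: integrable_unit_circle continuous_intros cG)
  also have "\<dots> \<le> (\<Sum>q\<in>{1..X}. 4 * ln (1 + real X ^ 3) / real X ^ 3 * cube_congruences X q)"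
  proof (intro sum_mono)
    fix q assume q: "q \<in> {1..X}"
    have "1 / real q * (\<integral>\<alpha>. G q \<alpha> \<partial>unit_circle) \<le>
        1 / real q * (4 * ln (1 + real X ^ 3) / real X ^ 3 * (real q * cube_congruences X q))"
      unfolding G_def using q X_pos by (intro mult_left_mono integral_cube_sum_arcs_le) auto
    then show "1 / real q * (\<integral>\<alpha>. G q \<alpha> \<partial>unit_circle) \<le> 4 * ln (1 + real X ^ 3) / real X ^ 3 * cube_congruences X q"
      using q by simp
  qed
  also have "\<dots> = 4 * ln (1 + real X ^ 3) / real X ^ 3 * (\<Sum>q\<in>{1..X}. cube_congruences X q)"
    by (simp add: sum_distrib_left)
  also have "\<dots> \<le> 4 * (3 * D) / real X ^ 3 * (2 * D * (real X)\<^sup>2)"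
    using ln ln0 D_ge_1 sum_cube_congruences_le
    by (intro mult_mono divide_right_mono) (auto simp: cube_congruences_def intro!: sum_nonneg)
  also have "\<dots> = 24 * D\<^sup>2 / real X"
    using X_pos by (simp add: power2_eq_square power3_eq_cube)
  finally show ?thesis .
qed

end

section \<open>Minor arcs\<close>

lemma abs_mult_diff_divide:
  fixes \<alpha> c :: real
  assumes "q > 0"
  shows "\<bar>q * \<alpha> - c\<bar> = q * \<bar>\<alpha> - c / q\<bar>"
proof -
  have "q * \<alpha> - c = q * (\<alpha> - c / q)" using assms by (simp add: field_simps)
  then show ?thesis using assms by (simp add: abs_mult)
qed

lemma minor_arcs_subset: "minor_arcs P \<subseteq> {0..<1}"
  by (auto simp: minor_arcs_def)

lemma minor_arcs_borel: "minor_arcs P \<in> sets borel"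
proof -
  have eq: "minor_arcs P = {0..<1} \<inter>
      (\<Inter>q\<in>{q::nat. q \<ge> 1 \<and> real q \<le> P powr (3/4)}. - (\<Union>a::int. {\<alpha>. \<bar>real q * \<alpha> - of_int a\<bar> \<le> P powr (-9/4)}))"
    unfolding minor_arcs_def by (auto simp: not_less) (meson linorder_not_le)
  have cl: "closed {\<alpha>. \<bar>real q * \<alpha> - of_int a\<bar> \<le> P powr (-9/4)}" for q :: nat and a :: int
    by (intro closed_Collect_le continuous_intros)
  then have m: "- (\<Union>a::int. {\<alpha>. \<bar>real q * \<alpha> - of_int a\<bar> \<le> P powr (-9/4)}) \<in> sets borel" for q :: nat
    by (intro borel_comp sets.countable_UN') auto
  show ?thesis
  proof (cases "{q::nat. q \<ge> 1 \<and> real q \<le> P powr (3/4)} = {}")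
    case True
    then show ?thesis unfolding eq by simp
  next
    case False
    then show ?thesis
      unfolding eq by (intro sets.Int sets.countable_INT' m) auto
  qed
qed

lemma minor_arcs_in_sets: "minor_arcs P \<in> sets unit_circle"
  using minor_arcs_borel minor_arcs_subset by (simp add: sets_restrict_space_iff)

lemma integrable_minor_arcs:
  fixes g :: "real \<Rightarrow> 'a :: {banach, second_countable_topology}"
  assumes "continuous_on UNIV g"
  shows "integrable unit_circle (\<lambda>\<alpha>. indicator (minor_arcs P) \<alpha> *\<^sub>R g \<alpha>)"
  by (intro integrable_mult_indicator minor_arcs_in_sets integrable_unit_circle assms)

locale minor_arc_bounds = weyl_bounded +
  fixes P :: real
  assumes X_le_P: "real X \<le> P" and P_less: "P < real X + 1"
begin

text \<open>With y as the unit of size every fractional power of X in the argument is an integral power.\<close>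

definition y :: real where "y = real X powr (1/4)"

lemma y_ge_1: "y \<ge> 1"
  using X_pos by (simp add: y_def ge_one_powr_ge_zero)

lemma X_eq: "real X = y ^ 4"
  using X_pos by (simp add: y_def powr_powr powr_numeral[symmetric])

lemma powr_X: "real X powr (real k / 4) = y ^ k"
  using X_pos by (simp add: y_def powr_powr powr_realpow[symmetric])

text \<open>Valid for every fraction a/q: either q exceeds P^(3/4), or |q \<alpha> - a| exceeds
  P^(-9/4), and X^3 P^(-9/4) is about X^(3/4) = y^3.\<close>

lemma arc_distance_ge:
  fixes a :: int and q :: nat
  assumes "\<alpha> \<in> minor_arcs P" "q > 0"
  shows "real q * (1 + real X ^ 3 * \<bar>\<alpha> - of_int a / real q\<bar>) \<ge> y ^ 3 / 8"
proof -
  define b where "b = \<bar>\<alpha> - of_int a / real q\<bar>"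
  have b0: "b \<ge> 0" by (simp add: b_def)
  have x1: "real X \<ge> 1" using X_pos by simp
  have qb: "\<bar>real q * \<alpha> - of_int a\<bar> = real q * b"
    using assms(2) by (simp add: b_def abs_mult_diff_divide)
  show ?thesis
  proof (cases "real q > P powr (3/4)")
    case True
    have "y ^ 3 = real X powr (3/4)" using powr_X[of 3] by simp
    also have "\<dots> \<le> P powr (3/4)" using X_le_P by (intro powr_mono2) auto
    finally have "y ^ 3 \<le> real q" using True by simp
    moreover have "real q * 1 \<le> real q * (1 + real X ^ 3 * b)"
      using b0 by (intro mult_left_mono) auto
    moreover have "y ^ 3 / 8 \<le> y ^ 3" using y_ge_1 by simp
    ultimately show ?thesis unfolding b_def by linarith
  next
    case False
    have "\<forall>q::nat. q \<ge> 1 \<longrightarrow> (\<exists>a::int. \<bar>real q * \<alpha> - of_int a\<bar> \<le> P powr (-9/4)) \<longrightarrow> real q > P powr (3/4)"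
      using assms(1) unfolding minor_arcs_def by blast
    then have "\<not> \<bar>real q * \<alpha> - of_int a\<bar> \<le> P powr (-9/4)"
      using False assms(2) by (metis One_nat_def Suc_leI)
    then have "P powr (-9/4) < \<bar>real q * \<alpha> - of_int a\<bar>" by (rule not_le_imp_less)
    moreover have "P powr (-9/4) \<ge> 1 / (8 * y ^ 9)"
    proof -
      \<comment> \<open>P < X + 1 <= 2 X, and 2^(9/4) <= 8 is the origin of the 8.\<close>
      have "P powr (9/4) \<le> (2 * real X) powr (9/4)"
        using X_le_P P_less x1 by (intro powr_mono2) auto
      also have "\<dots> = 2 powr (9/4) * y ^ 9"
      proof -
        have "real X powr (9/4) = y ^ 9" using powr_X[of 9] by simp
        then show ?thesis by (simp only: powr_mult)
      qed
      also have "\<dots> \<le> 2 powr 3 * y ^ 9"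
        using y_ge_1 by (intro mult_right_mono powr_mono) auto
      finally have "P powr (9/4) \<le> 8 * y ^ 9" by simp
      moreover have "P powr (9/4) > 0" using x1 X_le_P by simp
      ultimately have "1 / (8 * y ^ 9) \<le> 1 / P powr (9/4)"
        by (intro frac_le) auto
      also have "\<dots> = P powr (-9/4)" by (simp add: powr_minus_divide)
      finally show ?thesis .
    qed
    ultimately have "real q * b \<ge> 1 / (8 * y ^ 9)" unfolding qb by (rule less_imp_le[OF le_less_trans, rotated])
    then have "real X ^ 3 * (1 / (8 * y ^ 9)) \<le> real X ^ 3 * (real q * b)"
      by (intro mult_left_mono) auto
    moreover have "real X ^ 3 * (1 / (8 * y ^ 9)) = y ^ 3 / 8"
      unfolding X_eq using y_ge_1 by (simp add: power_mult[symmetric] divide_simps power_add[symmetric])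
    ultimately show ?thesis unfolding b_def[symmetric] by (simp add: algebra_simps)
  qed
qed

text \<open>For lam >= X, Weyl's inequality gives |f| << y^3, which is taken out once or twice. For
  lam < X, also q <= X, and a power of y^16 / lam is traded for a single factor 1 / lam, a summand
  of the weight.\<close>

lemma minor_arc_pointwise:
  assumes "\<alpha> \<in> minor_arcs P"
  defines "s \<equiv> cmod (cube_sum X \<alpha>)" and "A \<equiv> 1600 * D\<^sup>2"
  shows "s ^ 10 \<le> 32 * A\<^sup>2 * (y ^ 6 * s ^ 8 + y ^ 29 * (s\<^sup>2 * arc_weight X \<alpha>))"
    and "s ^ 5 \<le> 32 * A\<^sup>2 * (y ^ 3 * s ^ 4 + y ^ 13 * (s\<^sup>2 * arc_weight X \<alpha>))"
proof -
  define w where "w = arc_weight X \<alpha>"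
  have w0: "w \<ge> 0" by (simp add: w_def arc_weight_nonneg)
  have s0: "s \<ge> 0" by (simp add: s_def)
  have A1: "A \<ge> 1" using one_le_power[OF D_ge_1, of 2] unfolding A_def by linarith
  have y1: "y \<ge> 1" by (rule y_ge_1)
  obtain a :: int and q :: nat where q: "q > 0"
    and \<beta>: "\<bar>\<alpha> - of_int a / real q\<bar> \<le> 1 / (12 * (real X)\<^sup>2 * real q)"
    and weyl: "s ^ 4 \<le> A * (real X ^ 3 + real X ^ 4 / (real q * (1 + real X ^ 3 * \<bar>\<alpha> - of_int a / real q\<bar>)))"
    unfolding s_def A_def by (rule cube_sum_weyl_bound)
  define lam where "lam = real q * (1 + real X ^ 3 * \<bar>\<alpha> - of_int a / real q\<bar>)"
  have lam_ge: "lam \<ge> y ^ 3 / 8" unfolding lam_def by (rule arc_distance_ge[OF assms(1) q])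
  have y3: "y ^ 3 > 0" using y1 by simp
  then have lam0: "lam > 0" using lam_ge by linarith
  have qlam: "real q \<le> lam"
    unfolding lam_def using q by (simp add: mult_le_cancel_left1)
  have weyl': "s ^ 4 \<le> A * (y ^ 12 + y ^ 16 / lam)"
    using weyl[folded lam_def] unfolding X_eq by (simp add: power_mult[symmetric])
  consider "lam \<ge> real X" | "lam < real X" by linarith
  then have "s ^ 10 \<le> 32 * A\<^sup>2 * (y ^ 6 * s ^ 8 + y ^ 29 * (s\<^sup>2 * w)) \<and>
      s ^ 5 \<le> 32 * A\<^sup>2 * (y ^ 3 * s ^ 4 + y ^ 13 * (s\<^sup>2 * w))"
  proof cases
    case 1
    then have "y ^ 16 / lam \<le> y ^ 16 / y ^ 4"
      using y1 lam0 unfolding X_eq by (intro divide_left_mono) (auto intro!: mult_pos_pos)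
    also have "\<dots> = y ^ 12" using y1 by (simp add: power_diff[symmetric])
    finally have "A * (y ^ 12 + y ^ 16 / lam) \<le> A * (2 * y ^ 12)"
      using A1 by (intro mult_left_mono) auto
    with weyl' have "s ^ 4 \<le> A * (2 * y ^ 12)" by (rule order_trans)
    then have s4: "s ^ 4 \<le> 2 * A * y ^ 12" by simp
    \<comment> \<open>Enlarging the constant makes the bound an exact fourth power, so a fourth root
      can be taken without fractional exponents.\<close>
    also have "\<dots> \<le> (2 * A) ^ 4 * y ^ 12"
      using A1 self_le_power[of "2 * A" 4] by (intro mult_right_mono) auto
    also have "\<dots> = (2 * A * y ^ 3) ^ 4" by (simp add: power_mult_distrib power_mult[symmetric])
    finally have s1: "s \<le> 2 * A * y ^ 3"
      by (rule power_le_imp_le_base[where n = 3, unfolded numeral_eq_Suc, simplified]) (use A1 y1 in auto)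
    have "s\<^sup>2 \<le> (2 * A * y ^ 3)\<^sup>2" using s1 s0 by (intro power_mono)
    then have "s\<^sup>2 * s ^ 8 \<le> (2 * A * y ^ 3)\<^sup>2 * s ^ 8" by (intro mult_right_mono) auto
    then have "s ^ 10 \<le> 4 * A\<^sup>2 * (y ^ 6 * s ^ 8)"
      by (simp add: power_mult_distrib power_mult[symmetric] power_add[symmetric])
    also have "\<dots> \<le> 32 * A\<^sup>2 * (y ^ 6 * s ^ 8)" using y1 by (intro mult_right_mono) auto
    also have "\<dots> \<le> 32 * A\<^sup>2 * (y ^ 6 * s ^ 8 + y ^ 29 * (s\<^sup>2 * w))"
      using w0 y1 by (intro mult_left_mono) auto
    finally have g1: "s ^ 10 \<le> 32 * A\<^sup>2 * (y ^ 6 * s ^ 8 + y ^ 29 * (s\<^sup>2 * w))" .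
    have "s * s ^ 4 \<le> (2 * A * y ^ 3) * s ^ 4" using s1 by (intro mult_right_mono) auto
    then have "s ^ 5 \<le> 2 * A * (y ^ 3 * s ^ 4)" by (simp add: eval_nat_numeral mult_ac)
    also have "\<dots> \<le> 32 * A\<^sup>2 * (y ^ 3 * s ^ 4)"
      using y1 A1 by (intro mult_right_mono) (auto simp: power2_eq_square)
    also have "\<dots> \<le> 32 * A\<^sup>2 * (y ^ 3 * s ^ 4 + y ^ 13 * (s\<^sup>2 * w))"
      using w0 y1 by (intro mult_left_mono) auto
    finally show ?thesis using g1 by simp
  next
    case 2
    have lamy: "lam \<le> y ^ 4" using 2 X_eq by simp
    \<comment> \<open>From 0 <= q \<alpha> < q and |q \<alpha> - a| < 1 it follows that 0 <= a <= q,
      so a/q is among the fractions in \<open>arc_weight\<close>.\<close>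
    have \<alpha>: "0 \<le> \<alpha>" "\<alpha> < 1" using assms(1) minor_arcs_subset[of P] by auto
    have "\<bar>real q * \<alpha> - of_int a\<bar> < 1"
    proof -
      have "\<bar>real q * \<alpha> - of_int a\<bar> = real q * \<bar>\<alpha> - of_int a / real q\<bar>"
        using q by (simp add: abs_mult_diff_divide)
      also have "\<dots> \<le> real q * (1 / (12 * (real X)\<^sup>2 * real q))"
        using \<beta> by (intro mult_left_mono) auto
      also have "\<dots> = 1 / (12 * (real X)\<^sup>2)" using q by simp
      also have "\<dots> < 1"
      proof -
        have "(real X)\<^sup>2 \<ge> 1" using X_pos by (intro one_le_power) auto
        then have "12 * (real X)\<^sup>2 > 1" by linarith
        then show ?thesis by (subst divide_less_eq_1_pos) linarith+
      qed
      finally show ?thesis .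
    qed
    moreover have "real q * \<alpha> \<ge> 0" "real q * \<alpha> < real q" using \<alpha> q by auto
    ultimately have "real_of_int a > -1" "real_of_int a < real q + 1" by linarith+
    then have a0: "a \<ge> 0" "a \<le> int q" by linarith+
    then have an: "nat a \<in> {..q}" and ar: "real (nat a) = of_int a" by auto
    have qX: "q \<in> {1..X}" using q qlam 2 by auto
    have "1 / lam = 1 / (real q * (1 + real X ^ 3 * \<bar>\<alpha> - real (nat a) / real q\<bar>))"
      unfolding lam_def ar ..
    also have "\<dots> \<le> (\<Sum>a\<in>{..q}. 1 / (real q * (1 + real X ^ 3 * \<bar>\<alpha> - real a / real q\<bar>)))"
      using an by (intro member_le_sum) auto
    also have "\<dots> \<le> w"
      unfolding w_def arc_weight_def using qX by (intro member_le_sum) (auto intro: sum_nonneg)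
    finally have wl: "1 / lam \<le> w" .
    have "y ^ 12 \<le> y ^ 16 / lam"
    proof -
      have "y ^ 12 * lam \<le> y ^ 12 * y ^ 4" using lamy y1 by (intro mult_left_mono) auto
      then show ?thesis using lam0 by (simp add: pos_le_divide_eq power_add[symmetric])
    qed
    then have "A * (y ^ 12 + y ^ 16 / lam) \<le> A * (2 * (y ^ 16 / lam))"
      using A1 by (intro mult_left_mono) auto
    with weyl' have "s ^ 4 \<le> A * (2 * (y ^ 16 / lam))" by (rule order_trans)
    then have s4: "s ^ 4 \<le> 2 * A * y ^ 16 / lam" by (simp add: mult_ac)
    have "(s ^ 4)\<^sup>2 \<le> (2 * A * y ^ 16 / lam)\<^sup>2"
      using s4 by (intro power_mono) auto
    also have "\<dots> = 4 * A\<^sup>2 * y ^ 32 * (1 / lam) * (1 / lam)"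
      by (simp add: power2_eq_square power_add[symmetric] mult_ac)
    \<comment> \<open>One factor 1 / lam is estimated by the minor arc condition, the other becomes
      the weight; 32 - 3 = 29.\<close>
    also have "\<dots> \<le> 4 * A\<^sup>2 * y ^ 32 * (8 / y ^ 3) * w"
    proof (intro mult_mono)
      have "1 / lam \<le> 1 / (y ^ 3 / 8)"
        using lam_ge y3 by (intro frac_le) auto
      then show "1 / lam \<le> 8 / y ^ 3" by simp
    qed (use wl lam0 y1 in auto)
    also have "\<dots> = 32 * A\<^sup>2 * y ^ 29 * w"
    proof -
      have "y ^ 32 / y ^ 3 = y ^ 29" using y1 by (simp add: power_diff[symmetric])
      moreover have "4 * A\<^sup>2 * y ^ 32 * (8 / y ^ 3) * w = 32 * A\<^sup>2 * (y ^ 32 / y ^ 3) * w" by simp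
      ultimately show ?thesis by (simp only:)
    qed
    finally have "s ^ 8 \<le> 32 * A\<^sup>2 * y ^ 29 * w"
      by (simp add: power_mult[symmetric])
    then have "s\<^sup>2 * s ^ 8 \<le> s\<^sup>2 * (32 * A\<^sup>2 * y ^ 29 * w)" by (intro mult_left_mono) auto
    then have "s ^ 10 \<le> 32 * A\<^sup>2 * (y ^ 29 * (s\<^sup>2 * w))"
      by (simp add: power_add[symmetric] mult_ac)
    also have "\<dots> \<le> 32 * A\<^sup>2 * (y ^ 6 * s ^ 8 + y ^ 29 * (s\<^sup>2 * w))"
      using y1 by (intro mult_left_mono) auto
    finally have g1: "s ^ 10 \<le> 32 * A\<^sup>2 * (y ^ 6 * s ^ 8 + y ^ 29 * (s\<^sup>2 * w))" .
    \<comment> \<open>lam^(-3) = lam^(-4) lam <= lam^(-4) y^4 turns the cube of the Weyl bound into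
      an exact fourth power, whose root is of order y^13 / lam.\<close>
    have "(s ^ 3) ^ 4 = (s ^ 4) ^ 3" by (simp add: power_mult[symmetric])
    also have "\<dots> \<le> (2 * A * y ^ 16 / lam) ^ 3"
      using s4 by (intro power_mono) auto
    also have "\<dots> = (2 * A) ^ 3 * y ^ 48 / lam ^ 4 * lam"
      using lam0 by (simp add: power_mult_distrib power_divide power_mult[symmetric] eval_nat_numeral)
    also have "\<dots> \<le> (2 * A) ^ 4 * y ^ 48 / lam ^ 4 * y ^ 4"
      using A1 lam0 lamy y1 by (intro mult_mono divide_right_mono mult_right_mono power_increasing) auto
    also have "\<dots> = (2 * A * y ^ 13 / lam) ^ 4"
      by (simp add: power_mult_distrib power_divide power_mult[symmetric] power_add[symmetric])
    finally have "s ^ 3 \<le> 2 * A * y ^ 13 / lam"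
      by (rule power_le_imp_le_base[where n = 3, unfolded numeral_eq_Suc, simplified]) (use A1 y1 lam0 in auto)
    also have "\<dots> = 2 * A * y ^ 13 * (1 / lam)" by simp
    also have "\<dots> \<le> 2 * A * y ^ 13 * w" using wl A1 y1 by (intro mult_left_mono) auto
    also have "\<dots> \<le> 32 * A\<^sup>2 * y ^ 13 * w"
      using A1 y1 w0 by (intro mult_right_mono) (auto simp: power2_eq_square)
    finally have "s\<^sup>2 * s ^ 3 \<le> s\<^sup>2 * (32 * A\<^sup>2 * y ^ 13 * w)" by (intro mult_left_mono) auto
    then have "s ^ 5 \<le> 32 * A\<^sup>2 * (y ^ 13 * (s\<^sup>2 * w))"
      by (simp add: power_add[symmetric] mult_ac)
    also have "\<dots> \<le> 32 * A\<^sup>2 * (y ^ 3 * s ^ 4 + y ^ 13 * (s\<^sup>2 * w))"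
      using y1 by (intro mult_left_mono) auto
    finally show ?thesis using g1 by simp
  qed
  then show "s ^ 10 \<le> 32 * A\<^sup>2 * (y ^ 6 * s ^ 8 + y ^ 29 * (s\<^sup>2 * arc_weight X \<alpha>))"
    and "s ^ 5 \<le> 32 * A\<^sup>2 * (y ^ 3 * s ^ 4 + y ^ 13 * (s\<^sup>2 * arc_weight X \<alpha>))"
    unfolding w_def by auto
qed

end

text \<open>Turns a weak type bound into a strong one at the cost of a logarithm.\<close>

lemma sum_le_harm_if_rank_bound:
  fixes a :: "'a \<Rightarrow> real"
  assumes "finite R" "\<And>n. n \<in> R \<Longrightarrow> a n \<ge> 0"
    "\<And>n. n \<in> R \<Longrightarrow> a n * real (card {m \<in> R. a m \<ge> a n}) \<le> B"
  shows "(\<Sum>n\<in>R. a n) \<le> B * harm (card R)"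
  using assms
proof (induction "card R" arbitrary: R)
  case 0
  then show ?case by (simp add: harm_def)
next
  case (Suc k)
  then have "R \<noteq> {}" by auto
  \<comment> \<open>The least value has all of \<open>R\<close> above it, so it is at most B / card
    R, the last term of the harmonic sum.\<close>
  then obtain n0 where n0: "n0 \<in> R" "\<And>m. m \<in> R \<Longrightarrow> a n0 \<le> a m"
    using Suc.prems(1) by (metis arg_min_least arg_min_if_finite(1))
  define R' where "R' = R - {n0}"
  have fin: "finite R'" and k: "k = card R'"
    using Suc n0 by (auto simp: R'_def)
  have "(\<Sum>n\<in>R'. a n) \<le> B * harm (card R')"
  proof (rule Suc.hyps(1)[OF k fin])
    fix n assume n: "n \<in> R'"
    then show "a n \<ge> 0" using Suc.prems(2) by (auto simp: R'_def)
    have "card {m \<in> R'. a m \<ge> a n} \<le> card {m \<in> R. a m \<ge> a n}"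
      using Suc.prems(1) by (intro card_mono) (auto simp: R'_def)
    then have "a n * real (card {m \<in> R'. a m \<ge> a n}) \<le> a n * real (card {m \<in> R. a m \<ge> a n})"
      using \<open>a n \<ge> 0\<close> by (intro mult_left_mono) auto
    also have "\<dots> \<le> B" using Suc.prems(3) n by (auto simp: R'_def)
    finally show "a n * real (card {m \<in> R'. a m \<ge> a n}) \<le> B" .
  qed
  moreover have "a n0 \<le> B * inverse (real (Suc k))"
  proof -
    have "{m \<in> R. a m \<ge> a n0} = R" using n0 by auto
    then have "a n0 * real (Suc k) \<le> B" using Suc.prems(3)[OF n0(1)] Suc.hyps(2) by simp
    then show ?thesis by (simp add: field_simps)
  qed
  moreover have "(\<Sum>n\<in>R. a n) = a n0 + (\<Sum>n\<in>R'. a n)"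
    using n0(1) Suc.prems(1) unfolding R'_def by (rule sum.remove[rotated])
  ultimately show ?case
    unfolding Suc.hyps(2)[symmetric] by (simp add: harm_Suc k distrib_left)
qed

lemma harm_le_ln_plus_1: "n > 0 \<Longrightarrow> harm n \<le> ln (real n) + (1 :: real)"
  using euler_mascheroni_sequence_decreasing[of 1 n] by (simp add: harm_def)

section \<open>Mean square and large values of the minor arc coefficients\<close>

context minor_arc_bounds
begin

definition coef :: "nat \<Rightarrow> complex" where
  "coef n = (\<integral>\<alpha>. indicator (minor_arcs P) \<alpha> *\<^sub>R (cube_sum X \<alpha> ^ 5 * ee (- (real n * \<alpha>))) \<partial>unit_circle)"

text \<open>Duality: pairing the coefficients with arbitrary numbers \<open>b\<close> is an integral
  of the conjugate of f^5 against a trigonometric sum. The conjugate turns e(-n \<alpha>) into e(n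
  \<alpha>).\<close>

lemma sum_cnj_coef_le:
  assumes "finite S"
  shows "cmod (\<Sum>n\<in>S. b n * cnj (coef n)) \<le>
    (\<integral>\<alpha>. indicator (minor_arcs P) \<alpha> *\<^sub>R (cmod (cube_sum X \<alpha>) ^ 5 * cmod (trig_sum b int S \<alpha>)) \<partial>unit_circle)"
proof -
  have c: "b n * cnj (coef n) =
      (\<integral>\<alpha>. indicator (minor_arcs P) \<alpha> *\<^sub>R (b n * (cnj (cube_sum X \<alpha>) ^ 5 * ee (real n * \<alpha>))) \<partial>unit_circle)" for n
  proof -
    have "cnj (coef n) = (\<integral>\<alpha>. cnj (indicator (minor_arcs P) \<alpha> *\<^sub>R (cube_sum X \<alpha> ^ 5 * ee (- (real n * \<alpha>)))) \<partial>unit_circle)"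
      unfolding coef_def by (rule Bochner_Integration.integral_cnj[symmetric])
    also have "\<dots> = (\<integral>\<alpha>. indicator (minor_arcs P) \<alpha> *\<^sub>R (cnj (cube_sum X \<alpha>) ^ 5 * ee (real n * \<alpha>)) \<partial>unit_circle)"
      by (simp add: cnj_ee complex_cnj_scaleR)
    finally show ?thesis by (simp flip: integral_mult_right_zero)
  qed
  have "(\<Sum>n\<in>S. b n * cnj (coef n)) =
      (\<integral>\<alpha>. (\<Sum>n\<in>S. indicator (minor_arcs P) \<alpha> *\<^sub>R (b n * (cnj (cube_sum X \<alpha>) ^ 5 * ee (real n * \<alpha>)))) \<partial>unit_circle)"
    unfolding c
    by (intro Bochner_Integration.integral_sum[symmetric] integrable_minor_arcs continuous_intros)
  also have "\<dots> = (\<integral>\<alpha>. indicator (minor_arcs P) \<alpha> *\<^sub>R (cnj (cube_sum X \<alpha>) ^ 5 * trig_sum b int S \<alpha>) \<partial>unit_circle)"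
    unfolding trig_sum_def scaleR_sum_right[symmetric] sum_distrib_left by (simp add: mult_ac)
  finally have "cmod (\<Sum>n\<in>S. b n * cnj (coef n)) \<le>
      (\<integral>\<alpha>. cmod (indicator (minor_arcs P) \<alpha> *\<^sub>R (cnj (cube_sum X \<alpha>) ^ 5 * trig_sum b int S \<alpha>)) \<partial>unit_circle)"
    by (simp only: integral_norm_bound)
  then show ?thesis
    by (simp add: norm_mult norm_power)
qed

text \<open>The generic part is y^6 X^5 = y^26, that is X^(13/2); the part near rationals is only
  y^29 / X = y^25. The 52 is 28 + 24.\<close>

lemma integral_minor_pow10_le:
  "(\<integral>\<alpha>. indicator (minor_arcs P) \<alpha> *\<^sub>R (cmod (cube_sum X \<alpha>) ^ 10) \<partial>unit_circle) \<le> 32 * 1600\<^sup>2 * 52 * D ^ 6 * y ^ 26"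
proof -
  define A where "A = 1600 * D\<^sup>2"
  define s where "s \<alpha> = cmod (cube_sum X \<alpha>)" for \<alpha>
  define w where "w = arc_weight X"
  have cs: "continuous_on UNIV s" unfolding s_def by (intro continuous_intros)
  have cw: "continuous_on UNIV w" unfolding w_def by (intro continuous_intros)
  have y1: "y \<ge> 1" by (rule y_ge_1)
  have "(\<integral>\<alpha>. indicator (minor_arcs P) \<alpha> *\<^sub>R (s \<alpha> ^ 10) \<partial>unit_circle) \<le>
      (\<integral>\<alpha>. 32 * A\<^sup>2 * (y ^ 6 * s \<alpha> ^ 8 + y ^ 29 * ((s \<alpha>)\<^sup>2 * w \<alpha>)) \<partial>unit_circle)"
  proof (intro integral_mono integrable_minor_arcs integrable_unit_circle)
    fix \<alpha>
    show "indicator (minor_arcs P) \<alpha> *\<^sub>R (s \<alpha> ^ 10) \<le> 32 * A\<^sup>2 * (y ^ 6 * s \<alpha> ^ 8 + y ^ 29 * ((s \<alpha>)\<^sup>2 * w \<alpha>))"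
    proof (cases "\<alpha> \<in> minor_arcs P")
      case True
      then show ?thesis using minor_arc_pointwise(1)[OF True] by (simp add: s_def A_def w_def)
    next
      case False
      have "0 \<le> 32 * A\<^sup>2 * (y ^ 6 * s \<alpha> ^ 8 + y ^ 29 * ((s \<alpha>)\<^sup>2 * w \<alpha>))"
        using y1 arc_weight_nonneg[of X \<alpha>] by (intro mult_nonneg_nonneg add_nonneg_nonneg) (auto simp: s_def w_def)
      then show ?thesis using False by simp
    qed
  qed (intro continuous_intros cs cw)+
  also have "\<dots> = 32 * A\<^sup>2 * (y ^ 6 * (\<integral>\<alpha>. s \<alpha> ^ 8 \<partial>unit_circle) + y ^ 29 * (\<integral>\<alpha>. (s \<alpha>)\<^sup>2 * w \<alpha> \<partial>unit_circle))"
    by (subst Bochner_Integration.integral_mult_right_zero, subst Bochner_Integration.integral_add)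
       (auto intro!: integrable_unit_circle continuous_intros cs cw)
  also have "\<dots> \<le> 32 * A\<^sup>2 * (y ^ 6 * (28 * D\<^sup>2 * real X ^ 5) + y ^ 29 * (24 * D\<^sup>2 / real X))"
    using integral_cube_sum_pow8_le integral_cube_sum_arc_weight_le y1
    unfolding s_def w_def by (intro mult_left_mono add_mono) auto
  also have "\<dots> = 32 * A\<^sup>2 * (28 * D\<^sup>2 * y ^ 26 + 24 * D\<^sup>2 * y ^ 25)"
  proof -
    have "y ^ 29 / y ^ 4 = y ^ 25" using y1 by (simp add: power_diff[symmetric])
    moreover have "y ^ 29 * (24 * D\<^sup>2 / y ^ 4) = 24 * D\<^sup>2 * (y ^ 29 / y ^ 4)" by simp
    moreover have "y ^ 6 * (28 * D\<^sup>2 * (y ^ 4) ^ 5) = 28 * D\<^sup>2 * y ^ 26"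
      by (simp add: power_mult[symmetric] power_add[symmetric])
    ultimately show ?thesis unfolding X_eq by (simp only:)
  qed
  also have "\<dots> \<le> 32 * A\<^sup>2 * (52 * D\<^sup>2 * y ^ 26)"
  proof -
    have "24 * D\<^sup>2 * y ^ 25 \<le> 24 * D\<^sup>2 * y ^ 26"
      using y1 by (intro mult_left_mono power_increasing) auto
    then show ?thesis by (intro mult_left_mono) auto
  qed
  also have "\<dots> = 32 * 1600\<^sup>2 * 52 * D ^ 6 * y ^ 26"
    by (simp add: A_def power_mult_distrib power_mult[symmetric] power_add[symmetric])
  finally show ?thesis unfolding s_def .
qed

text \<open>Bessel's inequality by duality, with \<open>b\<close> equal to the coefficients: the sum
  M satisfies M^2 <= M times the tenth moment on the minor arcs.\<close>

lemma sum_coef_square_le: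
  assumes "finite S"
  shows "(\<Sum>n\<in>S. (cmod (coef n))\<^sup>2) \<le> 32 * 1600\<^sup>2 * 52 * D ^ 6 * y ^ 26"
proof -
  define a where "a \<alpha> = indicator (minor_arcs P) \<alpha> *\<^sub>R (cmod (cube_sum X \<alpha>) ^ 5)" for \<alpha>
  define T where "T \<alpha> = cmod (trig_sum coef int S \<alpha>)" for \<alpha>
  define M where "M = (\<Sum>n\<in>S. (cmod (coef n))\<^sup>2)"
  have M0: "M \<ge> 0" by (simp add: M_def sum_nonneg)
  have a2: "(a \<alpha>)\<^sup>2 = indicator (minor_arcs P) \<alpha> *\<^sub>R (cmod (cube_sum X \<alpha>) ^ 10)" for \<alpha>
    by (simp add: a_def power_mult_distrib power_mult[symmetric] indicator_def)
  have aT: "a \<alpha> * T \<alpha> = indicator (minor_arcs P) \<alpha> *\<^sub>R (cmod (cube_sum X \<alpha>) ^ 5 * cmod (trig_sum coef int S \<alpha>))" for \<alpha>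
    by (simp add: a_def T_def)
  have "complex_of_real M = (\<Sum>n\<in>S. coef n * cnj (coef n))"
    by (simp only: M_def of_real_sum complex_norm_square)
  then have "M = cmod (\<Sum>n\<in>S. coef n * cnj (coef n))"
    using M0 by (metis norm_of_real abs_of_nonneg)
  also have "\<dots> \<le> (\<integral>\<alpha>. a \<alpha> * T \<alpha> \<partial>unit_circle)"
    unfolding aT by (rule sum_cnj_coef_le[OF assms])
  finally have "M\<^sup>2 \<le> (\<integral>\<alpha>. a \<alpha> * T \<alpha> \<partial>unit_circle)\<^sup>2"
    using M0 by (intro power_mono)
  also have "\<dots> \<le> (\<integral>\<alpha>. (a \<alpha>)\<^sup>2 \<partial>unit_circle) * (\<integral>\<alpha>. (T \<alpha>)\<^sup>2 \<partial>unit_circle)"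
  proof (rule integral_Cauchy_Schwarz)
    show "integrable unit_circle (\<lambda>\<alpha>. (a \<alpha>)\<^sup>2)"
      unfolding a2 by (intro integrable_minor_arcs continuous_intros)
    show "integrable unit_circle (\<lambda>\<alpha>. a \<alpha> * T \<alpha>)"
      unfolding aT by (intro integrable_minor_arcs continuous_intros)
    show "integrable unit_circle (\<lambda>\<alpha>. (T \<alpha>)\<^sup>2)"
      unfolding T_def by (intro integrable_unit_circle continuous_intros)
  qed
  also have "(\<integral>\<alpha>. (T \<alpha>)\<^sup>2 \<partial>unit_circle) = M"
    unfolding T_def M_def using assms by (intro integral_norm_trig_sum_square_inj) auto
  also have "(\<integral>\<alpha>. (a \<alpha>)\<^sup>2 \<partial>unit_circle) * M \<le> 32 * 1600\<^sup>2 * 52 * D ^ 6 * y ^ 26 * M"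
    unfolding a2 by (intro mult_right_mono integral_minor_pow10_le M0)
  finally have "M * M \<le> 32 * 1600\<^sup>2 * 52 * D ^ 6 * y ^ 26 * M" by (simp add: power2_eq_square)
  moreover have "32 * 1600\<^sup>2 * 52 * D ^ 6 * y ^ 26 \<ge> 0" using D_ge_1 y_ge_1 by simp
  ultimately have "M \<le> 32 * 1600\<^sup>2 * 52 * D ^ 6 * y ^ 26"
    using M0 by (cases "M = 0") (auto simp: mult_le_cancel_right)
  then show ?thesis unfolding M_def .
qed

text \<open>If card S is at least X, Cauchy-Schwarz is applied to f^4 and f K; otherwise |f|^5 is first
  replaced by its pointwise majorant on the minor arcs, and Cauchy-Schwarz is applied to f^2 and f^2 K.\<close>

lemma integral_minor_pow5_mult_le:
  assumes fin: "finite S" and S: "\<And>n. n \<in> S \<Longrightarrow> n \<le> 8 * X ^ 3" and b: "\<And>n. n \<in> S \<Longrightarrow> cmod (b n) \<le> 1"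
    and ne: "S \<noteq> {}"
  shows "(\<integral>\<alpha>. indicator (minor_arcs P) \<alpha> *\<^sub>R (cmod (cube_sum X \<alpha>) ^ 5 * cmod (trig_sum b int S \<alpha>)) \<partial>unit_circle)
    \<le> 32 * 1600\<^sup>2 * 29 * D ^ 6 * y ^ 11 * (real (card S) powr (1/4)) ^ 3"
proof -
  define A where "A = 1600 * D\<^sup>2"
  define s where "s \<alpha> = cmod (cube_sum X \<alpha>)" for \<alpha>
  define K where "K \<alpha> = cmod (trig_sum b int S \<alpha>)" for \<alpha>
  define w where "w = arc_weight X"
  define z where "z = real (card S) powr (1/4)"
  have cs: "continuous_on UNIV s" unfolding s_def by (intro continuous_intros)
  have cK: "continuous_on UNIV K" unfolding K_def by (intro continuous_intros)
  have cw: "continuous_on UNIV w" unfolding w_def by (intro continuous_intros)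
  have w0: "w \<alpha> \<ge> 0" for \<alpha> by (simp add: w_def arc_weight_nonneg)
  have s0: "s \<alpha> \<ge> 0" and K0: "K \<alpha> \<ge> 0" for \<alpha> by (simp_all add: s_def K_def)
  have y1: "y \<ge> 1" by (rule y_ge_1)
  have cardS: "card S \<ge> 1" using fin ne by (simp add: Suc_le_eq card_gt_0_iff)
  have z1: "z \<ge> 1" using cardS by (simp add: z_def ge_one_powr_ge_zero)
  have Z: "real (card S) = z ^ 4"
    using cardS by (simp add: z_def powr_powr powr_realpow[symmetric])
  have sqrtZ: "sqrt (real (card S)) = z\<^sup>2"
  proof -
    have "real (card S) = (z\<^sup>2)\<^sup>2" unfolding Z by (simp add: power_mult[symmetric])
    then show ?thesis by (simp only: real_sqrt_abs abs_power2)
  qed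
  have sqrtX: "sqrt (real X) = y\<^sup>2"
  proof -
    have "real X = (y\<^sup>2)\<^sup>2" unfolding X_eq by (simp add: power_mult[symmetric])
    then show ?thesis by (simp only: real_sqrt_abs abs_power2)
  qed
  have KZ: "K \<alpha> \<le> z ^ 4" for \<alpha>
  proof -
    have "K \<alpha> \<le> (\<Sum>n\<in>S. 1)"
      unfolding K_def trig_sum_def using b by (intro sum_norm_le) (simp add: norm_mult)
    then show ?thesis using Z by simp
  qed
  have D6: "D ^ k \<le> D ^ 6" if "k \<le> 6" for k using D_ge_1 that by (rule power_increasing[rotated])
  show ?thesis
  proof (cases "X \<le> card S")
    case True
    have "(\<integral>\<alpha>. indicator (minor_arcs P) \<alpha> *\<^sub>R (s \<alpha> ^ 5 * K \<alpha>) \<partial>unit_circle) \<le> (\<integral>\<alpha>. s \<alpha> ^ 4 * (s \<alpha> * K \<alpha>) \<partial>unit_circle)"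
    proof (intro integral_mono integrable_minor_arcs integrable_unit_circle)
      fix \<alpha>
      have e: "s \<alpha> ^ 4 * (s \<alpha> * K \<alpha>) = s \<alpha> ^ 5 * K \<alpha>" by (simp add: eval_nat_numeral)
      have "s \<alpha> ^ 5 * K \<alpha> \<ge> 0" using s0 K0 by simp
      then show "indicator (minor_arcs P) \<alpha> *\<^sub>R (s \<alpha> ^ 5 * K \<alpha>) \<le> s \<alpha> ^ 4 * (s \<alpha> * K \<alpha>)"
        unfolding e by (cases "\<alpha> \<in> minor_arcs P") simp_all
    qed (intro continuous_intros cs cK)+
    also have "\<dots> \<le> 12 * D\<^sup>2 * y ^ 11 * z ^ 3"
    proof (rule power2_le_imp_le)
      have "(\<integral>\<alpha>. s \<alpha> ^ 4 * (s \<alpha> * K \<alpha>) \<partial>unit_circle)\<^sup>2 \<le>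
          (\<integral>\<alpha>. (s \<alpha> ^ 4)\<^sup>2 \<partial>unit_circle) * (\<integral>\<alpha>. (s \<alpha> * K \<alpha>)\<^sup>2 \<partial>unit_circle)"
        by (intro integral_Cauchy_Schwarz integrable_unit_circle continuous_intros cs cK)
      also have "\<dots> \<le> (28 * D\<^sup>2 * real X ^ 5) * (5 * D * sqrt (real X) * (real (card S) * sqrt (real (card S))))"
      proof (intro mult_mono)
        show "(\<integral>\<alpha>. (s \<alpha> ^ 4)\<^sup>2 \<partial>unit_circle) \<le> 28 * D\<^sup>2 * real X ^ 5"
          using integral_cube_sum_pow8_le unfolding s_def by (simp add: power_mult[symmetric])
        have "(\<integral>\<alpha>. (s \<alpha> * K \<alpha>)\<^sup>2 \<partial>unit_circle) \<le> energy (\<lambda>(n, x). int n + int x ^ 3) (S \<times> {1..X})"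
          unfolding s_def K_def using b by (rule integral_cube_sum_mult_le)
        also have "\<dots> \<le> 5 * D * sqrt (real X) * (real (card S) * sqrt (real (card S)))"
          using fin S True by (rule energy_shifted_cubes_large)
        finally show "(\<integral>\<alpha>. (s \<alpha> * K \<alpha>)\<^sup>2 \<partial>unit_circle) \<le> 5 * D * sqrt (real X) * (real (card S) * sqrt (real (card S)))" .
      qed (use D_ge_1 in auto)
      also have "\<dots> = 140 * D ^ 3 * (y ^ 11 * z ^ 3)\<^sup>2"
        unfolding sqrtX sqrtZ unfolding Z X_eq by (simp add: eval_nat_numeral mult_ac)
      \<comment> \<open>Rounded up to a perfect square, as the bound is squared here.\<close>
      also have "\<dots> \<le> 144 * D ^ 4 * (y ^ 11 * z ^ 3)\<^sup>2"
        using D_ge_1 by (intro mult_right_mono mult_mono power_increasing) auto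
      also have "\<dots> = (12 * D\<^sup>2 * y ^ 11 * z ^ 3)\<^sup>2"
        by (simp add: power_mult_distrib power_mult[symmetric])
      finally show "(\<integral>\<alpha>. s \<alpha> ^ 4 * (s \<alpha> * K \<alpha>) \<partial>unit_circle)\<^sup>2 \<le> (12 * D\<^sup>2 * y ^ 11 * z ^ 3)\<^sup>2" .
    qed (use D_ge_1 y1 z1 in auto)
    also have "\<dots> \<le> 32 * 1600\<^sup>2 * 29 * D ^ 6 * y ^ 11 * z ^ 3"
      using D6[of 2] D_ge_1 y1 z1 by (intro mult_right_mono mult_mono) auto
    finally show ?thesis unfolding s_def K_def z_def .
  next
    case False
    then have small: "card S \<le> X" by simp
    have zy: "z \<le> y"
      unfolding z_def y_def using small by (intro powr_mono2) auto
    \<comment> \<open>In the generic part K stays for Cauchy-Schwarz; in the weighted part it is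
      replaced by its maximum Z = z^4.\<close>
    have "(\<integral>\<alpha>. indicator (minor_arcs P) \<alpha> *\<^sub>R (s \<alpha> ^ 5 * K \<alpha>) \<partial>unit_circle) \<le>
        (\<integral>\<alpha>. 32 * A\<^sup>2 * (y ^ 3 * ((s \<alpha>)\<^sup>2 * (s \<alpha> * (s \<alpha> * K \<alpha>))) + y ^ 13 * z ^ 4 * ((s \<alpha>)\<^sup>2 * w \<alpha>)) \<partial>unit_circle)"
    proof (intro integral_mono integrable_minor_arcs integrable_unit_circle)
      fix \<alpha>
      have e: "(s \<alpha>)\<^sup>2 * (s \<alpha> * (s \<alpha> * K \<alpha>)) = s \<alpha> ^ 4 * K \<alpha>"
        by (simp add: eval_nat_numeral)
      show "indicator (minor_arcs P) \<alpha> *\<^sub>R (s \<alpha> ^ 5 * K \<alpha>) \<le>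
          32 * A\<^sup>2 * (y ^ 3 * ((s \<alpha>)\<^sup>2 * (s \<alpha> * (s \<alpha> * K \<alpha>))) + y ^ 13 * z ^ 4 * ((s \<alpha>)\<^sup>2 * w \<alpha>))"
      proof (cases "\<alpha> \<in> minor_arcs P")
        case True
        have "s \<alpha> ^ 5 * K \<alpha> \<le> 32 * A\<^sup>2 * (y ^ 3 * s \<alpha> ^ 4 + y ^ 13 * ((s \<alpha>)\<^sup>2 * w \<alpha>)) * K \<alpha>"
          using minor_arc_pointwise(2)[OF True] K0 unfolding s_def w_def A_def by (intro mult_right_mono)
        also have "\<dots> = 32 * A\<^sup>2 * (y ^ 3 * (s \<alpha> ^ 4 * K \<alpha>) + y ^ 13 * ((s \<alpha>)\<^sup>2 * w \<alpha>) * K \<alpha>)"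
          by (simp add: algebra_simps)
        also have "\<dots> \<le> 32 * A\<^sup>2 * (y ^ 3 * (s \<alpha> ^ 4 * K \<alpha>) + y ^ 13 * ((s \<alpha>)\<^sup>2 * w \<alpha>) * z ^ 4)"
          using KZ w0 y1 by (intro mult_left_mono add_mono) auto
        finally show ?thesis using True unfolding e by (simp add: mult_ac)
      next
        case False
        have "0 \<le> 32 * A\<^sup>2 * (y ^ 3 * ((s \<alpha>)\<^sup>2 * (s \<alpha> * (s \<alpha> * K \<alpha>))) + y ^ 13 * z ^ 4 * ((s \<alpha>)\<^sup>2 * w \<alpha>))"
          using y1 z1 w0 s0 K0 by (intro mult_nonneg_nonneg add_nonneg_nonneg) auto
        then show ?thesis using False by simp
      qed
    qed (intro continuous_intros cs cw cK)+
    also have "\<dots> = 32 * A\<^sup>2 * (y ^ 3 * (\<integral>\<alpha>. (s \<alpha>)\<^sup>2 * (s \<alpha> * (s \<alpha> * K \<alpha>)) \<partial>unit_circle) +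
        y ^ 13 * z ^ 4 * (\<integral>\<alpha>. (s \<alpha>)\<^sup>2 * w \<alpha> \<partial>unit_circle))"
      by (subst Bochner_Integration.integral_mult_right_zero, subst Bochner_Integration.integral_add)
         (auto intro!: integrable_unit_circle continuous_intros cs cw cK)
    also have "\<dots> \<le> 32 * A\<^sup>2 * (y ^ 3 * (5 * D\<^sup>2 * y ^ 8 * z ^ 3) + y ^ 13 * z ^ 4 * (24 * D\<^sup>2 / real X))"
    proof (intro mult_left_mono add_mono)
      show "(\<integral>\<alpha>. (s \<alpha>)\<^sup>2 * (s \<alpha> * (s \<alpha> * K \<alpha>)) \<partial>unit_circle) \<le> 5 * D\<^sup>2 * y ^ 8 * z ^ 3"
      proof (rule power2_le_imp_le)
        have "(\<integral>\<alpha>. (s \<alpha>)\<^sup>2 * (s \<alpha> * (s \<alpha> * K \<alpha>)) \<partial>unit_circle)\<^sup>2 \<le>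
            (\<integral>\<alpha>. ((s \<alpha>)\<^sup>2)\<^sup>2 \<partial>unit_circle) * (\<integral>\<alpha>. (s \<alpha> * (s \<alpha> * K \<alpha>))\<^sup>2 \<partial>unit_circle)"
          by (intro integral_Cauchy_Schwarz integrable_unit_circle continuous_intros cs cK)
        also have "\<dots> \<le> (2 * D * (real X)\<^sup>2) * (10 * D\<^sup>2 * (real X)\<^sup>2 * real (card S) * sqrt (real (card S)))"
        proof (intro mult_mono)
          show "(\<integral>\<alpha>. ((s \<alpha>)\<^sup>2)\<^sup>2 \<partial>unit_circle) \<le> 2 * D * (real X)\<^sup>2"
            using integral_cube_sum_pow4_le unfolding s_def by (simp add: power_mult[symmetric])
          have sK: "s \<alpha> * K \<alpha> = cmod (trig_sum (\<lambda>p. b (fst p)) (\<lambda>p. int (fst p) + int (snd p) ^ 3) (S \<times> {1..X}) \<alpha>)" for \<alpha>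
          proof -
            have "trig_sum b int S \<alpha> * cube_sum X \<alpha> = trig_sum (\<lambda>p. b (fst p)) (\<lambda>p. int (fst p) + int (snd p) ^ 3) (S \<times> {1..X}) \<alpha>"
              unfolding cube_sum_def trig_sum_mult by (simp add: case_prod_beta')
            then show ?thesis unfolding s_def K_def by (metis mult.commute norm_mult)
          qed
          have "(\<integral>\<alpha>. (s \<alpha> * (s \<alpha> * K \<alpha>))\<^sup>2 \<partial>unit_circle) \<le>
              energy (\<lambda>(p, y). (int (fst p) + int (snd p) ^ 3) + int y ^ 3) ((S \<times> {1..X}) \<times> {1..X})"
            unfolding sK unfolding s_def using b by (intro integral_cube_sum_mult_le) auto
          also have "\<dots> \<le> 10 * D\<^sup>2 * (real X)\<^sup>2 * real (card S) * sqrt (real (card S))"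
            using fin S small by (rule energy_two_shifted_cubes_le)
          finally show "(\<integral>\<alpha>. (s \<alpha> * (s \<alpha> * K \<alpha>))\<^sup>2 \<partial>unit_circle) \<le> 10 * D\<^sup>2 * (real X)\<^sup>2 * real (card S) * sqrt (real (card S))" .
        qed (use D_ge_1 in auto)
        also have "\<dots> = 20 * D ^ 3 * (y ^ 8 * z ^ 3)\<^sup>2"
          unfolding sqrtZ unfolding Z X_eq by (simp add: eval_nat_numeral mult_ac)
        also have "\<dots> \<le> 25 * D ^ 4 * (y ^ 8 * z ^ 3)\<^sup>2"
          using D_ge_1 by (intro mult_right_mono mult_mono power_increasing) auto
        also have "\<dots> = (5 * D\<^sup>2 * y ^ 8 * z ^ 3)\<^sup>2"
          by (simp add: power_mult_distrib power_mult[symmetric])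
        finally show "(\<integral>\<alpha>. (s \<alpha>)\<^sup>2 * (s \<alpha> * (s \<alpha> * K \<alpha>)) \<partial>unit_circle)\<^sup>2 \<le> (5 * D\<^sup>2 * y ^ 8 * z ^ 3)\<^sup>2" .
      qed (use D_ge_1 y1 z1 in auto)
      show "(\<integral>\<alpha>. (s \<alpha>)\<^sup>2 * w \<alpha> \<partial>unit_circle) \<le> 24 * D\<^sup>2 / real X"
        unfolding s_def w_def by (rule integral_cube_sum_arc_weight_le)
    qed (use y1 z1 in auto)
    also have "\<dots> = 32 * A\<^sup>2 * (5 * D\<^sup>2 * (y ^ 11 * z ^ 3) + 24 * D\<^sup>2 * (y ^ 9 * z ^ 4))"
    proof -
      have "y ^ 13 / y ^ 4 = y ^ 9" using y1 by (simp add: power_diff[symmetric])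
      moreover have "y ^ 13 * z ^ 4 * (24 * D\<^sup>2 / y ^ 4) = 24 * D\<^sup>2 * (y ^ 13 / y ^ 4 * z ^ 4)" by simp
      moreover have "y ^ 3 * (5 * D\<^sup>2 * y ^ 8 * z ^ 3) = 5 * D\<^sup>2 * (y ^ 11 * z ^ 3)"
        by (simp add: power_add[symmetric])
      ultimately show ?thesis unfolding X_eq by (simp only:)
    qed
    also have "\<dots> \<le> 32 * A\<^sup>2 * (5 * D\<^sup>2 * (y ^ 11 * z ^ 3) + 24 * D\<^sup>2 * (y ^ 11 * z ^ 3))"
    proof -
      \<comment> \<open>Since Z <= X means z <= y, the contribution near rationals is below the
        generic one.\<close>
      have "y ^ 9 * z ^ 4 = y ^ 9 * z * z ^ 3" by (simp add: eval_nat_numeral)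
      also have "\<dots> \<le> y ^ 9 * y\<^sup>2 * z ^ 3"
      proof (intro mult_right_mono mult_left_mono)
        show "z \<le> y\<^sup>2" using zy y1 self_le_power[of y 2] by linarith
      qed (use y1 z1 in auto)
      also have "\<dots> = y ^ 11 * z ^ 3" by (simp add: power_add[symmetric])
      finally show ?thesis using y1 z1 by (intro mult_left_mono add_mono) auto
    qed
    also have "\<dots> = 32 * 1600\<^sup>2 * 29 * D ^ 6 * y ^ 11 * z ^ 3"
      by (simp add: A_def power_mult_distrib power_mult[symmetric] power_add[symmetric] algebra_simps)
    finally show ?thesis unfolding s_def K_def z_def .
  qed
qed

text \<open>With \<open>b\<close> the sign of the coefficients, T Z is at most a constant times y^11
  Z^(3/4); dividing by Z^(3/4) and taking fourth powers gives the bound.\<close>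

lemma coef_large_values:
  assumes fin: "finite S" and S: "\<And>n. n \<in> S \<Longrightarrow> n \<le> 8 * X ^ 3"
    and T: "\<And>n. n \<in> S \<Longrightarrow> T \<le> cmod (coef n)" and T0: "T \<ge> 0"
  shows "T ^ 4 * real (card S) \<le> (32 * 1600\<^sup>2 * 29 * D ^ 6) ^ 4 * y ^ 44"
proof (cases "S = {}")
  case True
  then show ?thesis using D_ge_1 y_ge_1 by simp
next
  case False
  define C where "C = 32 * 1600\<^sup>2 * 29 * D ^ 6"
  define z where "z = real (card S) powr (1/4)"
  have cardS: "card S \<ge> 1" using fin False by (simp add: Suc_le_eq card_gt_0_iff)
  have z1: "z \<ge> 1" using cardS by (simp add: z_def ge_one_powr_ge_zero)
  have Z: "real (card S) = z ^ 4"
    using cardS by (simp add: z_def powr_powr powr_realpow[symmetric])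
  define b where "b n = sgn (coef n)" for n
  have "T * z ^ 4 = (\<Sum>n\<in>S. T)" using Z by simp
  also have "\<dots> \<le> (\<Sum>n\<in>S. cmod (coef n))" by (intro sum_mono T)
  also have "\<dots> = cmod (\<Sum>n\<in>S. b n * cnj (coef n))"
  proof -
    have "b n * cnj (coef n) = complex_of_real (cmod (coef n))" for n
    proof (cases "coef n = 0")
      case False
      have "b n * cnj (coef n) = coef n * cnj (coef n) / of_real (cmod (coef n))"
        by (simp add: b_def sgn_eq)
      also have "\<dots> = (of_real (cmod (coef n)))\<^sup>2 / of_real (cmod (coef n))"
        using complex_norm_square[of "coef n"] by simp
      also have "\<dots> = of_real (cmod (coef n))" using False by (simp add: power2_eq_square)
      finally show ?thesis .
    qed (simp add: b_def)
    then have "(\<Sum>n\<in>S. b n * cnj (coef n)) = complex_of_real (\<Sum>n\<in>S. cmod (coef n))" by simp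
    then show ?thesis by (metis abs_of_nonneg norm_ge_zero norm_of_real sum_nonneg)
  qed
  also have "\<dots> \<le> C * y ^ 11 * z ^ 3"
    unfolding C_def z_def
    by (rule order_trans[OF sum_cnj_coef_le[OF fin] integral_minor_pow5_mult_le[OF fin S _ False]])
       (auto simp: b_def norm_sgn)
  finally have "T * z * z ^ 3 \<le> C * y ^ 11 * z ^ 3" by (simp add: eval_nat_numeral mult_ac)
  then have "T * z \<le> C * y ^ 11" using z1 by (simp add: mult_le_cancel_right)
  then have "(T * z) ^ 4 \<le> (C * y ^ 11) ^ 4" using T0 z1 by (intro power_mono) auto
  then show ?thesis unfolding Z C_def by (simp add: power_mult_distrib power_mult[symmetric])
qed

text \<open>The large values estimate for the set of m with |coef m| >= |coef n| is exactly the rank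
  bound that \<open>sum_le_harm_if_rank_bound\<close> converts into a sum.\<close>

lemma sum_coef_pow4_le:
  assumes R: "R \<subseteq> {1..8 * X ^ 3}"
  shows "(\<Sum>n\<in>R. cmod (coef n) ^ 4) \<le> 7 * (32 * 1600\<^sup>2 * 29) ^ 4 * D ^ 25 * y ^ 44"
proof -
  define B where "B = (32 * 1600\<^sup>2 * 29 * D ^ 6) ^ 4 * y ^ 44"
  have B0: "B \<ge> 0" using D_ge_1 y_ge_1 by (simp add: B_def)
  have fin: "finite R" using R by (rule finite_subset) simp
  have "(\<Sum>n\<in>R. cmod (coef n) ^ 4) \<le> B * harm (card R)"
  proof (rule sum_le_harm_if_rank_bound[OF fin])
    fix n assume "n \<in> R"
    show "cmod (coef n) ^ 4 * real (card {m \<in> R. cmod (coef n) ^ 4 \<le> cmod (coef m) ^ 4}) \<le> B"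
      unfolding B_def
    proof (rule coef_large_values)
      fix m assume m: "m \<in> {m \<in> R. cmod (coef n) ^ 4 \<le> cmod (coef m) ^ 4}"
      then show "m \<le> 8 * X ^ 3" using R by auto
      show "cmod (coef n) \<le> cmod (coef m)"
        using m by (auto intro: power_le_imp_le_base[where n = 3, unfolded numeral_eq_Suc, simplified] simp: numeral_eq_Suc)
    qed (use fin in auto)
  qed auto
  also have "\<dots> \<le> B * (7 * D)"
  proof (intro mult_left_mono B0)
    \<comment> \<open>The harmonic sum is at most 3 (ln 2 + ln X) + 1 <= 3 (1 + D) + 1, and D >= 1
      makes this at most 7 D.\<close>
    have "card R \<le> 8 * X ^ 3" using card_mono[OF _ R] by simp
    then have "harm (card R) \<le> (harm (8 * X ^ 3) :: real)" by (rule harm_mono)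
    also have "\<dots> \<le> ln (real (8 * X ^ 3)) + 1" using X_pos by (intro harm_le_ln_plus_1) simp
    also have "ln (real (8 * X ^ 3)) = ln ((2 * real X) ^ 3)" by (simp add: power_mult_distrib)
    also have "\<dots> = 3 * (ln 2 + ln (real X))"
      using X_pos by (subst ln_realpow) (auto simp: ln_mult)
    also have "\<dots> \<le> 3 * (1 + D)"
    proof -
      have "ln (real X) \<le> ln (real X + 1)" using X_pos by simp
      also have "\<dots> \<le> harm X" by (rule ln_le_harm)
      also have "harm X \<le> D" using X_pos by (intro harm_le_D) (simp add: power2_eq_square)
      finally show ?thesis using ln_2_less_1 by simp
    qed
    finally show "harm (card R) \<le> 7 * D" using D_ge_1 by simp
  qed
  also have "\<dots> = 7 * (32 * 1600\<^sup>2 * 29) ^ 4 * D ^ 25 * y ^ 44"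
  proof -
    have "B = (32 * 1600\<^sup>2 * 29) ^ 4 * D ^ 24 * y ^ 44"
      unfolding B_def power_mult_distrib[of "32 * 1600\<^sup>2 * 29"] by (simp only: power_mult[symmetric]) simp
    moreover have "D ^ 25 = D ^ 24 * D" by (simp add: eval_nat_numeral)
    ultimately show ?thesis by (simp only: mult_ac)
  qed
  finally show ?thesis .
qed

end

section \<open>Moments of the minor arc coefficients\<close>

lemma power_powr:
  fixes x :: real
  assumes "x > 0"
  shows "(x ^ n) powr a = x powr (real n * a)"
  using assms by (simp add: powr_realpow[symmetric] powr_powr)

context minor_arc_bounds
begin

text \<open>Up to h = 4 the second and fourth moments are combined by splitting at one height;
  beyond h = 4 the fourth moment also bounds the largest coefficient.\<close>

lemma sum_coef_powr_le:
  assumes R: "R \<subseteq> {1..8 * X ^ 3}" and h: "h \<ge> 2"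
  defines "C2 \<equiv> 32 * 1600\<^sup>2 * 52" and "C4 \<equiv> 7 * (32 * 1600\<^sup>2 * 29) ^ 4"
  shows "(\<Sum>n\<in>R. cmod (coef n) powr h) \<le>
    (C2 + C4 + C4 powr (h / 4)) * D powr (25 / 2 * h) * (y powr (11 * h) + y powr (9 * h + 8))"
proof -
  have fin: "finite R" using R by (rule finite_subset) simp
  have C: "C2 > 0" "C4 > 0" by (simp_all add: C2_def C4_def)
  have y0: "y > 0" and y1: "y \<ge> 1" using y_ge_1 by auto
  have M2: "(\<Sum>n\<in>R. (cmod (coef n))\<^sup>2) \<le> C2 * D ^ 6 * y ^ 26"
    unfolding C2_def by (rule sum_coef_square_le[OF fin])
  have M4: "(\<Sum>n\<in>R. cmod (coef n) ^ 4) \<le> C4 * D ^ 25 * y ^ 44"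
    unfolding C4_def by (rule sum_coef_pow4_le[OF R])
  \<comment> \<open>25 is the largest power of \<open>D\<close> in the two moments, and h >= 2 gives
    25 <= 25/2 * h.\<close>
  have Dk: "D ^ k \<le> D powr (25 / 2 * h)" if "k \<le> 25" for k
  proof -
    have "D ^ k = D powr (real k)" using D_ge_1 by (simp add: powr_realpow)
    also have "\<dots> \<le> D powr (25 / 2 * h)" using D_ge_1 h that by (intro powr_mono) auto
    finally show ?thesis .
  qed
  define E where "E = D powr (25 / 2 * h)"
  have E0: "E \<ge> 0" by (simp add: E_def)
  show ?thesis
  proof (cases "h \<le> 4")
    case True
    \<comment> \<open>The height where the moment bounds balance: r^2 = y^44 / y^26. Values up to r
      are charged to the second moment, larger ones to the fourth.\<close>
    define r where "r = y ^ 9"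
    have r0: "r > 0" using y0 by (simp add: r_def)
    have rp: "r powr a = y powr (9 * a)" for a
      using y0 by (simp add: r_def power_powr)
    have "(\<Sum>n\<in>R. cmod (coef n) powr h) \<le>
        (\<Sum>n\<in>R. r powr (h - 2) * (cmod (coef n))\<^sup>2 + r powr (h - 4) * cmod (coef n) ^ 4)"
    proof (intro sum_mono)
      fix n
      define c where "c = cmod (coef n)"
      have c0: "c \<ge> 0" by (simp add: c_def)
      have split: "c powr h = c powr (h - real k) * c ^ k" if "c > 0" for k
        using that by (simp add: powr_realpow[symmetric] powr_add[symmetric])
      have nn: "0 \<le> r powr (h - 2) * c\<^sup>2" "0 \<le> r powr (h - 4) * c ^ 4" by simp_all
      consider "c = 0" | "c > 0" "c \<le> r" | "c > r" using c0 by linarith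
      then have "c powr h \<le> r powr (h - 2) * c\<^sup>2 + r powr (h - 4) * c ^ 4"
      proof cases
        case 2
        have "c powr h = c powr (h - 2) * c\<^sup>2" using split[OF 2(1), of 2] by simp
        also have "\<dots> \<le> r powr (h - 2) * c\<^sup>2" using 2 h by (intro mult_right_mono powr_mono2) auto
        finally show ?thesis using nn by linarith
      next
        case 3
        then have "c > 0" using r0 by linarith
        have "c powr h = c powr (h - 4) * c ^ 4" using split[OF \<open>c > 0\<close>, of 4] by simp
        also have "\<dots> \<le> r powr (h - 4) * c ^ 4"
          using 3 r0 True by (intro mult_right_mono powr_mono2') auto
        finally show ?thesis using nn by linarith
      qed simp
      then show "cmod (coef n) powr h \<le> r powr (h - 2) * (cmod (coef n))\<^sup>2 + r powr (h - 4) * cmod (coef n) ^ 4"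
        unfolding c_def .
    qed
    also have "\<dots> = r powr (h - 2) * (\<Sum>n\<in>R. (cmod (coef n))\<^sup>2) + r powr (h - 4) * (\<Sum>n\<in>R. cmod (coef n) ^ 4)"
      by (simp add: sum.distrib sum_distrib_left)
    also have "\<dots> \<le> r powr (h - 2) * (C2 * D ^ 6 * y ^ 26) + r powr (h - 4) * (C4 * D ^ 25 * y ^ 44)"
      using M2 M4 by (intro add_mono mult_left_mono) auto
    also have "\<dots> = C2 * D ^ 6 * (y powr (9 * (h - 2)) * y ^ 26) + C4 * D ^ 25 * (y powr (9 * (h - 4)) * y ^ 44)"
      unfolding rp by simp
    also have "y powr (9 * (h - 2)) * y ^ 26 = y powr (9 * h + 8)"
    proof -
      have "y ^ 26 = y powr 26" using y0 by (simp add: powr_numeral)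
      then show ?thesis by (simp add: powr_add[symmetric] add.commute)
    qed
    also have "y powr (9 * (h - 4)) * y ^ 44 = y powr (9 * h + 8)"
    proof -
      have "y ^ 44 = y powr 44" using y0 by (simp add: powr_numeral)
      then show ?thesis by (simp add: powr_add[symmetric] add.commute)
    qed
    also have "C2 * D ^ 6 * y powr (9 * h + 8) + C4 * D ^ 25 * y powr (9 * h + 8) \<le>
        C2 * E * y powr (9 * h + 8) + C4 * E * y powr (9 * h + 8)"
      unfolding E_def using C Dk[of 6] Dk[of 25] by (intro add_mono mult_right_mono mult_left_mono) auto
    also have "\<dots> = (C2 + C4) * E * y powr (9 * h + 8)" by (simp add: algebra_simps)
    also have "\<dots> \<le> (C2 + C4 + C4 powr (h / 4)) * E * (y powr (11 * h) + y powr (9 * h + 8))"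
      using C E0 by (intro mult_mono mult_right_mono) auto
    finally show ?thesis unfolding E_def .
  next
    case False
    define S where "S = (\<Sum>n\<in>R. cmod (coef n) ^ 4)"
    have S0: "S \<ge> 0" by (simp add: S_def sum_nonneg)
    \<comment> \<open>A single fourth power is at most the whole sum \<open>S\<close>; this bounds
      the remaining h - 4 powers.\<close>
    have "(\<Sum>n\<in>R. cmod (coef n) powr h) \<le> (\<Sum>n\<in>R. cmod (coef n) ^ 4 * S powr (h / 4 - 1))"
    proof (intro sum_mono)
      fix n assume n: "n \<in> R"
      show "cmod (coef n) powr h \<le> cmod (coef n) ^ 4 * S powr (h / 4 - 1)"
      proof (cases "cmod (coef n) = 0")
        case False
        define c where "c = cmod (coef n)"
        have c0: "c > 0" using False by (simp add: c_def)
        have "c powr h = c powr 4 * c powr (4 * (h / 4 - 1))"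
          by (simp add: powr_add[symmetric])
        also have "\<dots> = c ^ 4 * (c ^ 4) powr (h / 4 - 1)"
        proof -
          have "c powr 4 = c ^ 4" using c0 by (simp add: powr_numeral)
          then show ?thesis by (simp only: powr_powr[symmetric])
        qed
        also have "\<dots> \<le> c ^ 4 * S powr (h / 4 - 1)"
        proof (intro mult_left_mono powr_mono2)
          show "c ^ 4 \<le> S" unfolding S_def c_def using n fin by (intro member_le_sum) auto
        qed (use \<open>\<not> h \<le> 4\<close> c0 in auto)
        finally show ?thesis unfolding c_def .
      qed simp
    qed
    also have "\<dots> = S * S powr (h / 4 - 1)" by (simp add: S_def sum_distrib_right)
    also have "\<dots> = S powr (h / 4)"
      using S0 by (cases "S = 0") (simp_all add: powr_diff)
    also have "\<dots> \<le> (C4 * D ^ 25 * y ^ 44) powr (h / 4)"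
      using M4 S0 h unfolding S_def by (intro powr_mono2) auto
    also have "\<dots> = C4 powr (h / 4) * (D ^ 25) powr (h / 4) * (y ^ 44) powr (h / 4)"
      by (simp add: powr_mult)
    also have "(y ^ 44) powr (h / 4) = y powr (11 * h)"
      using y0 by (simp add: power_powr)
    also have "C4 powr (h / 4) * (D ^ 25) powr (h / 4) * y powr (11 * h) \<le> C4 powr (h / 4) * E * y powr (11 * h)"
    proof (intro mult_right_mono mult_left_mono)
      have "(D ^ 25) powr (h / 4) = D powr (25 * (h / 4))"
        using D_ge_1 by (simp add: power_powr)
      also have "\<dots> \<le> E" unfolding E_def using D_ge_1 h by (intro powr_mono) auto
      finally show "(D ^ 25) powr (h / 4) \<le> E" .
    qed auto
    also have "\<dots> \<le> (C2 + C4 + C4 powr (h / 4)) * E * (y powr (11 * h) + y powr (9 * h + 8))"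
      using C E0 by (intro mult_mono mult_right_mono) auto
    finally show ?thesis unfolding E_def .
  qed
qed

section \<open>Passage to the real parameter N\<close>

lemma cubic_sum_eq: "cubic_sum P = cube_sum X"
proof -
  have "{x. 1 \<le> x \<and> real x \<le> P} = {1..X}"
  proof (intro equalityI subsetI)
    fix x :: nat assume "x \<in> {x. 1 \<le> x \<and> real x \<le> P}"
    then have "real x < real X + 1" "1 \<le> x" using P_less by auto
    then show "x \<in> {1..X}" by auto
  qed (use X_le_P in auto)
  then show ?thesis
    unfolding cubic_sum_def cube_sum_def trig_sum_def by (intro ext) (simp add: mult.commute)
qed

lemma coef_eq:
  "(LINT \<alpha>:minor_arcs P|lborel. cubic_sum P \<alpha> ^ 5 * ee (- (real n * \<alpha>))) = coef n"
proof -
  have "indicator {0..<1} \<alpha> * indicator (minor_arcs P) \<alpha> = (indicator (minor_arcs P) \<alpha> :: real)" for \<alpha>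
    using minor_arcs_subset[of P] by (auto simp: indicator_def)
  then show ?thesis
    unfolding set_lebesgue_integral_def coef_def cubic_sum_eq
    by (subst integral_restrict_space) (simp_all only: scaleR_scaleR, simp_all)
qed

end

text \<open>One multiple of N^\<delta> meets both requirements on \<open>D\<close>: divisor counts
  up to 9 N and the logarithm of 12 N.\<close>

lemma minor_arc_bounds_exists:
  fixes \<delta> :: real
  assumes "\<delta> > 0"
  obtains D0 where "D0 \<ge> 1"
    "\<And>N. N \<ge> 1 \<Longrightarrow> minor_arc_bounds (nat \<lfloor>N powr (1/3)\<rfloor>) (D0 * N powr \<delta>) (N powr (1/3))"
proof -
  obtain C where C: "C \<ge> 1" "\<And>n::nat. n > 0 \<Longrightarrow> real (card {d. d dvd n}) \<le> C * real n powr \<delta>"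
    using card_divisors_le_powr[OF assms] by blast
  \<comment> \<open>The first summand serves the divisor bound at 9 N, the second comes from ln(12
    N) <= (12 N)^\<delta> / \<delta>, and the 1 from harm n <= ln n + 1.\<close>
  define D0 where "D0 = C * 9 powr \<delta> + 12 powr \<delta> / \<delta> + 1"
  have pos: "C * 9 powr \<delta> \<ge> 0" "12 powr \<delta> / \<delta> \<ge> 0" using C assms by auto
  have D0: "D0 \<ge> 1" using pos by (simp add: D0_def)
  have "minor_arc_bounds (nat \<lfloor>N powr (1/3)\<rfloor>) (D0 * N powr \<delta>) (N powr (1/3))" if N: "N \<ge> 1" for N
  proof -
    define P where "P = N powr (1/3)"
    define X where "X = nat \<lfloor>P\<rfloor>"
    define V where "V = N powr \<delta>"
    have P1: "P \<ge> 1" using N by (simp add: P_def ge_one_powr_ge_zero)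
    have X1: "X > 0" using P1 by (simp add: X_def)
    have XP: "real X \<le> P" "P < real X + 1" using P1 by (simp_all add: X_def)
    have V1: "V \<ge> 1" using N assms by (simp add: V_def ge_one_powr_ge_zero)
    have P3: "P ^ 3 = N" using N by (simp add: P_def powr_power)
    have X3: "real X ^ 3 \<le> N" unfolding P3[symmetric] using XP by (intro power_mono) auto
    have D: "C * 9 powr \<delta> * V \<le> D0 * V" "(12 powr \<delta> / \<delta> + 1) * V \<le> D0 * V"
      using V1 pos by (auto simp: D0_def intro!: mult_right_mono)
    show ?thesis
      unfolding P_def[symmetric] X_def[symmetric] V_def[symmetric]
    proof unfold_locales
      show "X > 0" by (rule X1)
      show "1 \<le> D0 * V" using D0 V1 mult_mono[of 1 D0 1 V] by simp
      show "real X \<le> P" "P < real X + 1" by (fact XP)+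
    next
      fix m :: int assume m: "m \<noteq> 0" "\<bar>m\<bar> \<le> 9 * int X ^ 3"
      have "real (card {d::nat. int d dvd m}) = real (card {d. d dvd nat \<bar>m\<bar>})"
        by (simp add: dvd_nat_abs_iff)
      also have "\<dots> \<le> C * real (nat \<bar>m\<bar>) powr \<delta>" using m(1) by (intro C(2)) auto
      also have "\<dots> \<le> C * (9 * N) powr \<delta>"
      proof (intro mult_left_mono powr_mono2)
        have "real_of_int \<bar>m\<bar> \<le> real_of_int (9 * int X ^ 3)" using m(2) by (simp only: of_int_le_iff)
        then show "real (nat \<bar>m\<bar>) \<le> 9 * N" using X3 by simp
      qed (use C assms in auto)
      also have "\<dots> = C * 9 powr \<delta> * V" using N by (simp add: powr_mult V_def)
      also have "\<dots> \<le> D0 * V" by (rule D)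
      finally show "real (card {d::nat. int d dvd m}) \<le> D0 * V" .
    next
      have "harm (12 * X\<^sup>2) \<le> ln (real (12 * X\<^sup>2)) + (1 :: real)"
        using X1 by (intro harm_le_ln_plus_1) simp
      also have "ln (real (12 * X\<^sup>2)) \<le> ln (12 * N)"
      proof -
        have "(real X)\<^sup>2 \<le> real X ^ 3" using X1 by (intro power_increasing) auto
        then have "real (12 * X\<^sup>2) \<le> 12 * N" using X3 by simp
        moreover have "real (12 * X\<^sup>2) > 0" using X1 by simp
        ultimately show ?thesis using N by (subst ln_le_cancel_iff) auto
      qed
      also have "ln (12 * N) \<le> (12 * N) powr \<delta> / \<delta>"
        using N assms by (intro ln_powr_bound) auto
      also have "(12 * N) powr \<delta> = 12 powr \<delta> * V" using N by (simp add: powr_mult V_def)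
      also have "12 powr \<delta> * V / \<delta> + 1 \<le> (12 powr \<delta> / \<delta> + 1) * V"
        using V1 by (simp add: algebra_simps)
      also have "\<dots> \<le> D0 * V" by (rule D)
      finally show "harm (12 * X\<^sup>2) \<le> D0 * V" by simp
    qed
  qed
  then show ?thesis using that D0 by blast
qed

theorem theorem3p1:
  fixes h \<epsilon> :: real
  assumes "h \<ge> 2" and "\<epsilon> > 0"
  shows "minor_arc_moment h \<in> O[at_top](\<lambda>N. N powr \<epsilon> *
           (N powr (11/12 * h) + N powr (8/9 * h + 2/9) + N powr (3/4 * h + 2/3)))"
proof -
  define \<kappa> where "\<kappa> = 25 / 2 * h"
  have \<kappa>: "\<kappa> > 0" using assms by (simp add: \<kappa>_def)
  \<comment> \<open>\<open>\<kappa>\<close> is the exponent of \<open>D\<close> in the moment bound,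
    so this choice turns N^(\<delta> \<kappa>) into N^\<epsilon>.\<close>
  define \<delta> where "\<delta> = \<epsilon> / \<kappa>"
  have "\<delta> > 0" using assms \<kappa> by (simp add: \<delta>_def)
  then obtain D0 where D0: "D0 \<ge> 1" and
    loc: "\<And>N. N \<ge> 1 \<Longrightarrow> minor_arc_bounds (nat \<lfloor>N powr (1/3)\<rfloor>) (D0 * N powr \<delta>) (N powr (1/3))"
    using minor_arc_bounds_exists by blast
  define C4 :: real where "C4 = 7 * (32 * 1600\<^sup>2 * 29) ^ 4"
  define c where "c = (32 * 1600\<^sup>2 * 52 + C4 + C4 powr (h / 4)) * D0 powr \<kappa>"
  have c0: "c \<ge> 0" by (simp add: c_def C4_def)
  have "minor_arc_moment h N \<le> c * (N powr \<epsilon> *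
      (N powr (11/12 * h) + N powr (8/9 * h + 2/9) + N powr (3/4 * h + 2/3)))" if N: "N \<ge> 1" for N
  proof -
    define P where "P = N powr (1/3)"
    define X where "X = nat \<lfloor>P\<rfloor>"
    interpret minor_arc_bounds X "D0 * N powr \<delta>" P
      using loc[OF N] unfolding X_def P_def .
    define R where "R = {n::nat. N / 2 < real n \<and> real n \<le> N}"
    have "R \<subseteq> {1..8 * X ^ 3}"
    proof
      fix n assume "n \<in> R"
      then have n: "real n > 0" "real n \<le> N" using N by (auto simp: R_def)
      have "N = P ^ 3" using N by (simp add: P_def powr_power)
      also have "\<dots> \<le> (2 * real X) ^ 3"
        using X_pos X_le_P P_less by (intro power_mono) auto
      finally have "real n \<le> real (8 * X ^ 3)" using n by (simp add: power_mult_distrib)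
      then have "n \<le> 8 * X ^ 3" by (simp only: of_nat_le_iff)
      then show "n \<in> {1..8 * X ^ 3}" using n by auto
    qed
    then have "(\<Sum>n\<in>R. cmod (coef n) powr h) \<le>
        (32 * 1600\<^sup>2 * 52 + C4 + C4 powr (h / 4)) * (D0 * N powr \<delta>) powr \<kappa> * (y powr (11 * h) + y powr (9 * h + 8))"
      unfolding C4_def \<kappa>_def using assms(1) by (rule sum_coef_powr_le)
    also have "(D0 * N powr \<delta>) powr \<kappa> = D0 powr \<kappa> * N powr \<epsilon>"
      using D0 N \<kappa> by (simp add: powr_mult powr_powr \<delta>_def)
    also have "(32 * 1600\<^sup>2 * 52 + C4 + C4 powr (h / 4)) * (D0 powr \<kappa> * N powr \<epsilon>) * (y powr (11 * h) + y powr (9 * h + 8)) =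
        c * (N powr \<epsilon> * (y powr (11 * h) + y powr (9 * h + 8)))"
      by (simp add: c_def mult.assoc)
    also have "\<dots> \<le> c * (N powr \<epsilon> *
      (N powr (11/12 * h) + N powr (8/9 * h + 2/9) + N powr (3/4 * h + 2/3)))"
    proof (intro mult_left_mono c0)
      \<comment> \<open>y = X^(1/4) and X <= N^(1/3), so exponents of y are divided by 12; thus 11 h
        and 9 h + 8 become 11/12 h and 3/4 h + 2/3.\<close>
      have yN: "y powr t \<le> N powr (t / 12)" if "t \<ge> 0" for t
      proof -
        have "y powr t = real X powr (t / 4)" by (simp add: y_def powr_powr)
        also have "\<dots> \<le> P powr (t / 4)" using X_le_P that by (intro powr_mono2) auto
        also have "\<dots> = N powr (t / 12)" by (simp add: P_def powr_powr)
        finally show ?thesis .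
      qed
      have "y powr (11 * h) \<le> N powr (11/12 * h)"
        using yN[of "11 * h"] assms(1) by simp
      moreover have "y powr (9 * h + 8) \<le> N powr (3/4 * h + 2/3)"
        using yN[of "9 * h + 8"] assms(1) by (simp add: add_divide_distrib)
      ultimately show "y powr (11 * h) + y powr (9 * h + 8) \<le>
          N powr (11/12 * h) + N powr (8/9 * h + 2/9) + N powr (3/4 * h + 2/3)"
        using powr_ge_zero[of N "8/9 * h + 2/9"] by linarith
    qed auto
    finally have "(\<Sum>n\<in>R. cmod (coef n) powr h) \<le> c * (N powr \<epsilon> *
      (N powr (11/12 * h) + N powr (8/9 * h + 2/9) + N powr (3/4 * h + 2/3)))" .
    then show ?thesis
      unfolding minor_arc_moment_def R_def P_def[symmetric] coef_eq .
  qed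
  moreover have "minor_arc_moment h N \<ge> 0" for N
    unfolding minor_arc_moment_def by (intro sum_nonneg) auto
  ultimately have "eventually (\<lambda>N. norm (minor_arc_moment h N) \<le> c * norm (N powr \<epsilon> *
      (N powr (11/12 * h) + N powr (8/9 * h + 2/9) + N powr (3/4 * h + 2/3)))) at_top"
    by (intro eventually_at_top_linorderI[of 1]) simp
  then show ?thesis by (rule bigoI)
qed

end
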